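(* Let $\beta<0$, $\alpha,\delta\in\mathbb{R}$, $T'>0$, $s\ge0$, and let $\psi_0\in H^{\frac{s+1}3}_t(\mathbb{R})$, $\psi_1\in H^{\frac s3}_t(\mathbb{R})$ satisfy $\operatorname{supp}(\psi_0)\subseteq[0,T']$ and $\operatorname{supp}(\psi_1)\subseteq[0,T']$. Let $v$ be the solution of the reduced problem $$\begin{aligned}&iv_t+i\beta v_{xxx}+\alpha v_{xx}+i\delta v_x=0,\quad x>0,\ t>0,\\ &v(x,0)=0,\\ &v(0,t)=\psi_0(t),\quad v_x(0,t)=\psi_1(t),\end{aligned}$$ represented by the formula $$v(x,t)=\sum_{j=0}^1\frac1{2\pi}\int_\Gamma e^{ikx-\omega(k)t}\phi_j(k)\,\mathcal{F}[\psi_j](i\omega(k))\,dk .$$ Then $$\|v(\cdot,t)\|_{H^s_x(\mathbb{R}_+)}\le C\left(1+e^{cT'}\sqrt{T'}\right)\sum_{b=0}^1\|\psi_b\|_{H_t^{\frac{s+1-b}3}(\mathbb{R})},\qquad t\in[0,T'],$$ where the constants $c$ and $C$ may depend only on the fixed parameters such as $s,\alpha,\beta,\delta$.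
   Context: Notation. $\mathbb{R}_+=(0,\infty)$; $\mathcal{F}[\psi](\tau)=\int_{\mathbb{R}}e^{-i\tau t}\psi(t)\,dt$, so for $\psi$ supported in $[0,T']$, $\mathcal{F}[\psi](i\omega)=\int_0^{T'}e^{\omega t}\psi(t)\,dt$ for all $\omega\in\mathbb{C}$. $H^s(\mathbb{R})$ is the usual $L^2$-based Sobolev space, and $H^s(\mathbb{R}_+)$ is the space of restrictions to $\mathbb{R}_+$ of its elements. Symbols. $\omega(k)=-i\beta k^3+i\alpha k^2+i\delta k$, $$\nu_+(k)=-\frac12\left(k-\frac\alpha\beta\right)+i\frac{\sqrt3}2\left(\left(k-\frac\alpha{3\beta}\right)^2-\frac{4(\alpha^2+3\beta\delta)}{9\beta^2}\right)^{1/2}$$ with the principal square root $z^{1/2}=|z|^{1/2}e^{i\mathrm{Arg}(z)/2}$, $\mathrm{Arg}(z)\in(-\pi,\pi]$, and $$\phi_0(k)=(k-\nu_+(k))(\alpha-\beta k-\beta\nu_+(k)),\qquad \phi_1(k)=i\beta(k-\nu_+(k)).$$ Contour $\Gamma$. Fix a number $\ell$ (a fixed parameter): $\ell=\frac{\sqrt{-3(\alpha^2+3\beta\delta)}}{-3\beta}$ if $\alpha^2+3\beta\delta<0$, and any fixed $\ell$ with $\frac{\sqrt{\alpha^2+3\beta\delta}}{-\beta}<\ell<\infty$ if $\alpha^2+3\beta\delta\ge0$. Let $q(m)=\sqrt{3\beta^2m^2+\alpha^2+3\beta\delta}$, $c_1=\frac{\alpha+q(\ell)}{3\beta}$, $c_2=\frac{\alpha-q(\ell)}{3\beta}$,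 and $\gamma_1(m)=m$ ($-\infty<m\le c_1$), $\gamma_2(m)=c_1+im$ ($0<m<\ell$), $\gamma_3(m)=\frac{\alpha+q(m)}{3\beta}+im$ ($m\ge\ell$), $\gamma_4(m)=\frac{\alpha-q(m)}{3\beta}+im$ ($m\ge\ell$), $\gamma_5(m)=c_2+im$ ($0<m<\ell$), $\gamma_6(m)=m$ ($c_2\le m<\infty$). Then $\Gamma=\gamma_1\cup\gamma_2\cup\gamma_3\cup(-\gamma_4)\cup(-\gamma_5)\cup\gamma_6$ if $\alpha^2+3\beta\delta\ge0$, and $\Gamma=\gamma_1\cup\gamma_3\cup(-\gamma_4)\cup\gamma_6$ if $\alpha^2+3\beta\delta<0$; each $\gamma_n$ is oriented by increasing $m$, and $-\gamma_n$ is the reversed curve. The integrals over the real pieces $\gamma_1,\gamma_6$ are understood as inverse Fourier transforms (in the $L^2$ sense). *)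

theory Defs
  imports "HOL-Analysis.Analysis"
begin

section \<open>Square-integrable functions and the Fourier transform\<close>

definition square_integrable :: "(real \<Rightarrow> complex) \<Rightarrow> bool" where
  "square_integrable f \<longleftrightarrow>
     f \<in> borel_measurable lborel \<and> integrable lborel (\<lambda>x. (cmod (f x))\<^sup>2)"

text \<open>The transform is defined at complex frequencies, since it is evaluated
  at \<open>\<i> \<omega>(k)\<close> with \<open>k\<close> on a complex contour.\<close>

definition fourier :: "(real \<Rightarrow> complex) \<Rightarrow> complex \<Rightarrow> complex" where
  "fourier f \<tau> = (LINT t|lborel. exp (- (\<i> * \<tau> * of_real t)) * f t)"

definition truncate :: "real \<Rightarrow> (real \<Rightarrow> complex) \<Rightarrow> real \<Rightarrow> complex" where
  "truncate R f = (\<lambda>x. indicator {-R..R} x *\<^sub>R f x)"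

text \<open>Convergence in \<open>L\<^sup>2\<close>, as the truncation parameter tends to infinity. The
  distance is a nonnegative integral with values in \<open>[0, \<infinity>]\<close>: a Bochner integral
  would be \<open>0\<close> when the integrand is not integrable.\<close>

definition tendsto_L2 :: "(real \<Rightarrow> real \<Rightarrow> complex) \<Rightarrow> (real \<Rightarrow> complex) \<Rightarrow> bool" where
  "tendsto_L2 F g \<longleftrightarrow>
     ((\<lambda>R. \<integral>\<^sup>+x. ennreal ((cmod (F R x - g x))\<^sup>2) \<partial>lborel) \<longlongrightarrow> 0) at_top"

text \<open>The Fourier transform and its inverse on \<open>L\<^sup>2\<close> are given as relations, because
  the transform is determined only up to a null set.\<close>

definition is_L2_fourier :: "(real \<Rightarrow> complex) \<Rightarrow> (real \<Rightarrow> complex) \<Rightarrow> bool" where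
  "is_L2_fourier f g \<longleftrightarrow> square_integrable f \<and> square_integrable g \<and>
     tendsto_L2 (\<lambda>R \<xi>. fourier (truncate R f) (of_real \<xi>)) g"

definition is_L2_inv_fourier :: "(real \<Rightarrow> complex) \<Rightarrow> (real \<Rightarrow> complex) \<Rightarrow> bool" where
  "is_L2_inv_fourier g f \<longleftrightarrow> square_integrable g \<and> square_integrable f \<and>
     tendsto_L2 (\<lambda>R x. 1 / (2 * of_real pi) *
        (LINT k|lborel. exp (\<i> * of_real k * of_real x) * truncate R g k)) f"

definition ess_support :: "(real \<Rightarrow> complex) \<Rightarrow> real set" where
  "ess_support f = - \<Union>{U. open U \<and> (AE x in lborel. x \<in> U \<longrightarrow> f x = 0)}"


section \<open>Sobolev spaces of order \<open>s \<ge> 0\<close>\<close>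

definition sobolev :: "real \<Rightarrow> (real \<Rightarrow> complex) set" where
  "sobolev s = {f. \<exists>g. is_L2_fourier f g \<and>
     integrable lborel (\<lambda>\<xi>. (1 + \<xi>\<^sup>2) powr s * (cmod (g \<xi>))\<^sup>2)}"

text \<open>The value does not depend on the choice of \<open>g\<close>, which is unique almost everywhere.\<close>

definition sobolev_norm :: "real \<Rightarrow> (real \<Rightarrow> complex) \<Rightarrow> real" where
  "sobolev_norm s f = (let g = (SOME g. is_L2_fourier f g) in
     sqrt (LINT \<xi>|lborel. (1 + \<xi>\<^sup>2) powr s * (cmod (g \<xi>))\<^sup>2))"

text \<open>Sobolev spaces on \<open>(0, \<infinity>)\<close>: restrictions of elements of \<open>sobolev s\<close>, with the
  quotient norm. Values at \<open>x \<le> 0\<close> are ignored.\<close>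

definition half_line_extensions :: "real \<Rightarrow> (real \<Rightarrow> complex) \<Rightarrow> (real \<Rightarrow> complex) set" where
  "half_line_extensions s f = {F \<in> sobolev s. AE x in lborel. x > 0 \<longrightarrow> F x = f x}"

definition sobolev_half_line :: "real \<Rightarrow> (real \<Rightarrow> complex) set" where
  "sobolev_half_line s = {f. half_line_extensions s f \<noteq> {}}"

definition sobolev_half_line_norm :: "real \<Rightarrow> (real \<Rightarrow> complex) \<Rightarrow> real" where
  "sobolev_half_line_norm s f = Inf (sobolev_norm s ` half_line_extensions s f)"


section \<open>Symbols\<close>

definition omega :: "real \<Rightarrow> real \<Rightarrow> real \<Rightarrow> complex \<Rightarrow> complex" where
  "omega \<alpha> \<beta> \<delta> k =
     - \<i> * of_real \<beta> * k ^ 3 + \<i> * of_real \<alpha> * k\<^sup>2 + \<i> * of_real \<delta> * k"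

definition nu_plus :: "real \<Rightarrow> real \<Rightarrow> real \<Rightarrow> complex \<Rightarrow> complex" where
  "nu_plus \<alpha> \<beta> \<delta> k =
     - (1 / 2) * (k - of_real (\<alpha> / \<beta>))
     + \<i> * of_real (sqrt 3 / 2) *
       csqrt ((k - of_real (\<alpha> / (3 * \<beta>)))\<^sup>2
              - of_real (4 * (\<alpha>\<^sup>2 + 3 * \<beta> * \<delta>) / (9 * \<beta>\<^sup>2)))"

text \<open>Only the indices \<open>j = 0, 1\<close> are used.\<close>

definition phi :: "real \<Rightarrow> real \<Rightarrow> real \<Rightarrow> nat \<Rightarrow> complex \<Rightarrow> complex" where
  "phi \<alpha> \<beta> \<delta> j k =
     (if j = 0
      then (k - nu_plus \<alpha> \<beta> \<delta> k) * (of_real \<alpha> - of_real \<beta> * k - of_real \<beta> * nu_plus \<alpha> \<beta> \<delta> k)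
      else \<i> * of_real \<beta> * (k - nu_plus \<alpha> \<beta> \<delta> k))"


section \<open>The contour\<close>

definition admissible_l :: "real \<Rightarrow> real \<Rightarrow> real \<Rightarrow> real \<Rightarrow> bool" where
  "admissible_l \<alpha> \<beta> \<delta> l \<longleftrightarrow>
     (if \<alpha>\<^sup>2 + 3 * \<beta> * \<delta> < 0
      then l = sqrt (- 3 * (\<alpha>\<^sup>2 + 3 * \<beta> * \<delta>)) / (- 3 * \<beta>)
      else sqrt (\<alpha>\<^sup>2 + 3 * \<beta> * \<delta>) / (- \<beta>) < l)"

definition q :: "real \<Rightarrow> real \<Rightarrow> real \<Rightarrow> real \<Rightarrow> real" where
  "q \<alpha> \<beta> \<delta> m = sqrt (3 * \<beta>\<^sup>2 * m\<^sup>2 + \<alpha>\<^sup>2 + 3 * \<beta> * \<delta>)"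

definition c1 :: "real \<Rightarrow> real \<Rightarrow> real \<Rightarrow> real \<Rightarrow> real" where
  "c1 \<alpha> \<beta> \<delta> l = (\<alpha> + q \<alpha> \<beta> \<delta> l) / (3 * \<beta>)"

definition c2 :: "real \<Rightarrow> real \<Rightarrow> real \<Rightarrow> real \<Rightarrow> real" where
  "c2 \<alpha> \<beta> \<delta> l = (\<alpha> - q \<alpha> \<beta> \<delta> l) / (3 * \<beta>)"

definition gamma2 :: "real \<Rightarrow> real \<Rightarrow> real \<Rightarrow> real \<Rightarrow> real \<Rightarrow> complex" where
  "gamma2 \<alpha> \<beta> \<delta> l m = Complex (c1 \<alpha> \<beta> \<delta> l) m"

definition gamma3 :: "real \<Rightarrow> real \<Rightarrow> real \<Rightarrow> real \<Rightarrow> complex" where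
  "gamma3 \<alpha> \<beta> \<delta> m = Complex ((\<alpha> + q \<alpha> \<beta> \<delta> m) / (3 * \<beta>)) m"

definition gamma4 :: "real \<Rightarrow> real \<Rightarrow> real \<Rightarrow> real \<Rightarrow> complex" where
  "gamma4 \<alpha> \<beta> \<delta> m = Complex ((\<alpha> - q \<alpha> \<beta> \<delta> m) / (3 * \<beta>)) m"

definition gamma5 :: "real \<Rightarrow> real \<Rightarrow> real \<Rightarrow> real \<Rightarrow> real \<Rightarrow> complex" where
  "gamma5 \<alpha> \<beta> \<delta> l m = Complex (c2 \<alpha> \<beta> \<delta> l) m"

text \<open>\<open>contour_integral\<close> of the library is for paths on \<open>[0, 1]\<close>; the parameter set here may
  be unbounded.\<close>

definition curve_integral ::
    "real set \<Rightarrow> (real \<Rightarrow> complex) \<Rightarrow> (complex \<Rightarrow> complex) \<Rightarrow> complex" where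
  "curve_integral I \<gamma> f = (LINT m:I|lborel. f (\<gamma> m) * vector_derivative \<gamma> (at m))"

text \<open>The non-real part of the contour; the minus signs account for the reversed curves.\<close>

definition nonreal_integral ::
    "real \<Rightarrow> real \<Rightarrow> real \<Rightarrow> real \<Rightarrow> (complex \<Rightarrow> complex) \<Rightarrow> complex" where
  "nonreal_integral \<alpha> \<beta> \<delta> l f =
     (if \<alpha>\<^sup>2 + 3 * \<beta> * \<delta> \<ge> 0
      then curve_integral {0<..<l} (gamma2 \<alpha> \<beta> \<delta> l) f
         + curve_integral {l..} (gamma3 \<alpha> \<beta> \<delta>) f
         - curve_integral {l..} (gamma4 \<alpha> \<beta> \<delta>) f
         - curve_integral {0<..<l} (gamma5 \<alpha> \<beta> \<delta> l) f
      else curve_integral {l..} (gamma3 \<alpha> \<beta> \<delta>) f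
         - curve_integral {l..} (gamma4 \<alpha> \<beta> \<delta>) f)"


section \<open>The representation formula\<close>

definition density ::
    "real \<Rightarrow> real \<Rightarrow> real \<Rightarrow> nat \<Rightarrow> (real \<Rightarrow> complex) \<Rightarrow> real \<Rightarrow> complex \<Rightarrow> complex" where
  "density \<alpha> \<beta> \<delta> j \<psi> t k =
     exp (- omega \<alpha> \<beta> \<delta> k * of_real t) * phi \<alpha> \<beta> \<delta> j k * fourier \<psi> (\<i> * omega \<alpha> \<beta> \<delta> k)"

text \<open>\<open>represented \<alpha> \<beta> \<delta> l \<psi> t u\<close>: for almost every \<open>x > 0\<close>, \<open>u x\<close> is the value at
  \<open>(x, t)\<close> of the contour integral representing the solution \<open>v\<close> of the reduced
  initial-boundary value problem with boundary data
  \<open>v(0, t) = \<psi> 0 t\<close> and \<open>v\<^sub>x(0, t) = \<psi> 1 t\<close>. The functions \<open>w1 j\<close> and \<open>w6 j\<close> are the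
  contributions of the real half-lines, as \<open>L\<^sup>2\<close> inverse Fourier transforms; they already
  include the factor \<open>1 / (2 \<pi>)\<close>. The formula determines \<open>u\<close> almost everywhere on
  \<open>x > 0\<close>, and it is the only property of \<open>v\<close> that is required.\<close>

definition represented ::
    "real \<Rightarrow> real \<Rightarrow> real \<Rightarrow> real \<Rightarrow> (nat \<Rightarrow> real \<Rightarrow> complex) \<Rightarrow> real \<Rightarrow> (real \<Rightarrow> complex) \<Rightarrow> bool"
  where
  "represented \<alpha> \<beta> \<delta> l \<psi> t u \<longleftrightarrow>
     (\<exists>w1 w6 :: nat \<Rightarrow> real \<Rightarrow> complex.
        (\<forall>j\<in>{0..1}.
           is_L2_inv_fourier
             (\<lambda>k. indicator {..c1 \<alpha> \<beta> \<delta> l} k *\<^sub>R density \<alpha> \<beta> \<delta> j (\<psi> j) t (of_real k)) (w1 j) \<and>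
           is_L2_inv_fourier
             (\<lambda>k. indicator {c2 \<alpha> \<beta> \<delta> l..} k *\<^sub>R density \<alpha> \<beta> \<delta> j (\<psi> j) t (of_real k)) (w6 j)) \<and>
        (AE x in lborel. x > 0 \<longrightarrow>
           u x = (\<Sum>j=0..1. w1 j x + w6 j x
                    + 1 / (2 * of_real pi) *
                      nonreal_integral \<alpha> \<beta> \<delta> l
                        (\<lambda>k. exp (\<i> * k * of_real x) * density \<alpha> \<beta> \<delta> j (\<psi> j) t k))))"

end

theory Submission
  imports Defs "HOL-Probability.Probability"
begin

text \<open>
  The norm of \<open>H\<^sup>s(0,\<infinity>)\<close> is an infimum over extensions to the line. The contour integral is a sum of
  integrals over finitely many curves, and the estimate follows once every one of these integrals, as
  a function of \<open>x > 0\<close>, has an extension whose \<open>H\<^sup>s\<close> norm is bounded by the data.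

  On a real half-line the integral is an inverse Fourier transform in \<open>L\<^sup>2\<close> and is its own extension:
  by Fourier inversion (\<open>is_L2_inv_fourier_imp_is_L2_fourier\<close>, a consequence of Plancherel's theorem)
  its Sobolev norm is the weighted \<open>L\<^sup>2\<close> norm of the density.

  On a curve in the upper half-plane the integral superposes the decaying exponentials \<open>exp(ikx)\<close>
  with \<open>Im k > 0\<close>. Each of them is continued to \<open>x \<le> 0\<close> by \<open>exp(i k' x)\<close>, with \<open>k'\<close> the
  conjugate of \<open>k\<close>, times a polynomial in \<open>Im k \<bar>x\<bar>\<close> chosen so that the Fourier transform becomes the
  single fraction \<open>(2 Im k)\<^sup>N / (z u\<^sup>N)\<close>, where \<open>z = i (\<xi> - k)\<close> and \<open>u\<close> is its conjugate. If \<open>N \<ge> s\<close> this decay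
  exchanges the weight \<open>(1 + \<xi>\<^sup>2)\<^sup>s\<close> for \<open>(1 + \<bar>k\<bar>\<^sup>2)\<^sup>s\<close>, and what remains of the kernel is at most a
  constant times Hilbert's kernel \<open>1 / (\<bar>\<xi> - c\<bar> + Im k)\<close>, which is bounded on \<open>L\<^sup>2\<close> by Schur's test. The result is
  \<open>laplace_superposition_half_line\<close>: the extension is bounded by the weighted \<open>L\<^sup>2\<close> norm of the
  density with respect to arc length, for every real order \<open>s \<ge> 0\<close> at once and without interpolation.

  It remains to bound these weighted norms by the data. On the unbounded pieces the symbol
  \<open>\<tau> = i \<omega>(k)\<close> is real, so \<open>\<tau>\<close> can serve as integration variable
  (\<open>curve_energy\<close>). There \<open>\<bar>d\<tau>/dk\<bar>\<close> is at least a multiple of \<open>1 + \<bar>k\<bar>\<^sup>2\<close>, while \<open>\<bar>\<phi>\<^sub>j(k)\<bar>\<close> grows at most like \<open>\<bar>k\<bar>\<close> to the power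
  \<open>2 - j\<close> and \<open>\<bar>\<tau>\<bar>\<close> like \<open>\<bar>k\<bar>\<^sup>3\<close>; the powers match exactly the order \<open>(s + 1 - j)/3\<close> of the Sobolev
  norm of \<open>\<psi>\<^sub>j\<close>. On the two vertical segments the frequency is bounded but complex, and the
  Cauchy-Schwarz inequality on \<open>[0, T']\<close> gives the factor \<open>exp(c T') sqrt T'\<close>
  (\<open>density_bound_bounded_frequencies\<close>).
\<close>

section \<open>Squared norms in \<open>L\<^sup>2\<close>\<close>

text \<open>The values in \<open>[0, \<infinity>]\<close> allow bounds and limits to be stated before integrability is known.\<close>

definition l2sq :: "(real \<Rightarrow> complex) \<Rightarrow> ennreal" where
  "l2sq f = (\<integral>\<^sup>+x. ennreal ((cmod (f x))\<^sup>2) \<partial>lborel)"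

lemma square_integrable_iff_l2sq:
  "square_integrable f \<longleftrightarrow> f \<in> borel_measurable borel \<and> l2sq f < \<infinity>"
  unfolding square_integrable_def l2sq_def
  by (auto simp: integrable_iff_bounded)

text \<open>The first coefficient can be taken arbitrarily close to \<open>1\<close>, which gives the continuity of the norm
without Minkowski's inequality.\<close>

lemma norm_add_sq_weighted_le:
  fixes a b :: complex and e :: real
  assumes "e > 0"
  shows "(cmod (a + b))\<^sup>2 \<le> (1 + e) * (cmod a)\<^sup>2 + (1 + 1 / e) * (cmod b)\<^sup>2"
proof -
  have "(cmod (a + b))\<^sup>2 \<le> (cmod a + cmod b)\<^sup>2"
    by (simp add: norm_triangle_ineq power_mono)
  also have "\<dots> = (cmod a)\<^sup>2 + (cmod b)\<^sup>2 + 2 * (cmod a * cmod b)"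
    by (simp add: power2_eq_square algebra_simps)
  also have "2 * (cmod a * cmod b) \<le> e * (cmod a)\<^sup>2 + (cmod b)\<^sup>2 / e"
  proof -
    have "0 \<le> (sqrt e * cmod a - cmod b / sqrt e)\<^sup>2" by simp
    also have "\<dots> = e * (cmod a)\<^sup>2 + (cmod b)\<^sup>2 / e - 2 * (cmod a * cmod b)"
      using assms by (simp add: power2_diff power_mult_distrib power_divide)
    finally show ?thesis by simp
  qed
  finally show ?thesis by (simp add: algebra_simps)
qed

lemma l2sq_add_weighted_le:
  assumes [measurable]: "f \<in> borel_measurable borel" "g \<in> borel_measurable borel" and "e > 0"
  shows "l2sq (\<lambda>x. f x + g x) \<le> ennreal (1 + e) * l2sq f + ennreal (1 + 1 / e) * l2sq g"
proof -
  have "l2sq (\<lambda>x. f x + g x) \<le> (\<integral>\<^sup>+x. ennreal (1 + e) * ennreal ((cmod (f x))\<^sup>2)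
      + ennreal (1 + 1 / e) * ennreal ((cmod (g x))\<^sup>2) \<partial>lborel)"
    unfolding l2sq_def
  proof (rule nn_integral_mono)
    fix x
    show "ennreal ((cmod (f x + g x))\<^sup>2) \<le> ennreal (1 + e) * ennreal ((cmod (f x))\<^sup>2)
      + ennreal (1 + 1 / e) * ennreal ((cmod (g x))\<^sup>2)"
      using norm_add_sq_weighted_le[OF \<open>e > 0\<close>, of "f x" "g x"] \<open>e > 0\<close>
      by (simp add: ennreal_mult[symmetric] ennreal_plus[symmetric] del: ennreal_plus)
  qed
  also have "\<dots> = ennreal (1 + e) * l2sq f + ennreal (1 + 1 / e) * l2sq g"
    unfolding l2sq_def by (simp add: nn_integral_add nn_integral_cmult)
  finally show ?thesis .
qed

lemma l2sq_add_le:
  assumes "f \<in> borel_measurable borel" "g \<in> borel_measurable borel"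
  shows "l2sq (\<lambda>x. f x + g x) \<le> 2 * l2sq f + 2 * l2sq g"
  using l2sq_add_weighted_le[OF assms, of 1] by simp

lemma l2sq_cmult: "f \<in> borel_measurable borel \<Longrightarrow> l2sq (\<lambda>x. c * f x) = ennreal ((cmod c)\<^sup>2) * l2sq f"
  unfolding l2sq_def by (simp add: norm_mult power_mult_distrib ennreal_mult nn_integral_cmult)

lemma l2sq_minus_commute: "l2sq (\<lambda>x. f x - g x) = l2sq (\<lambda>x. g x - f x)"
  unfolding l2sq_def by (simp add: norm_minus_commute)

lemma l2sq_diff_triangle:
  assumes [measurable]: "f \<in> borel_measurable borel" "g \<in> borel_measurable borel" "h \<in> borel_measurable borel"
  shows "l2sq (\<lambda>x. f x - h x) \<le> 2 * l2sq (\<lambda>x. f x - g x) + 2 * l2sq (\<lambda>x. g x - h x)"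
  using l2sq_add_le[of "\<lambda>x. f x - g x" "\<lambda>x. g x - h x"] by simp

lemma l2sq_diff_le:
  assumes [measurable]: "f \<in> borel_measurable borel" "g \<in> borel_measurable borel"
  shows "l2sq (\<lambda>x. f x - g x) \<le> 2 * l2sq f + 2 * l2sq g"
proof -
  have "l2sq (\<lambda>x. 0 - g x) = l2sq g" unfolding l2sq_def by simp
  then show ?thesis using l2sq_diff_triangle[of f "\<lambda>_. 0" g] by simp
qed

lemma l2sq_cong_AE: "AE x in lborel. f x = g x \<Longrightarrow> l2sq f = l2sq g"
  unfolding l2sq_def by (rule nn_integral_cong_AE) auto

lemma l2sq_eq_0_iff: "f \<in> borel_measurable borel \<Longrightarrow> l2sq f = 0 \<longleftrightarrow> (AE x in lborel. f x = 0)"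
  unfolding l2sq_def by (simp add: nn_integral_0_iff_AE)

lemma square_integrable_diff:
  "square_integrable f \<Longrightarrow> square_integrable g \<Longrightarrow> square_integrable (\<lambda>x. f x - g x)"
  unfolding square_integrable_iff_l2sq
  using l2sq_diff_le[of f g] by (auto simp: ennreal_mult_less_top le_less_trans)

lemma square_integrable_add:
  "square_integrable f \<Longrightarrow> square_integrable g \<Longrightarrow> square_integrable (\<lambda>x. f x + g x)"
  unfolding square_integrable_iff_l2sq
  using l2sq_add_le[of f g] by (auto simp: ennreal_mult_less_top le_less_trans)

lemma square_integrable_product:
  assumes "square_integrable f" "square_integrable g"
  shows "integrable lborel (\<lambda>x. f x * g x)"
proof (rule Bochner_Integration.integrable_bound)
  have [measurable]: "f \<in> borel_measurable borel" "g \<in> borel_measurable borel"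
    using assms by (auto simp: square_integrable_def)
  show "(\<lambda>x. f x * g x) \<in> borel_measurable lborel" by simp
  show "integrable lborel (\<lambda>x. (cmod (f x))\<^sup>2 + (cmod (g x))\<^sup>2)"
    using assms by (simp add: square_integrable_def)
  have "cmod (f x) * cmod (g x) \<le> (cmod (f x))\<^sup>2 + (cmod (g x))\<^sup>2" for x
    using sum_squares_bound[of "cmod (f x)" "cmod (g x)"]
          mult_nonneg_nonneg[of "cmod (f x)" "cmod (g x)"] by (simp add: del: mult_nonneg_nonneg; linarith)
  then show "AE x in lborel. norm (f x * g x) \<le> norm ((cmod (f x))\<^sup>2 + (cmod (g x))\<^sup>2)"
    by (simp add: norm_mult)
qed

section \<open>The multiplication formula and Gaussian means\<close>

abbreviation fhat :: "(real \<Rightarrow> complex) \<Rightarrow> real \<Rightarrow> complex" where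
  "fhat f \<xi> \<equiv> fourier f (complex_of_real \<xi>)"

lemma fourier_measurable [measurable]:
  assumes [measurable]: "f \<in> borel_measurable borel"
  shows "fourier f \<in> borel_measurable borel"
  unfolding fourier_def by measurable

lemma norm_fourier_le:
  assumes "integrable lborel f"
  shows "cmod (fourier f (of_real \<xi>)) \<le> (LINT x|lborel. cmod (f x))"
  unfolding fourier_def
  by (rule order_trans[OF integral_norm_bound]) (simp add: norm_mult)

lemma integrable_fourier_kernel:
  assumes "integrable lborel f"
  shows "integrable lborel (\<lambda>t. exp (- (\<i> * of_real \<xi> * of_real t)) * f t)"
proof (rule Bochner_Integration.integrable_bound[OF assms])
  have [measurable]: "f \<in> borel_measurable borel" using assms by simp
  show "(\<lambda>t. exp (- (\<i> * of_real \<xi> * of_real t)) * f t) \<in> borel_measurable lborel" by measurable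
qed (simp add: norm_mult)

text \<open>Both sides are iterated integrals of \<open>exp(-i x \<xi>) f(x) g(\<xi>)\<close>, which is integrable on the plane.\<close>

lemma fourier_multiplication_formula:
  assumes f: "integrable lborel f" and g: "integrable lborel g"
  shows "(LINT \<xi>|lborel. fourier f (of_real \<xi>) * g \<xi>) = (LINT x|lborel. f x * fourier g (of_real x))"
proof -
  have [measurable]: "f \<in> borel_measurable borel" "g \<in> borel_measurable borel" using f g by auto
  let ?K = "\<lambda>x \<xi>. exp (- (\<i> * of_real \<xi> * of_real x)) * f x * g \<xi>"
  have int: "integrable (lborel \<Otimes>\<^sub>M lborel) (case_prod ?K)"
  proof (rule Bochner_Integration.integrable_bound)
    show "integrable (lborel \<Otimes>\<^sub>M lborel) (\<lambda>(x,y). f x * g y)"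
      using f g by (intro lborel_pair.Fubini_integrable) (auto simp: norm_mult)
    show "case_prod ?K \<in> borel_measurable (lborel \<Otimes>\<^sub>M lborel)" by measurable
  qed (auto simp: norm_mult)
  have "(LINT \<xi>|lborel. LINT x|lborel. ?K x \<xi>) = (LINT x|lborel. LINT \<xi>|lborel. ?K x \<xi>)"
    by (rule lborel_pair.Fubini_integral[OF int])
  moreover have "(LINT x|lborel. ?K x \<xi>) = fourier f (of_real \<xi>) * g \<xi>" for \<xi>
    unfolding fourier_def by simp
  moreover have "(LINT \<xi>|lborel. ?K x \<xi>) = f x * fourier g (of_real x)" for x
  proof -
    have "(LINT \<xi>|lborel. ?K x \<xi>) = (LINT \<xi>|lborel. f x * (exp (- (\<i> * of_real x * of_real \<xi>)) * g \<xi>))"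
      by (rule Bochner_Integration.integral_cong) (auto simp: mult_ac)
    then show ?thesis unfolding fourier_def by simp
  qed
  ultimately show ?thesis by (simp only:)
qed

text \<open>A rescaling of the characteristic function of the standard normal distribution.\<close>

lemma fourier_gaussian:
  assumes "e > 0"
  shows "(LINT \<xi>|lborel. exp (- (\<i> * of_real \<xi> * of_real z)) * of_real (exp (- (e\<^sup>2 * \<xi>\<^sup>2 / 2))))
    = of_real (2 * pi * normal_density 0 e z)"
proof -
  let ?G = "\<lambda>\<xi>. exp (- (\<i> * of_real \<xi> * of_real z)) * complex_of_real (exp (- (e\<^sup>2 * \<xi>\<^sup>2 / 2)))"
  have "(LINT \<xi>|lborel. ?G \<xi>) = \<bar>1/e\<bar> *\<^sub>R (LINT \<xi>|lborel. ?G (0 + (1/e) * \<xi>))"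
    by (rule lborel_integral_real_affine) (use assms in simp)
  also have "(LINT \<xi>|lborel. ?G (0 + (1/e) * \<xi>)) =
     (LINT \<xi>|lborel. sqrt (2*pi) *\<^sub>R (std_normal_density \<xi> *\<^sub>R exp (\<i> * of_real ((-z/e) * \<xi>))))"
    using assms
    by (intro Bochner_Integration.integral_cong refl)
       (simp add: normal_density_def scaleR_conv_of_real field_simps power_divide)
  also have "\<dots> = sqrt (2*pi) *\<^sub>R char std_normal_distribution (-z/e)"
    unfolding char_def
    by (subst integral_density)
       (simp_all add: scaleR_scaleR[symmetric] del: scaleR_scaleR)
  also have "\<dots> = of_real (sqrt (2*pi) * exp (- (z\<^sup>2 / e\<^sup>2) / 2))"
    by (simp add: char_std_normal_distribution scaleR_conv_of_real power_divide)
  also have "\<bar>1/e\<bar> *\<^sub>R (\<dots>::complex) = of_real (1/e * (sqrt (2*pi) * exp (- (z\<^sup>2 / e\<^sup>2) / 2)))"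
    using assms by (simp add: scaleR_conv_of_real)
  also have "1/e * (sqrt (2*pi) * exp (- (z\<^sup>2 / e\<^sup>2) / 2)) = 2 * pi * normal_density 0 e z"
    using assms by (simp add: normal_density_def real_sqrt_mult field_simps)
  finally show ?thesis .
qed

lemma cnj_borel_measurable [measurable]: "cnj \<in> borel_measurable borel"
  by (intro borel_measurable_continuous_onI continuous_intros)

lemma integrable_gaussian:
  assumes "e > 0"
  shows "integrable lborel (\<lambda>\<xi>::real. exp (- (e\<^sup>2 * \<xi>\<^sup>2 / 2)))"
proof -
  have "integrable lborel (\<lambda>\<xi>. sqrt (2 * pi * (1/e)\<^sup>2) * normal_density 0 (1/e) \<xi>)"
    using assms by (intro integrable_mult_right integrable_normal_density) simp
  also have "(\<lambda>\<xi>. sqrt (2 * pi * (1/e)\<^sup>2) * normal_density 0 (1/e) \<xi>) = (\<lambda>\<xi>. exp (- (e\<^sup>2 * \<xi>\<^sup>2 / 2)))"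
    using assms by (auto simp: normal_density_def power_divide field_simps)
  finally show ?thesis .
qed

text \<open>The convolution of \<open>f\<close> with a Gaussian of width \<open>e\<close>. The average over translates has a kernel that
does not depend on \<open>e\<close>, which suits dominated convergence as \<open>e\<close> tends to \<open>0\<close>.\<close>

definition gaussian_mean :: "real \<Rightarrow> (real \<Rightarrow> complex) \<Rightarrow> real \<Rightarrow> complex" where
  "gaussian_mean e f x = (LINT w|lborel. std_normal_density w *\<^sub>R f (x + e * w))"

lemma gaussian_mean_measurable [measurable]:
  assumes [measurable]: "f \<in> borel_measurable borel"
  shows "gaussian_mean e f \<in> borel_measurable borel"
  unfolding gaussian_mean_def by measurable

lemma gaussian_mean_eq:
  assumes "e > 0"
  shows "gaussian_mean e f x = (LINT y|lborel. of_real (normal_density 0 e (y - x)) * f y)"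
proof -
  have "(LINT y|lborel. of_real (normal_density 0 e (y - x)) * f y)
    = \<bar>e\<bar> *\<^sub>R (LINT w|lborel. of_real (normal_density 0 e (x + e * w - x)) * f (x + e * w))"
    by (rule lborel_integral_real_affine) (use assms in simp)
  also have "\<dots> = (LINT w|lborel. e *\<^sub>R (of_real (normal_density 0 e (x + e * w - x)) * f (x + e * w)))"
    using assms by simp
  also have "\<dots> = gaussian_mean e f x"
    unfolding gaussian_mean_def using assms
    by (intro Bochner_Integration.integral_cong refl)
       (simp add: normal_density_def scaleR_conv_of_real real_sqrt_mult power_mult_distrib)
  finally show ?thesis by simp
qed

lemma integrable_fourier_gaussian:
  assumes f: "integrable lborel f" and "e > 0"
  shows "integrable lborel (\<lambda>\<xi>. cnj (fourier f (of_real \<xi>)) * of_real (exp (- (e\<^sup>2 * \<xi>\<^sup>2 / 2))))"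
proof (rule Bochner_Integration.integrable_bound)
  have [measurable]: "f \<in> borel_measurable borel" using f by auto
  show "integrable lborel (\<lambda>\<xi>. (LINT x|lborel. cmod (f x)) * exp (- (e\<^sup>2 * \<xi>\<^sup>2 / 2)))"
    by (intro integrable_mult_right integrable_gaussian \<open>e > 0\<close>)
  show "(\<lambda>\<xi>. cnj (fourier f (of_real \<xi>)) * of_real (exp (- (e\<^sup>2 * \<xi>\<^sup>2 / 2)))) \<in> borel_measurable lborel"
    by measurable
  show "AE \<xi> in lborel. norm (cnj (fourier f (of_real \<xi>)) * of_real (exp (- (e\<^sup>2 * \<xi>\<^sup>2 / 2))))
     \<le> norm ((LINT x|lborel. cmod (f x)) * exp (- (e\<^sup>2 * \<xi>\<^sup>2 / 2)))"
    using norm_fourier_le[OF f] by (auto simp: norm_mult)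
qed

lemma fourier_modulated_gaussian:
  assumes "e > 0"
  shows "fourier (\<lambda>\<xi>. exp (\<i> * of_real x * of_real \<xi>) * of_real (exp (- (e\<^sup>2 * \<xi>\<^sup>2 / 2)))) (of_real y)
    = of_real (2 * pi * normal_density 0 e (y - x))"
proof -
  have *: "exp (- (\<i> * of_real y * of_real \<xi>)) * (exp (\<i> * of_real x * of_real \<xi>) * c)
    = exp (- (\<i> * of_real \<xi> * of_real (y - x))) * c" for \<xi> :: real and c :: complex
  proof -
    have "exp (- (\<i> * of_real y * of_real \<xi>)) * exp (\<i> * of_real x * of_real \<xi>)
      = exp (- (\<i> * of_real \<xi> * of_real (y - x)))"
      unfolding exp_add[symmetric] by (simp add: algebra_simps)
    then show ?thesis by (simp only: mult.assoc[symmetric])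
  qed
  show ?thesis unfolding fourier_gaussian[OF assms, symmetric] fourier_def * ..
qed

text \<open>The Gaussian factor makes the square of the transform integrable. Two applications of the
multiplication formula, the first to \<open>f\<close> and its damped conjugate transform, the second to \<open>f\<close> and a
modulated Gaussian, move this factor to the other side, where it acts as an approximate identity.\<close>

lemma gaussian_energy:
  assumes f: "integrable lborel f" and e: "e > 0"
  shows "integrable lborel (\<lambda>\<xi>. (cmod (fourier f (of_real \<xi>)))\<^sup>2 * exp (- (e\<^sup>2 * \<xi>\<^sup>2 / 2)))"
    and "complex_of_real (LINT \<xi>|lborel. (cmod (fourier f (of_real \<xi>)))\<^sup>2 * exp (- (e\<^sup>2 * \<xi>\<^sup>2 / 2)))
      = of_real (2 * pi) * (LINT x|lborel. f x * cnj (gaussian_mean e f x))"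
proof -
  have [measurable]: "f \<in> borel_measurable borel" using f by auto
  let ?g = "\<lambda>\<xi>. exp (- (e\<^sup>2 * \<xi>\<^sup>2 / 2))"
  let ?G = "\<lambda>\<xi>. cnj (fourier f (of_real \<xi>)) * complex_of_real (?g \<xi>)"
  note G = integrable_fourier_gaussian[OF f e]
  have prod: "fourier f (of_real \<xi>) * ?G \<xi> = of_real ((cmod (fourier f (of_real \<xi>)))\<^sup>2 * ?g \<xi>)" for \<xi>
    by (simp only: of_real_mult complex_norm_square mult.assoc)
  have "integrable lborel (\<lambda>\<xi>. fourier f (of_real \<xi>) * ?G \<xi>)"
  proof (rule Bochner_Integration.integrable_bound)
    show "integrable lborel (\<lambda>\<xi>. complex_of_real (LINT x|lborel. cmod (f x)) * ?G \<xi>)"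
      by (intro integrable_mult_right G)
    show "AE \<xi> in lborel. norm (fourier f (of_real \<xi>) * ?G \<xi>) \<le> norm (complex_of_real (LINT x|lborel. cmod (f x)) * ?G \<xi>)"
      using norm_fourier_le[OF f] by (auto simp: norm_mult intro!: mult_right_mono)
  qed measurable
  then have int: "integrable lborel (\<lambda>\<xi>. complex_of_real ((cmod (fourier f (of_real \<xi>)))\<^sup>2 * ?g \<xi>))"
    unfolding prod .
  then show "integrable lborel (\<lambda>\<xi>. (cmod (fourier f (of_real \<xi>)))\<^sup>2 * ?g \<xi>)"
    by (simp only: complex_of_real_integrable_eq)
  have FG: "fourier ?G (of_real x) = of_real (2 * pi) * cnj (gaussian_mean e f x)" for x
  proof -
    let ?H = "\<lambda>\<xi>. exp (\<i> * of_real x * of_real \<xi>) * complex_of_real (?g \<xi>)"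
    have H: "integrable lborel ?H"
    proof (rule Bochner_Integration.integrable_bound[OF integrable_gaussian[OF e]])
      show "?H \<in> borel_measurable lborel" by measurable
    qed (simp add: norm_mult)
    have "cnj (fourier ?G (of_real x)) = (LINT \<xi>|lborel. cnj (exp (- (\<i> * of_real x * of_real \<xi>)) * ?G \<xi>))"
      unfolding fourier_def[of ?G] by (rule Bochner_Integration.integral_cnj[symmetric])
    also have "\<dots> = (LINT \<xi>|lborel. fourier f (of_real \<xi>) * ?H \<xi>)"
      by (intro Bochner_Integration.integral_cong refl) (simp add: exp_cnj mult_ac)
    also have "\<dots> = (LINT y|lborel. f y * fourier ?H (of_real y))"
      by (rule fourier_multiplication_formula[OF f H])
    also have "\<dots> = (LINT y|lborel. of_real (2 * pi) * (of_real (normal_density 0 e (y - x)) * f y))"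
      unfolding fourier_modulated_gaussian[OF e] by (intro Bochner_Integration.integral_cong refl) simp
    also have "\<dots> = of_real (2 * pi) * gaussian_mean e f x"
      unfolding gaussian_mean_eq[OF e] by simp
    finally have "cnj (cnj (fourier ?G (of_real x))) = cnj (of_real (2 * pi) * gaussian_mean e f x)" by simp
    then show ?thesis by simp
  qed
  have "complex_of_real (LINT \<xi>|lborel. (cmod (fourier f (of_real \<xi>)))\<^sup>2 * ?g \<xi>)
     = (LINT \<xi>|lborel. fourier f (of_real \<xi>) * ?G \<xi>)"
    unfolding prod by (rule integral_complex_of_real[symmetric])
  also have "\<dots> = (LINT x|lborel. f x * fourier ?G (of_real x))"
    by (rule fourier_multiplication_formula[OF f G])
  also have "\<dots> = (LINT x|lborel. of_real (2 * pi) * (f x * cnj (gaussian_mean e f x)))"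
    unfolding FG by (intro Bochner_Integration.integral_cong refl) simp
  also have "\<dots> = of_real (2 * pi) * (LINT x|lborel. f x * cnj (gaussian_mean e f x))"
    by simp
  finally show "complex_of_real (LINT \<xi>|lborel. (cmod (fourier f (of_real \<xi>)))\<^sup>2 * ?g \<xi>)
     = of_real (2 * pi) * (LINT x|lborel. f x * cnj (gaussian_mean e f x))" .
qed

lemma nn_integral_shift:
  fixes c :: real
  assumes [measurable]: "g \<in> borel_measurable borel"
  shows "(\<integral>\<^sup>+x. g (x + c) \<partial>lborel) = (\<integral>\<^sup>+x. g x \<partial>lborel)"
  using nn_integral_real_affine[of g 1 c] by (simp add: add.commute)

text \<open>Since \<open>a b \<le> a\<^sup>2/2 + b\<^sup>2/2\<close> and the Gaussian has total mass one, the average over translates costs nothing.\<close>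

lemma gaussian_correlation_le:
  assumes [measurable]: "f \<in> borel_measurable borel" and "l2sq f < \<infinity>"
  shows "ennreal (cmod (LINT x|lborel. f x * cnj (gaussian_mean e f x))) \<le> l2sq f"
proof (cases "integrable lborel (\<lambda>x. f x * cnj (gaussian_mean e f x))")
  case False
  then show ?thesis by (simp add: not_integrable_integral_eq)
next
  case True
  let ?d = std_normal_density
  have d1: "(\<integral>\<^sup>+w. ennreal (?d w) \<partial>lborel) = 1"
    using nn_integral_eq_integral[of lborel ?d] by simp
  have bound: "ennreal (cmod (f x * cnj (gaussian_mean e f x)))
     \<le> (\<integral>\<^sup>+w. ennreal (?d w) * (ennreal (1/2 * (cmod (f x))\<^sup>2) + ennreal (1/2 * (cmod (f (x + e * w)))\<^sup>2)) \<partial>lborel)" for x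
  proof -
    have "ennreal (cmod (gaussian_mean e f x)) \<le> (\<integral>\<^sup>+w. ennreal (cmod (?d w *\<^sub>R f (x + e * w))) \<partial>lborel)"
      unfolding gaussian_mean_def
      by (cases "integrable lborel (\<lambda>w. ?d w *\<^sub>R f (x + e * w))",
          rule integral_norm_bound_ennreal, assumption, simp add: not_integrable_integral_eq)
    then have "ennreal (cmod (f x * cnj (gaussian_mean e f x)))
       \<le> ennreal (cmod (f x)) * (\<integral>\<^sup>+w. ennreal (cmod (?d w *\<^sub>R f (x + e * w))) \<partial>lborel)"
      by (simp add: norm_mult ennreal_mult mult_left_mono)
    also have "\<dots> = (\<integral>\<^sup>+w. ennreal (cmod (f x)) * ennreal (cmod (?d w *\<^sub>R f (x + e * w))) \<partial>lborel)"
      by (rule nn_integral_cmult[symmetric]) simp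
    also have "\<dots> \<le> (\<integral>\<^sup>+w. ennreal (?d w) * (ennreal (1/2 * (cmod (f x))\<^sup>2) + ennreal (1/2 * (cmod (f (x + e * w)))\<^sup>2)) \<partial>lborel)"
    proof (rule nn_integral_mono)
      fix w
      let ?a = "cmod (f x)" and ?b = "cmod (f (x + e * w))"
      have "cmod (f x) * cmod (f (x + e * w)) \<le> 1/2 * (cmod (f x))\<^sup>2 + 1/2 * (cmod (f (x + e * w)))\<^sup>2"
        using sum_squares_bound[of "cmod (f x)" "cmod (f (x + e * w))"] by simp
      then have "?d w * (cmod (f x) * cmod (f (x + e * w))) \<le> ?d w * (1/2 * (cmod (f x))\<^sup>2 + 1/2 * (cmod (f (x + e * w)))\<^sup>2)"
        by (rule mult_left_mono) simp
      then have "ennreal (?a * (?d w * ?b)) \<le> ennreal (?d w * (1/2 * ?a\<^sup>2 + 1/2 * ?b\<^sup>2))"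
        by (intro ennreal_leI) (simp only: mult.left_commute)
      moreover have "ennreal (?d w * (1/2 * ?a\<^sup>2 + 1/2 * ?b\<^sup>2)) = ennreal (?d w) * (ennreal (1/2 * ?a\<^sup>2) + ennreal (1/2 * ?b\<^sup>2))"
        by (subst ennreal_mult) (simp_all add: ennreal_plus del: times_divide_eq_left)
      moreover have "cmod (?d w *\<^sub>R f (x + e * w)) = ?d w * ?b" by simp
      moreover have "ennreal (?a * (?d w * ?b)) = ennreal ?a * ennreal (?d w * ?b)"
        by (rule ennreal_mult) simp_all
      ultimately show "ennreal ?a * ennreal (cmod (?d w *\<^sub>R f (x + e * w)))
         \<le> ennreal (?d w) * (ennreal (1/2 * ?a\<^sup>2) + ennreal (1/2 * ?b\<^sup>2))"
        by (simp only:)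
    qed
    finally show ?thesis .
  qed
  have half: "(\<integral>\<^sup>+x. ennreal (1/2 * (cmod (f x))\<^sup>2) \<partial>lborel) = ennreal (1/2) * l2sq f"
    unfolding l2sq_def by (subst nn_integral_cmult[symmetric], simp, intro nn_integral_cong, rule ennreal_mult) simp_all
  have "ennreal (cmod (LINT x|lborel. f x * cnj (gaussian_mean e f x)))
     \<le> (\<integral>\<^sup>+x. ennreal (cmod (f x * cnj (gaussian_mean e f x))) \<partial>lborel)"
    by (rule integral_norm_bound_ennreal[OF True])
  also have "\<dots> \<le> (\<integral>\<^sup>+x. \<integral>\<^sup>+w. ennreal (?d w) * (ennreal (1/2 * (cmod (f x))\<^sup>2) + ennreal (1/2 * (cmod (f (x + e * w)))\<^sup>2)) \<partial>lborel \<partial>lborel)"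
    by (intro nn_integral_mono bound)
  also have "\<dots> = (\<integral>\<^sup>+w. \<integral>\<^sup>+x. ennreal (?d w) * (ennreal (1/2 * (cmod (f x))\<^sup>2) + ennreal (1/2 * (cmod (f (x + e * w)))\<^sup>2)) \<partial>lborel \<partial>lborel)"
    by (rule lborel_pair.Fubini') measurable
  also have "\<dots> = (\<integral>\<^sup>+w. ennreal (?d w) * l2sq f \<partial>lborel)"
  proof (rule nn_integral_cong)
    fix w
    have "(\<integral>\<^sup>+x. ennreal (?d w) * (ennreal (1/2 * (cmod (f x))\<^sup>2) + ennreal (1/2 * (cmod (f (x + e * w)))\<^sup>2)) \<partial>lborel)
      = ennreal (?d w) * ((\<integral>\<^sup>+x. ennreal (1/2 * (cmod (f x))\<^sup>2) \<partial>lborel) + (\<integral>\<^sup>+x. ennreal (1/2 * (cmod (f (x + e * w)))\<^sup>2) \<partial>lborel))"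
      by (subst nn_integral_cmult, simp, subst nn_integral_add) simp_all
    also have "(\<integral>\<^sup>+x. ennreal (1/2 * (cmod (f (x + e * w)))\<^sup>2) \<partial>lborel) = (\<integral>\<^sup>+x. ennreal (1/2 * (cmod (f x))\<^sup>2) \<partial>lborel)"
      by (rule nn_integral_shift) simp
    also have "(\<integral>\<^sup>+x. ennreal (1/2 * (cmod (f x))\<^sup>2) \<partial>lborel) + (\<integral>\<^sup>+x. ennreal (1/2 * (cmod (f x))\<^sup>2) \<partial>lborel) = l2sq f"
    proof -
      have "ennreal (1/2) + ennreal (1/2) = 1" by (subst ennreal_plus[symmetric]) simp_all
      then show ?thesis unfolding half by (metis distrib_right mult_1)
    qed
    finally show "(\<integral>\<^sup>+x. ennreal (?d w) * (ennreal (1/2 * (cmod (f x))\<^sup>2) + ennreal (1/2 * (cmod (f (x + e * w)))\<^sup>2)) \<partial>lborel)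
       = ennreal (?d w) * l2sq f" .
  qed
  also have "\<dots> = l2sq f"
    using d1 by (simp add: nn_integral_multc)
  finally show ?thesis .
qed

lemma nn_gaussian_energy:
  assumes f: "integrable lborel f" and e: "e > 0"
  shows "ennreal (2 * pi * cmod (LINT x|lborel. f x * cnj (gaussian_mean e f x)))
    = (\<integral>\<^sup>+\<xi>. ennreal ((cmod (fhat f \<xi>))\<^sup>2 * exp (- (e\<^sup>2 * \<xi>\<^sup>2 / 2))) \<partial>lborel)"
proof -
  have "2 * pi * cmod (LINT x|lborel. f x * cnj (gaussian_mean e f x))
     = cmod (of_real (2 * pi) * (LINT x|lborel. f x * cnj (gaussian_mean e f x)))"
    by (simp add: norm_mult)
  also have "\<dots> = (LINT \<xi>|lborel. (cmod (fhat f \<xi>))\<^sup>2 * exp (- (e\<^sup>2 * \<xi>\<^sup>2 / 2)))"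
    unfolding gaussian_energy(2)[OF f e, symmetric] norm_of_real
    by (intro abs_of_nonneg Bochner_Integration.integral_nonneg) simp
  finally show ?thesis
    using nn_integral_eq_integral[OF gaussian_energy(1)[OF f e]] by simp
qed

section \<open>Plancherel's theorem\<close>

text \<open>Fatou's lemma removes the Gaussian factor from \<open>gaussian_energy\<close>.\<close>

lemma plancherel_le:
  assumes f: "integrable lborel f" and sq: "square_integrable f"
  shows "l2sq (fhat f) \<le> ennreal (2 * pi) * l2sq f"
proof -
  have [measurable]: "f \<in> borel_measurable borel" using f by auto
  let ?e = "\<lambda>n::nat. 1 / (real n + 1)"
  let ?h = "\<lambda>n \<xi>. ennreal ((cmod (fhat f \<xi>))\<^sup>2 * exp (- ((?e n)\<^sup>2 * \<xi>\<^sup>2 / 2)))"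
  have e0: "?e \<longlonglongrightarrow> 0"
    using LIMSEQ_Suc[OF lim_1_over_n] by (simp add: add.commute)
  have lim: "(\<lambda>n. ?h n \<xi>) \<longlonglongrightarrow> ennreal ((cmod (fhat f \<xi>))\<^sup>2)" for \<xi>
  proof -
    have "(\<lambda>n. (cmod (fhat f \<xi>))\<^sup>2 * exp (- ((?e n)\<^sup>2 * \<xi>\<^sup>2 / 2))) \<longlonglongrightarrow> (cmod (fhat f \<xi>))\<^sup>2 * exp (- (0\<^sup>2 * \<xi>\<^sup>2 / 2))"
      by (intro tendsto_intros e0) simp
    then show ?thesis by (intro tendsto_ennrealI) simp
  qed
  have "l2sq (fhat f) = (\<integral>\<^sup>+\<xi>. liminf (\<lambda>n. ?h n \<xi>) \<partial>lborel)"
    unfolding l2sq_def using lim_imp_Liminf[OF _ lim] by simp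
  also have "\<dots> \<le> liminf (\<lambda>n. \<integral>\<^sup>+\<xi>. ?h n \<xi> \<partial>lborel)"
    by (rule nn_integral_liminf) measurable
  also have "\<dots> \<le> ennreal (2 * pi) * l2sq f"
  proof (rule Liminf_le)
    show "\<forall>\<^sub>F n in sequentially. (\<integral>\<^sup>+\<xi>. ?h n \<xi> \<partial>lborel) \<le> ennreal (2 * pi) * l2sq f"
    proof (rule always_eventually, rule allI)
      fix n
      have "(\<integral>\<^sup>+\<xi>. ?h n \<xi> \<partial>lborel) = ennreal (2 * pi) * ennreal (cmod (LINT x|lborel. f x * cnj (gaussian_mean (?e n) f x)))"
        by (subst nn_gaussian_energy[OF f, symmetric]) (auto simp: ennreal_mult add_pos_nonneg)
      also have "\<dots> \<le> ennreal (2 * pi) * l2sq f"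
        using gaussian_correlation_le[of f] sq
        by (intro mult_left_mono) (auto simp: square_integrable_iff_l2sq)
      finally show "(\<integral>\<^sup>+\<xi>. ?h n \<xi> \<partial>lborel) \<le> ennreal (2 * pi) * l2sq f" .
    qed
  qed simp
  finally show ?thesis .
qed

text \<open>For continuous bounded \<open>f\<close> the Gaussian means converge pointwise and boundedly to \<open>f\<close>, so the damped
energies tend to \<open>2 \<pi> l2sq f\<close>; and damping only lowers the energy.\<close>

lemma plancherel_continuous:
  assumes f: "integrable lborel f" and cont: "continuous_on UNIV f" and bnd: "\<And>x. cmod (f x) \<le> B"
  shows "ennreal (2 * pi) * l2sq f \<le> l2sq (fhat f)"
proof -
  have [measurable]: "f \<in> borel_measurable borel" using f by auto
  let ?e = "\<lambda>n::nat. 1 / (real n + 1)"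
  have e0: "?e \<longlonglongrightarrow> 0"
    using LIMSEQ_Suc[OF lim_1_over_n] by (simp add: add.commute)
  have mean: "(\<lambda>n. gaussian_mean (?e n) f x) \<longlonglongrightarrow> f x" for x
  proof -
    have "(\<lambda>n. LINT w|lborel. std_normal_density w *\<^sub>R f (x + ?e n * w)) \<longlonglongrightarrow> (LINT w|lborel. std_normal_density w *\<^sub>R f x)"
    proof (rule integral_dominated_convergence)
      show "integrable lborel (\<lambda>w. std_normal_density w * B)" by simp
      show "AE w in lborel. norm (std_normal_density w *\<^sub>R f (x + ?e n * w)) \<le> std_normal_density w * B" for n
        using bnd by (auto intro!: mult_left_mono)
      show "AE w in lborel. (\<lambda>n. std_normal_density w *\<^sub>R f (x + ?e n * w)) \<longlonglongrightarrow> std_normal_density w *\<^sub>R f x"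
      proof (rule AE_I2)
        fix w
        have "(\<lambda>n. x + ?e n * w) \<longlonglongrightarrow> x + 0 * w" by (intro tendsto_intros e0)
        then have "(\<lambda>n. f (x + ?e n * w)) \<longlonglongrightarrow> f x"
          using continuous_on_tendsto_compose[OF cont, of _ "x + 0 * w"] by simp
        then show "(\<lambda>n. std_normal_density w *\<^sub>R f (x + ?e n * w)) \<longlonglongrightarrow> std_normal_density w *\<^sub>R f x"
          by (intro tendsto_intros)
      qed
    qed simp_all
    then show ?thesis unfolding gaussian_mean_def by simp
  qed
  have mbnd: "cmod (gaussian_mean e f x) \<le> B" for e x
  proof -
    have le: "norm (std_normal_density w *\<^sub>R f (x + e * w)) \<le> std_normal_density w * B" for w
      using bnd by (auto intro!: mult_left_mono)
    have "integrable lborel (\<lambda>w. std_normal_density w *\<^sub>R f (x + e * w))"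
    proof (rule Bochner_Integration.integrable_bound)
      show "integrable lborel (\<lambda>w. std_normal_density w * B)" by simp
      show "AE w in lborel. norm (std_normal_density w *\<^sub>R f (x + e * w)) \<le> norm (std_normal_density w * B)"
        using le by (intro AE_I2) (metis abs_ge_self order_trans real_norm_def)
    qed simp
    then have "(LINT w|lborel. norm (std_normal_density w *\<^sub>R f (x + e * w))) \<le> (LINT w|lborel. std_normal_density w * B)"
      using le by (intro integral_mono integrable_norm) simp_all
    then have "cmod (gaussian_mean e f x) \<le> (LINT w|lborel. std_normal_density w * B)"
      unfolding gaussian_mean_def by (rule order_trans[OF integral_norm_bound])
    then show ?thesis by simp
  qed
  have lim: "(\<lambda>n. LINT x|lborel. f x * cnj (gaussian_mean (?e n) f x)) \<longlonglongrightarrow> (LINT x|lborel. f x * cnj (f x))"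
  proof (rule integral_dominated_convergence)
    show "integrable lborel (\<lambda>x. cmod (f x) * B)" using f by simp
    show "AE x in lborel. norm (f x * cnj (gaussian_mean (?e n) f x)) \<le> cmod (f x) * B" for n
      using mbnd by (auto simp: norm_mult intro!: mult_left_mono)
    show "AE x in lborel. (\<lambda>n. f x * cnj (gaussian_mean (?e n) f x)) \<longlonglongrightarrow> f x * cnj (f x)"
      by (intro AE_I2 tendsto_intros mean)
  qed simp_all
  have sq: "integrable lborel (\<lambda>x. (cmod (f x))\<^sup>2)"
  proof (rule Bochner_Integration.integrable_bound)
    show "integrable lborel (\<lambda>x. cmod (f x) * B)" using f by simp
    show "AE x in lborel. norm ((cmod (f x))\<^sup>2) \<le> norm (cmod (f x) * B)"
    proof (rule AE_I2)
      fix x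
      have "cmod (f x) * cmod (f x) \<le> cmod (f x) * B" using bnd by (intro mult_left_mono) simp_all
      also have "\<dots> \<le> norm (cmod (f x) * B)" by simp
      finally show "norm ((cmod (f x))\<^sup>2) \<le> norm (cmod (f x) * B)" by (simp add: power2_eq_square)
    qed
  qed simp
  have "(LINT x|lborel. f x * cnj (f x)) = of_real (LINT x|lborel. (cmod (f x))\<^sup>2)"
    by (subst integral_complex_of_real[symmetric]) (simp add: complex_norm_square[symmetric] del: of_real_power)
  then have "cmod (LINT x|lborel. f x * cnj (f x)) = (LINT x|lborel. (cmod (f x))\<^sup>2)" by simp
  then have limn: "(\<lambda>n. ennreal (2 * pi * cmod (LINT x|lborel. f x * cnj (gaussian_mean (?e n) f x))))
     \<longlonglongrightarrow> ennreal (2 * pi * (LINT x|lborel. (cmod (f x))\<^sup>2))"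
    using tendsto_norm[OF lim] by (intro tendsto_ennrealI tendsto_intros) simp
  have "ennreal (2 * pi * (LINT x|lborel. (cmod (f x))\<^sup>2)) \<le> l2sq (fhat f)"
  proof (rule LIMSEQ_le_const2[OF limn], intro exI allI impI)
    fix n :: nat
    have "ennreal (2 * pi * cmod (LINT x|lborel. f x * cnj (gaussian_mean (?e n) f x)))
       = (\<integral>\<^sup>+\<xi>. ennreal ((cmod (fhat f \<xi>))\<^sup>2 * exp (- ((?e n)\<^sup>2 * \<xi>\<^sup>2 / 2))) \<partial>lborel)"
      by (rule nn_gaussian_energy[OF f]) (simp add: add_pos_nonneg)
    also have "\<dots> \<le> l2sq (fhat f)"
      unfolding l2sq_def by (intro nn_integral_mono ennreal_leI mult_left_le) auto
    finally show "ennreal (2 * pi * cmod (LINT x|lborel. f x * cnj (gaussian_mean (?e n) f x))) \<le> l2sq (fhat f)" .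
  qed
  moreover have "l2sq f = ennreal (LINT x|lborel. (cmod (f x))\<^sup>2)"
    unfolding l2sq_def by (rule nn_integral_eq_integral[OF sq]) simp
  ultimately show ?thesis by (simp add: ennreal_mult)
qed

lemma fhat_diff:
  assumes "integrable lborel f" "integrable lborel g"
  shows "fhat (\<lambda>x. f x - g x) \<xi> = fhat f \<xi> - fhat g \<xi>"
  unfolding fourier_def right_diff_distrib
  by (intro Bochner_Integration.integral_diff integrable_fourier_kernel assms)

lemma fhat_add:
  assumes "integrable lborel f" "integrable lborel g"
  shows "fhat (\<lambda>x. f x + g x) \<xi> = fhat f \<xi> + fhat g \<xi>"
  unfolding fourier_def distrib_left
  by (intro Bochner_Integration.integral_add integrable_fourier_kernel assms)

lemma fhat_cmult: "fhat (\<lambda>x. c * f x) \<xi> = c * fhat f \<xi>"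
proof -
  have "exp (- (\<i> * of_real \<xi> * of_real t)) * (c * f t) = c * (exp (- (\<i> * of_real \<xi> * of_real t)) * f t)" for t
    by (simp only: mult.left_commute)
  then show ?thesis unfolding fourier_def by (simp only: integral_mult_right_zero)
qed

lemma ennreal_le_vanishing_error:
  fixes A X :: ennreal
  assumes "\<And>n. X \<le> A + \<phi> n" and "(\<phi> \<longlongrightarrow> 0) F" and "F \<noteq> bot"
  shows "X \<le> A"
proof -
  have "((\<lambda>n. A + \<phi> n) \<longlongrightarrow> A + 0) F"
    by (intro tendsto_intros assms)
  then show ?thesis using assms(1,3) by (intro tendsto_lowerbound[of _ "A" F]) auto
qed

lemma l2sq_dominated_convergence:
  assumes [measurable]: "\<And>n::nat. F n \<in> borel_measurable borel" "f \<in> borel_measurable borel" "w \<in> borel_measurable borel"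
    and bnd: "\<And>n. AE x in lborel. (cmod (F n x - f x))\<^sup>2 \<le> w x"
    and fin: "(\<integral>\<^sup>+x. ennreal (w x) \<partial>lborel) < \<infinity>"
    and lim: "AE x in lborel. (\<lambda>n. F n x) \<longlonglongrightarrow> f x"
  shows "(\<lambda>n. l2sq (\<lambda>x. F n x - f x)) \<longlonglongrightarrow> 0"
proof -
  have "(\<lambda>n. \<integral>\<^sup>+x. ennreal ((cmod (F n x - f x))\<^sup>2) \<partial>lborel) \<longlonglongrightarrow> (\<integral>\<^sup>+x. 0 \<partial>(lborel :: real measure))"
  proof (rule nn_integral_dominated_convergence[where w="\<lambda>x. ennreal (w x)"])
    show "AE x in lborel. ennreal ((cmod (F n x - f x))\<^sup>2) \<le> ennreal (w x)" for n
      using bnd[of n] by eventually_elim (rule ennreal_leI)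
    show "AE x in lborel. (\<lambda>n. ennreal ((cmod (F n x - f x))\<^sup>2)) \<longlonglongrightarrow> 0"
      using lim
    proof eventually_elim
      case (elim x)
      have "(\<lambda>n. (cmod (F n x - f x))\<^sup>2) \<longlonglongrightarrow> (cmod (f x - f x))\<^sup>2"
        by (intro tendsto_intros elim)
      then have "(\<lambda>n. ennreal ((cmod (F n x - f x))\<^sup>2)) \<longlonglongrightarrow> ennreal 0"
        by (intro tendsto_ennrealI) simp
      then show ?case by simp
    qed
  qed (use fin in simp_all)
  then show ?thesis unfolding l2sq_def by simp
qed

lemma ennreal_tendsto_0_cmult:
  fixes \<phi> :: "'a \<Rightarrow> ennreal"
  assumes "(\<phi> \<longlongrightarrow> 0) F" "c \<noteq> \<infinity>"
  shows "((\<lambda>n. c * \<phi> n) \<longlongrightarrow> 0) F"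
  using ennreal_tendsto_cmult[OF _ assms(1), of c] assms(2) by (simp add: top.not_eq_extremum)

text \<open>The upper bound \<open>plancherel_le\<close>, applied to \<open>F n - f\<close>, makes the transform continuous in \<open>L\<^sup>2\<close>, so the lower
bound passes to limits. The exact constant survives because \<open>e\<close> is arbitrary in
\<open>l2sq_add_weighted_le\<close>.\<close>

lemma plancherel_ge_limit:
  assumes f: "integrable lborel f" "square_integrable f"
    and fn: "\<And>n::nat. integrable lborel (F n)" "\<And>n. square_integrable (F n)"
    and ge: "\<And>n. ennreal (2 * pi) * l2sq (F n) \<le> l2sq (fhat (F n))"
    and lim: "(\<lambda>n. l2sq (\<lambda>x. F n x - f x)) \<longlonglongrightarrow> 0"
  shows "ennreal (2 * pi) * l2sq f \<le> l2sq (fhat f)"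
proof -
  have [measurable]: "f \<in> borel_measurable borel" "\<And>n. F n \<in> borel_measurable borel" using f fn by auto
  have step: "ennreal (2 * pi) * l2sq f \<le> ennreal ((1 + e)\<^sup>2) * l2sq (fhat f)" if e: "e > 0" for e
  proof (rule ennreal_le_vanishing_error[where F=sequentially])
    fix n
    let ?d = "l2sq (\<lambda>x. F n x - f x)"
    have "l2sq f = l2sq (\<lambda>x. F n x + (f x - F n x))" by simp
    also have "\<dots> \<le> ennreal (1 + e) * l2sq (F n) + ennreal (1 + 1 / e) * l2sq (\<lambda>x. f x - F n x)"
      by (rule l2sq_add_weighted_le) (use e in simp_all)
    also have "l2sq (\<lambda>x. f x - F n x) = ?d" by (rule l2sq_minus_commute)
    finally have 1: "ennreal (2 * pi) * l2sq f \<le> ennreal (2 * pi) * (ennreal (1 + e) * l2sq (F n) + ennreal (1 + 1 / e) * ?d)"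
      by (rule mult_left_mono) simp
    have "l2sq (fhat (F n)) = l2sq (\<lambda>\<xi>. fhat f \<xi> + fhat (\<lambda>x. F n x - f x) \<xi>)"
      using f fn by (simp add: fhat_diff)
    also have "\<dots> \<le> ennreal (1 + e) * l2sq (fhat f) + ennreal (1 + 1 / e) * l2sq (fhat (\<lambda>x. F n x - f x))"
      by (rule l2sq_add_weighted_le) (use e in simp_all)
    also have "\<dots> \<le> ennreal (1 + e) * l2sq (fhat f) + ennreal (1 + 1 / e) * (ennreal (2 * pi) * ?d)"
      by (intro add_left_mono mult_left_mono plancherel_le square_integrable_diff Bochner_Integration.integrable_diff f fn) simp
    finally have 2: "ennreal (2 * pi) * l2sq (F n) \<le> ennreal (1 + e) * l2sq (fhat f) + ennreal (1 + 1 / e) * (ennreal (2 * pi) * ?d)"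
      using ge[of n] by (rule order_trans[rotated])
    have "ennreal (2 * pi) * (ennreal (1 + e) * l2sq (F n) + ennreal (1 + 1 / e) * ?d)
      = ennreal (1 + e) * (ennreal (2 * pi) * l2sq (F n)) + ennreal (2 * pi) * ennreal (1 + 1 / e) * ?d"
      by (simp only: distrib_left mult.assoc mult.left_commute)
    also have "\<dots> \<le> ennreal (1 + e) * (ennreal (1 + e) * l2sq (fhat f) + ennreal (1 + 1 / e) * (ennreal (2 * pi) * ?d)) + ennreal (2 * pi) * ennreal (1 + 1 / e) * ?d"
      by (intro add_right_mono mult_left_mono 2) simp
    also have "\<dots> = (ennreal (1 + e) * ennreal (1 + e)) * l2sq (fhat f) + (ennreal (1 + e) * ennreal (1 + 1 / e) * ennreal (2 * pi) + ennreal (2 * pi) * ennreal (1 + 1 / e)) * ?d"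
      by (simp only: distrib_left distrib_right mult.assoc add.assoc)
    also have "ennreal (1 + e) * ennreal (1 + e) = ennreal ((1 + e)\<^sup>2)"
      by (subst ennreal_mult[symmetric]) (use e in \<open>simp_all add: power2_eq_square\<close>)
    finally show "ennreal (2 * pi) * l2sq f \<le> ennreal ((1 + e)\<^sup>2) * l2sq (fhat f) 
      + (ennreal (1 + e) * ennreal (1 + 1 / e) * ennreal (2 * pi) + ennreal (2 * pi) * ennreal (1 + 1 / e)) * ?d"
      using 1 by (rule order_trans[rotated])
  next
    show "(\<lambda>n. (ennreal (1 + e) * ennreal (1 + 1 / e) * ennreal (2 * pi) + ennreal (2 * pi) * ennreal (1 + 1 / e)) * l2sq (\<lambda>x. F n x - f x)) \<longlonglongrightarrow> 0"
      by (rule ennreal_tendsto_0_cmult[OF lim]) (simp add: ennreal_mult_eq_top_iff)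
  qed simp
  have "(\<lambda>n. ennreal ((1 + 1 / (real n + 1))\<^sup>2) * l2sq (fhat f)) \<longlonglongrightarrow> ennreal ((1 + 0)\<^sup>2) * l2sq (fhat f)"
  proof (rule tendsto_mult_ennreal)
    have "(\<lambda>n. 1 / (real n + 1)) \<longlonglongrightarrow> 0"
      using LIMSEQ_Suc[OF lim_1_over_n] by (simp add: add.commute)
    then show "(\<lambda>n. ennreal ((1 + 1 / (real n + 1))\<^sup>2)) \<longlonglongrightarrow> ennreal ((1 + 0)\<^sup>2)"
      by (intro tendsto_ennrealI tendsto_intros)
  qed simp_all
  then have "(\<lambda>n. ennreal ((1 + 1 / (real n + 1))\<^sup>2) * l2sq (fhat f)) \<longlonglongrightarrow> l2sq (fhat f)" by simp
  then show ?thesis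
    by (rule LIMSEQ_le_const) (intro exI[of _ 0] allI impI step, simp add: add_pos_nonneg)
qed

text \<open>A measurable function is an almost everywhere limit of continuous functions. Radial projection onto
the disc of radius \<open>B\<close> and multiplication by a tent function preserve continuity and the limit, and
they provide the common bound needed for dominated convergence.\<close>

lemma continuous_approximation:
  fixes f :: "real \<Rightarrow> complex"
  assumes [measurable]: "f \<in> borel_measurable borel" and B: "\<And>x. cmod (f x) \<le> B" "B > 0"
    and supp: "\<And>x. x \<notin> {-R..R} \<Longrightarrow> f x = 0"
  obtains g where "\<And>n::nat. continuous_on UNIV (g n)" 
    "\<And>n x. cmod (g n x) \<le> B * indicator {-R-1..R+1} x"
    "AE x in lborel. (\<lambda>n. g n x) \<longlonglongrightarrow> f x"
proof -
  have "f \<in> borel_measurable lebesgue" by (rule measurable_completion) simp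
  then have "f measurable_on UNIV" by (rule lebesgue_measurable_imp_measurable_on) simp
  then obtain N g where N: "negligible N" and cont: "\<And>n::nat. continuous_on UNIV (g n)"
    and lim: "\<And>x. x \<notin> N \<Longrightarrow> (\<lambda>n. g n x) \<longlonglongrightarrow> f x"
    unfolding measurable_on_def by auto
  \<comment> \<open>equal to \<open>1\<close> on the support and to \<open>0\<close> outside \<open>{-R-1..R+1}\<close>\<close>
  define tent where "tent x = max 0 (min 1 (R + 1 - \<bar>x\<bar>))" for x
  define G where "G n x = tent x *\<^sub>R (g n x /\<^sub>R max 1 (cmod (g n x) / B))" for n x
  show thesis
  proof (rule that[of G])
    show "continuous_on UNIV (G n)" for n
      unfolding G_def tent_def using B(2) by (intro continuous_intros cont) (auto simp: max_def)
    show "cmod (G n x) \<le> B * indicator {-R-1..R+1} x" for n x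
    proof -
      have "cmod (g n x /\<^sub>R max 1 (cmod (g n x) / B)) \<le> B"
        using B(2) by (auto simp: max_def field_simps)
      moreover have "0 \<le> tent x" "tent x \<le> indicator {-R-1..R+1} x"
        by (auto simp: tent_def indicator_def)
      ultimately have "tent x * cmod (g n x /\<^sub>R max 1 (cmod (g n x) / B)) \<le> indicator {-R-1..R+1} x * B"
        by (intro mult_mono) simp_all
      then show ?thesis using \<open>0 \<le> tent x\<close> by (simp add: G_def mult_ac)
    qed
    have "AE x in lebesgue. x \<notin> N"
      using N by (simp add: negligible_iff_null_sets AE_not_in)
    then have "AE x in lborel. x \<notin> N" by (simp add: AE_completion_iff)
    then show "AE x in lborel. (\<lambda>n. G n x) \<longlonglongrightarrow> f x"
    proof eventually_elim
      case (elim x)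
      have "(\<lambda>n. G n x) \<longlonglongrightarrow> tent x *\<^sub>R (f x /\<^sub>R max 1 (cmod (f x) / B))"
        unfolding G_def using B(2) by (intro tendsto_intros lim elim) (auto simp: max_def)
      also have "tent x *\<^sub>R (f x /\<^sub>R max 1 (cmod (f x) / B)) = f x"
      proof (cases "x \<in> {-R..R}")
        case True
        have "cmod (f x) / B \<le> 1" using B by simp
        then have "max 1 (cmod (f x) / B) = 1" by (rule max_absorb1)
        moreover have "tent x = 1" using True by (auto simp: tent_def)
        ultimately show ?thesis by simp
      qed (simp add: supp)
      finally show ?case .
    qed
  qed
qed

lemma bounded_support_integrable:
  fixes g :: "real \<Rightarrow> complex"
  assumes [measurable]: "g \<in> borel_measurable borel" and "\<And>x. cmod (g x) \<le> B * indicator {a..b} x"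
  shows "integrable lborel g"
proof (rule Bochner_Integration.integrable_bound)
  show "integrable lborel (\<lambda>x. B * indicator {a..b} x)" by (intro integrable_mult_right integrable_real_indicator) (simp_all add: emeasure_lborel_Icc_eq)
  show "AE x in lborel. norm (g x) \<le> norm (B * indicator {a..b} x)"
    using assms(2) by (intro AE_I2) (metis abs_ge_self order_trans real_norm_def)
qed simp

lemma bounded_support_square_integrable:
  fixes g :: "real \<Rightarrow> complex"
  assumes [measurable]: "g \<in> borel_measurable borel" and b: "\<And>x. cmod (g x) \<le> B * indicator {a..b} x"
  shows "square_integrable g"
  unfolding square_integrable_def
proof
  show "integrable lborel (\<lambda>x. (cmod (g x))\<^sup>2)"
  proof (rule Bochner_Integration.integrable_bound)
    show "integrable lborel (\<lambda>x. B\<^sup>2 * indicator {a..b} x)"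
      by (intro integrable_mult_right integrable_real_indicator) (simp_all add: emeasure_lborel_Icc_eq)
    show "AE x in lborel. norm ((cmod (g x))\<^sup>2) \<le> norm (B\<^sup>2 * indicator {a..b} x)"
    proof (rule AE_I2)
      fix x
      have "(cmod (g x))\<^sup>2 \<le> (B * indicator {a..b} x)\<^sup>2" by (intro power_mono b) simp
      then show "norm ((cmod (g x))\<^sup>2) \<le> norm (B\<^sup>2 * indicator {a..b} x)"
        by (auto simp: indicator_def)
    qed
  qed simp
qed simp

lemma plancherel_ge_bounded:
  assumes [measurable]: "f \<in> borel_measurable borel" and B: "\<And>x. cmod (f x) \<le> B" "B > 0"
    and supp: "\<And>x. x \<notin> {-R..R} \<Longrightarrow> f x = 0"
  shows "ennreal (2 * pi) * l2sq f \<le> l2sq (fhat f)"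
proof -
  obtain g where cont: "\<And>n::nat. continuous_on UNIV (g n)" 
    and bnd: "\<And>n x. cmod (g n x) \<le> B * indicator {-R-1..R+1} x"
    and lim: "AE x in lborel. (\<lambda>n. g n x) \<longlonglongrightarrow> f x"
    using continuous_approximation[of f B R, OF assms] by blast
  have [measurable]: "\<And>n. g n \<in> borel_measurable borel" using cont by (rule borel_measurable_continuous_onI)
  have fb: "cmod (f x) \<le> B * indicator {-R-1..R+1} x" for x
  proof (cases "x \<in> {-R..R}")
    case True
    then have "x \<in> {-R-1..R+1}" by auto
    then show ?thesis using B(1)[of x] by simp
  qed (use B(2) supp in simp)
  have gB: "cmod (g n x) \<le> B" for n x
    using bnd[of n x] B(2) by (cases "x \<in> {-R-1..R+1}") simp_all
  show ?thesis
  proof (rule plancherel_ge_limit[where F=g])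
    show "integrable lborel f" "square_integrable f" "integrable lborel (g n)" "square_integrable (g n)" for n
      by (rule bounded_support_integrable bounded_support_square_integrable; (rule fb bnd)?; simp)+
    then show "ennreal (2 * pi) * l2sq (g n) \<le> l2sq (fhat (g n))" for n
      using cont gB by (intro plancherel_continuous[where B=B])
    show "(\<lambda>n. l2sq (\<lambda>x. g n x - f x)) \<longlonglongrightarrow> 0"
    proof (rule l2sq_dominated_convergence[where w="\<lambda>x. 4 * B\<^sup>2 * indicator {-R-1..R+1} x"])
      show "AE x in lborel. (cmod (g n x - f x))\<^sup>2 \<le> 4 * B\<^sup>2 * indicator {-R-1..R+1} x" for n
      proof (rule AE_I2)
        fix x
        have "cmod (g n x - f x) \<le> 2 * B * indicator {-R-1..R+1} x"
          using norm_triangle_ineq4[of "g n x" "f x"] bnd[of n x] fb[of x] by simp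
        then have "(cmod (g n x - f x))\<^sup>2 \<le> (2 * B * indicator {-R-1..R+1} x)\<^sup>2" by (rule power_mono) simp
        then show "(cmod (g n x - f x))\<^sup>2 \<le> 4 * B\<^sup>2 * indicator {-R-1..R+1} x"
          by (auto simp: indicator_def power_mult_distrib)
      qed
      have "integrable lborel (\<lambda>x. 4 * B\<^sup>2 * indicator {-R-1..R+1} x)"
        by (intro integrable_mult_right integrable_real_indicator) (simp_all add: emeasure_lborel_Icc_eq)
      then show "(\<integral>\<^sup>+x. ennreal (4 * B\<^sup>2 * indicator {-R-1..R+1} x) \<partial>lborel) < \<infinity>"
        by (subst nn_integral_eq_integral) simp_all
    qed (use lim in simp_all)
  qed
qed

text \<open>The lower bound extends from continuous functions to bounded ones with bounded support, and from
there, by cutting off large values and large arguments, to the general case.\<close>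

theorem plancherel:
  assumes f: "integrable lborel f" "square_integrable f"
  shows "l2sq (fhat f) = ennreal (2 * pi) * l2sq f"
proof (rule antisym)
  show "l2sq (fhat f) \<le> ennreal (2 * pi) * l2sq f" by (rule plancherel_le[OF f])
  have [measurable]: "f \<in> borel_measurable borel" using f by auto
  let ?F = "\<lambda>n::nat. \<lambda>x. if \<bar>x\<bar> \<le> real n \<and> cmod (f x) \<le> real n then f x else 0"
  have b: "cmod (?F n x) \<le> real n * indicator {- real n..real n} x" for n x
    by (auto simp: indicator_def)
  show "ennreal (2 * pi) * l2sq f \<le> l2sq (fhat f)"
  proof (rule plancherel_ge_limit[where F="?F", OF f])
    fix n
    show "integrable lborel (?F n)" "square_integrable (?F n)"
      by (rule bounded_support_integrable bounded_support_square_integrable; (rule b)?; simp)+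
    show "ennreal (2 * pi) * l2sq (?F n) \<le> l2sq (fhat (?F n))"
      by (rule plancherel_ge_bounded[where B="real n + 1" and R="real n"]) auto
  next
    show "(\<lambda>n. l2sq (\<lambda>x. ?F n x - f x)) \<longlonglongrightarrow> 0"
    proof (rule l2sq_dominated_convergence[where w="\<lambda>x. (cmod (f x))\<^sup>2"])
      show "AE x in lborel. (\<lambda>n. ?F n x) \<longlonglongrightarrow> f x"
      proof (rule AE_I2)
        fix x
        have "\<forall>\<^sub>F n in sequentially. real n \<ge> \<bar>x\<bar>" "\<forall>\<^sub>F n in sequentially. real n \<ge> cmod (f x)"
          using filterlim_real_sequentially unfolding filterlim_at_top by blast+
        then have "\<forall>\<^sub>F n in sequentially. ?F n x = f x"
          by eventually_elim simp
        then show "(\<lambda>n. ?F n x) \<longlonglongrightarrow> f x" by (rule tendsto_eventually)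
      qed
      show "(\<integral>\<^sup>+x. ennreal ((cmod (f x))\<^sup>2) \<partial>lborel) < \<infinity>"
        using f(2) by (simp add: square_integrable_iff_l2sq l2sq_def)
    qed auto
  qed
qed

section \<open>Inversion in \<open>L\<^sup>2\<close>\<close>

lemma tendsto_L2_iff: "tendsto_L2 F g \<longleftrightarrow> ((\<lambda>R. l2sq (\<lambda>x. F R x - g x)) \<longlongrightarrow> 0) at_top"
  unfolding tendsto_L2_def l2sq_def ..

lemma truncate_measurable [measurable]:
  "f \<in> borel_measurable borel \<Longrightarrow> truncate R f \<in> borel_measurable borel"
  unfolding truncate_def by simp

lemma norm_truncate_le: "cmod (truncate R f x) \<le> cmod (f x)"
  by (simp add: truncate_def indicator_def)

lemma square_integrable_truncate:
  assumes "square_integrable f"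
  shows "square_integrable (truncate R f)"
  unfolding square_integrable_def
proof
  have [measurable]: "f \<in> borel_measurable borel" using assms by (simp add: square_integrable_def)
  show "truncate R f \<in> borel_measurable lborel" by simp
  show "integrable lborel (\<lambda>x. (cmod (truncate R f x))\<^sup>2)"
    by (rule Bochner_Integration.integrable_bound[of _ "\<lambda>x. (cmod (f x))\<^sup>2"])
       (use assms in \<open>auto simp: square_integrable_def intro!: power_mono norm_truncate_le\<close>)
qed

lemma integrable_truncate:
  assumes "square_integrable f"
  shows "integrable lborel (truncate R f)"
proof (rule Bochner_Integration.integrable_bound)
  have [measurable]: "f \<in> borel_measurable borel" using assms by (simp add: square_integrable_def)
  show "truncate R f \<in> borel_measurable lborel" by simp
  show "integrable lborel (\<lambda>x. (cmod (f x))\<^sup>2 + indicator {-R..R} x)"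
    using assms
    by (intro Bochner_Integration.integrable_add integrable_real_indicator)
       (simp_all add: square_integrable_def emeasure_lborel_Icc_eq)
  show "AE x in lborel. norm (truncate R f x) \<le> norm ((cmod (f x))\<^sup>2 + indicator {-R..R} x :: real)"
  proof (rule AE_I2)
    fix x
    have "cmod (f x) \<le> (cmod (f x))\<^sup>2 + 1"
      using sum_squares_bound[of "cmod (f x)" 1] norm_ge_zero[of "f x"]
      unfolding mult_1_right power_one by linarith
    then show "norm (truncate R f x) \<le> norm ((cmod (f x))\<^sup>2 + indicator {-R..R} x :: real)"
      by (auto simp: truncate_def indicator_def)
  qed
qed

lemma truncate_tendsto_L2:
  assumes "square_integrable f"
  shows "((\<lambda>R. l2sq (\<lambda>x. truncate R f x - f x)) \<longlongrightarrow> 0) at_top"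
proof (rule tendsto_at_topI_sequentially)
  fix X :: "nat \<Rightarrow> real"
  assume X: "filterlim X at_top sequentially"
  have [measurable]: "f \<in> borel_measurable borel" using assms by (simp add: square_integrable_def)
  show "(\<lambda>n. l2sq (\<lambda>x. truncate (X n) f x - f x)) \<longlonglongrightarrow> 0"
  proof (rule l2sq_dominated_convergence[where w="\<lambda>x. (cmod (f x))\<^sup>2"])
    show "AE x in lborel. (cmod (truncate (X n) f x - f x))\<^sup>2 \<le> (cmod (f x))\<^sup>2" for n
      by (auto simp: truncate_def indicator_def)
    show "(\<integral>\<^sup>+x. ennreal ((cmod (f x))\<^sup>2) \<partial>lborel) < \<infinity>"
      using assms by (simp add: square_integrable_iff_l2sq l2sq_def)
    show "AE x in lborel. (\<lambda>n. truncate (X n) f x) \<longlonglongrightarrow> f x"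
    proof (rule AE_I2)
      fix x
      have "\<forall>\<^sub>F n in sequentially. X n \<ge> \<bar>x\<bar>"
        using X unfolding filterlim_at_top by blast
      then have "\<forall>\<^sub>F n in sequentially. truncate (X n) f x = f x"
        by eventually_elim (auto simp: truncate_def indicator_def)
      then show "(\<lambda>n. truncate (X n) f x) \<longlonglongrightarrow> f x" by (rule tendsto_eventually)
    qed
  qed simp_all
qed

definition inv_fourier :: "(real \<Rightarrow> complex) \<Rightarrow> real \<Rightarrow> complex" where
  "inv_fourier g x = 1 / (2 * of_real pi) * (LINT k|lborel. exp (\<i> * of_real k * of_real x) * g k)"

lemma inv_fourier_eq: "inv_fourier g x = 1 / (2 * of_real pi) * fhat g (- x)"
  unfolding inv_fourier_def fourier_def
  by (intro arg_cong2[where f="(*)"] refl Bochner_Integration.integral_cong) (simp_all add: mult_ac)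

lemma inv_fourier_measurable [measurable]:
  assumes [measurable]: "g \<in> borel_measurable borel"
  shows "inv_fourier g \<in> borel_measurable borel"
  unfolding inv_fourier_eq[abs_def] by measurable

lemma l2sq_reflect:
  assumes [measurable]: "f \<in> borel_measurable borel"
  shows "l2sq (\<lambda>x. f (- x)) = l2sq f"
  unfolding l2sq_def
  using nn_integral_real_affine[of "\<lambda>x. ennreal ((cmod (f x))\<^sup>2)" "-1" 0] by simp

lemma l2sq_inv_fourier:
  assumes g: "integrable lborel g" "square_integrable g"
  shows "l2sq g = ennreal (2 * pi) * l2sq (inv_fourier g)"
proof -
  have [measurable]: "g \<in> borel_measurable borel" using g by auto
  have "l2sq (inv_fourier g) = ennreal ((cmod (1 / (2 * of_real pi)))\<^sup>2) * l2sq (\<lambda>x. fhat g (- x))"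
    unfolding inv_fourier_eq[abs_def] by (rule l2sq_cmult) simp
  also have "l2sq (\<lambda>x. fhat g (- x)) = ennreal (2 * pi) * l2sq g"
    unfolding plancherel[OF g, symmetric] by (rule l2sq_reflect) simp
  finally have "ennreal (2 * pi) * l2sq (inv_fourier g)
     = (ennreal (2 * pi) * ennreal ((cmod (1 / (2 * of_real pi)))\<^sup>2) * ennreal (2 * pi)) * l2sq g"
    by (simp only: mult.assoc)
  also have "ennreal (2 * pi) * ennreal ((cmod (1 / (2 * of_real pi)))\<^sup>2) * ennreal (2 * pi) = 1"
  proof -
    have r: "2 * pi * (cmod (1 / (2 * of_real pi)))\<^sup>2 * (2 * pi) = 1"
      by (simp add: norm_divide norm_mult power2_eq_square)
    show ?thesis
      by (subst ennreal_mult[symmetric], simp, simp, subst ennreal_mult[symmetric], simp, simp, subst r, simp)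
  qed
  finally show ?thesis by simp
qed

lemma l2sq_diff_expand:
  assumes a: "square_integrable a" and b: "square_integrable b"
  shows "l2sq (\<lambda>x. a x - b x) = ennreal ((LINT x|lborel. (cmod (a x))\<^sup>2) + (LINT x|lborel. (cmod (b x))\<^sup>2)
      - 2 * Re (LINT x|lborel. a x * cnj (b x)))"
proof -
  have [measurable]: "a \<in> borel_measurable borel" "b \<in> borel_measurable borel"
    using a b by (auto simp: square_integrable_def)
  have cb: "square_integrable (\<lambda>x. cnj (b x))" using b by (simp add: square_integrable_def)
  have ab: "integrable lborel (\<lambda>x. a x * cnj (b x))" by (rule square_integrable_product[OF a cb])
  then have ab': "integrable lborel (\<lambda>x. 2 * Re (a x * cnj (b x)))" by (intro integrable_mult_right integrable_Re)
  have ab_int: "integrable lborel (\<lambda>x. (cmod (a x))\<^sup>2)" "integrable lborel (\<lambda>x. (cmod (b x))\<^sup>2)"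
    using a b by (auto simp: square_integrable_def)
  have eq: "(cmod (a x - b x))\<^sup>2 = (cmod (a x))\<^sup>2 + (cmod (b x))\<^sup>2 - 2 * Re (a x * cnj (b x))" for x
    by (simp add: cmod_power2 power2_diff algebra_simps)
  have "l2sq (\<lambda>x. a x - b x) = ennreal (LINT x|lborel. (cmod (a x))\<^sup>2 + (cmod (b x))\<^sup>2 - 2 * Re (a x * cnj (b x)))"
    unfolding l2sq_def eq
    by (rule nn_integral_eq_integral) (use ab' ab_int in simp, rule AE_I2, subst eq[symmetric], simp)
  also have "(LINT x|lborel. (cmod (a x))\<^sup>2 + (cmod (b x))\<^sup>2 - 2 * Re (a x * cnj (b x)))
    = (LINT x|lborel. (cmod (a x))\<^sup>2) + (LINT x|lborel. (cmod (b x))\<^sup>2) - (LINT x|lborel. 2 * Re (a x * cnj (b x)))"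
    using ab' ab_int by simp
  also have "(LINT x|lborel. 2 * Re (a x * cnj (b x))) = 2 * Re (LINT x|lborel. a x * cnj (b x))"
    using integral_Re[OF ab] by (simp only: integral_mult_right_zero)
  finally show ?thesis .
qed

lemma l2sq_eq_integral:
  "square_integrable f \<Longrightarrow> l2sq f = ennreal (LINT x|lborel. (cmod (f x))\<^sup>2)"
  unfolding square_integrable_def l2sq_def by (intro nn_integral_eq_integral) auto

lemma square_integrable_fhat:
  assumes "integrable lborel f" "square_integrable f"
  shows "square_integrable (fhat f)"
  using plancherel[OF assms] assms
  by (auto simp: square_integrable_iff_l2sq ennreal_mult_less_top)

lemma square_integrable_inv_fourier:
  assumes g: "integrable lborel g" "square_integrable g"
  shows "square_integrable (inv_fourier g)"
proof -
  have "ennreal (2 * pi) * l2sq (inv_fourier g) < \<infinity>"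
    using l2sq_inv_fourier[OF g] g(2) by (simp add: square_integrable_iff_l2sq)
  then have "l2sq (inv_fourier g) < \<infinity>" by (auto simp: ennreal_mult_less_top)
  then show ?thesis using g by (simp add: square_integrable_iff_l2sq)
qed

text \<open>After expanding the squares, the norms agree by Plancherel's theorem and the cross terms by the
multiplication formula. This is an inversion theorem in isometric form: if the right-hand side is
small, the transform of \<open>h\<close> is close to \<open>g\<close>.\<close>

lemma mixed_plancherel:
  assumes h: "integrable lborel h" "square_integrable h"
    and g: "integrable lborel g" "square_integrable g"
  shows "l2sq (\<lambda>\<xi>. fhat h \<xi> - g \<xi>) = ennreal (2 * pi) * l2sq (\<lambda>x. h x - inv_fourier g x)"
proof -
  have cg: "integrable lborel (\<lambda>x. cnj (g x))" using g(1) by simp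
  have fc: "fhat (\<lambda>x. cnj (g x)) x = of_real (2 * pi) * cnj (inv_fourier g x)" for x
  proof -
    have "fhat (\<lambda>x. cnj (g x)) x = (LINT k|lborel. cnj (exp (\<i> * of_real k * of_real x) * g k))"
      unfolding fourier_def
      by (intro Bochner_Integration.integral_cong refl) (simp add: exp_cnj mult_ac)
    also have "\<dots> = cnj (LINT k|lborel. exp (\<i> * of_real k * of_real x) * g k)"
      by (rule Bochner_Integration.integral_cnj)
    also have "\<dots> = of_real (2 * pi) * cnj (inv_fourier g x)"
      unfolding inv_fourier_def by simp
    finally show ?thesis .
  qed
  have "(LINT \<xi>|lborel. fhat h \<xi> * cnj (g \<xi>)) = (LINT x|lborel. h x * fhat (\<lambda>x. cnj (g x)) x)"
    by (rule fourier_multiplication_formula[OF h(1) cg])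
  also have "\<dots> = (LINT x|lborel. of_real (2 * pi) * (h x * cnj (inv_fourier g x)))"
    unfolding fc by (intro Bochner_Integration.integral_cong refl) simp
  also have "\<dots> = of_real (2 * pi) * (LINT x|lborel. h x * cnj (inv_fourier g x))"
    by (rule integral_mult_right_zero)
  finally have pair: "Re (LINT \<xi>|lborel. fhat h \<xi> * cnj (g \<xi>)) = 2 * pi * Re (LINT x|lborel. h x * cnj (inv_fourier g x))"
    by simp
  note sq = square_integrable_fhat[OF h] square_integrable_inv_fourier[OF g]
  have e1: "(LINT \<xi>|lborel. (cmod (fhat h \<xi>))\<^sup>2) = 2 * pi * (LINT x|lborel. (cmod (h x))\<^sup>2)"
    using plancherel[OF h] unfolding l2sq_eq_integral[OF sq(1)] l2sq_eq_integral[OF h(2)]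
    by (simp add: ennreal_mult[symmetric])
  have e2: "(LINT \<xi>|lborel. (cmod (g \<xi>))\<^sup>2) = 2 * pi * (LINT x|lborel. (cmod (inv_fourier g x))\<^sup>2)"
    using l2sq_inv_fourier[OF g] unfolding l2sq_eq_integral[OF sq(2)] l2sq_eq_integral[OF g(2)]
    by (simp add: ennreal_mult[symmetric])
  show ?thesis
    unfolding l2sq_diff_expand[OF sq(1) g(2)] l2sq_diff_expand[OF h(2) sq(2)] pair e1 e2
    by (subst ennreal_mult'[symmetric]) (simp_all add: algebra_simps)
qed

text \<open>The isometry against every test function \<open>h\<close> passes, up to a constant, to the limit pair \<open>(w, g)\<close>.
With \<open>h\<close> a truncation of \<open>w\<close> it becomes the convergence in the definition of \<open>is_L2_fourier\<close>.\<close>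

lemma is_L2_fourier_limit:
  assumes w: "square_integrable w" and g: "square_integrable g"
    and meas: "\<And>n. W n \<in> borel_measurable borel" "\<And>n. G n \<in> borel_measurable borel"
    and isom: "\<And>n h. integrable lborel h \<Longrightarrow> square_integrable h \<Longrightarrow>
        l2sq (\<lambda>\<xi>. fhat h \<xi> - G n \<xi>) = ennreal (2 * pi) * l2sq (\<lambda>x. h x - W n x)"
    and W: "((\<lambda>n. l2sq (\<lambda>x. W n x - w x)) \<longlongrightarrow> 0) F"
    and G: "((\<lambda>n. l2sq (\<lambda>x. G n x - g x)) \<longlongrightarrow> 0) F"
    and F: "F \<noteq> bot"
  shows "is_L2_fourier w g"
proof -
  have [measurable]: "w \<in> borel_measurable borel" "g \<in> borel_measurable borel"
    using w g by (auto simp: square_integrable_def)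
  note [measurable] = meas
  have bound: "l2sq (\<lambda>\<xi>. fhat h \<xi> - g \<xi>) \<le> (2 * ennreal (2 * pi) * 2) * l2sq (\<lambda>x. h x - w x)"
    if h: "integrable lborel h" "square_integrable h" for h
  proof (rule ennreal_le_vanishing_error[where F=F])
    fix n
    have [measurable]: "h \<in> borel_measurable borel" using h by auto
    have "l2sq (\<lambda>\<xi>. fhat h \<xi> - g \<xi>) \<le> 2 * l2sq (\<lambda>\<xi>. fhat h \<xi> - G n \<xi>) + 2 * l2sq (\<lambda>\<xi>. G n \<xi> - g \<xi>)"
      by (rule l2sq_diff_triangle) measurable
    also have "l2sq (\<lambda>\<xi>. fhat h \<xi> - G n \<xi>) = ennreal (2 * pi) * l2sq (\<lambda>x. h x - W n x)"
      by (rule isom[OF h])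
    also have "2 * (ennreal (2 * pi) * l2sq (\<lambda>x. h x - W n x)) + 2 * l2sq (\<lambda>\<xi>. G n \<xi> - g \<xi>)
       \<le> 2 * (ennreal (2 * pi) * (2 * l2sq (\<lambda>x. h x - w x) + 2 * l2sq (\<lambda>x. w x - W n x))) + 2 * l2sq (\<lambda>\<xi>. G n \<xi> - g \<xi>)"
      by (intro add_right_mono mult_left_mono l2sq_diff_triangle) simp_all
    also have "\<dots> = (2 * ennreal (2 * pi) * 2) * l2sq (\<lambda>x. h x - w x)
        + ((2 * ennreal (2 * pi) * 2) * l2sq (\<lambda>x. W n x - w x) + 2 * l2sq (\<lambda>\<xi>. G n \<xi> - g \<xi>))"
      unfolding l2sq_minus_commute[of w] by (simp only: distrib_left mult.assoc add.assoc)
    finally show "l2sq (\<lambda>\<xi>. fhat h \<xi> - g \<xi>) \<le> (2 * ennreal (2 * pi) * 2) * l2sq (\<lambda>x. h x - w x)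
        + ((2 * ennreal (2 * pi) * 2) * l2sq (\<lambda>x. W n x - w x) + 2 * l2sq (\<lambda>\<xi>. G n \<xi> - g \<xi>))" .
  next
    have "((\<lambda>n. (2 * ennreal (2 * pi) * 2) * l2sq (\<lambda>x. W n x - w x) + 2 * l2sq (\<lambda>\<xi>. G n \<xi> - g \<xi>)) \<longlongrightarrow> 0 + 0) F"
      by (intro tendsto_add ennreal_tendsto_0_cmult W G) (simp_all add: ennreal_mult_eq_top_iff)
    then show "((\<lambda>n. (2 * ennreal (2 * pi) * 2) * l2sq (\<lambda>x. W n x - w x) + 2 * l2sq (\<lambda>\<xi>. G n \<xi> - g \<xi>)) \<longlongrightarrow> 0) F"
      by simp
  qed (rule F)
  have "((\<lambda>R. l2sq (\<lambda>\<xi>. fhat (truncate R w) \<xi> - g \<xi>)) \<longlongrightarrow> 0) at_top"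
  proof (rule tendsto_sandwich[OF _ _ tendsto_const])
    show "((\<lambda>R. (2 * ennreal (2 * pi) * 2) * l2sq (\<lambda>x. truncate R w x - w x)) \<longlongrightarrow> 0) at_top"
      by (intro ennreal_tendsto_0_cmult truncate_tendsto_L2[OF w]) (simp add: ennreal_mult_eq_top_iff)
    show "\<forall>\<^sub>F R in at_top. l2sq (\<lambda>\<xi>. fhat (truncate R w) \<xi> - g \<xi>) \<le> (2 * ennreal (2 * pi) * 2) * l2sq (\<lambda>x. truncate R w x - w x)"
      by (intro always_eventually allI bound integrable_truncate square_integrable_truncate w)
  qed simp
  then show ?thesis unfolding is_L2_fourier_def tendsto_L2_iff using w g by simp
qed

text \<open>The truncations of \<open>g\<close> and their inverse transforms satisfy the isometry by \<open>mixed_plancherel\<close>.\<close>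

theorem is_L2_inv_fourier_imp_is_L2_fourier:
  assumes "is_L2_inv_fourier g w"
  shows "is_L2_fourier w g"
proof -
  have g: "square_integrable g" and w: "square_integrable w"
    and lim: "((\<lambda>R. l2sq (\<lambda>x. inv_fourier (truncate R g) x - w x)) \<longlongrightarrow> 0) at_top"
    using assms unfolding is_L2_inv_fourier_def tendsto_L2_iff inv_fourier_def by auto
  have [measurable]: "g \<in> borel_measurable borel" using g by (simp add: square_integrable_def)
  show ?thesis
    by (rule is_L2_fourier_limit[OF w g _ _ _ lim truncate_tendsto_L2[OF g]])
       (simp_all add: mixed_plancherel integrable_truncate square_integrable_truncate g)
qed

text \<open>Here the isometry is Plancherel's theorem for \<open>h - F n\<close>.\<close>

theorem is_L2_fourier_closed:
  assumes w: "square_integrable w" and g: "square_integrable g"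
    and F: "\<And>n::nat. integrable lborel (F n)" "\<And>n. square_integrable (F n)"
    and lim: "(\<lambda>n. l2sq (\<lambda>x. F n x - w x)) \<longlonglongrightarrow> 0" "(\<lambda>n. l2sq (\<lambda>\<xi>. fhat (F n) \<xi> - g \<xi>)) \<longlonglongrightarrow> 0"
  shows "is_L2_fourier w g"
proof (rule is_L2_fourier_limit[OF w g _ _ _ lim])
  have [measurable]: "F n \<in> borel_measurable borel" for n using F by auto
  show "F n \<in> borel_measurable borel" "fhat (F n) \<in> borel_measurable borel" for n by simp_all
  show "l2sq (\<lambda>\<xi>. fhat h \<xi> - fhat (F n) \<xi>) = ennreal (2 * pi) * l2sq (\<lambda>x. h x - F n x)"
    if h: "integrable lborel h" "square_integrable h" for n h
    using plancherel[of "\<lambda>x. h x - F n x"] h F by (simp add: fhat_diff square_integrable_diff)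
qed simp

lemma is_L2_fourier_unique:
  assumes "is_L2_fourier f g" "is_L2_fourier f g'"
  shows "AE \<xi> in lborel. g \<xi> = g' \<xi>"
proof -
  have f: "square_integrable f" and g: "square_integrable g" "square_integrable g'"
    and lim: "((\<lambda>R. l2sq (\<lambda>x. fhat (truncate R f) x - g x)) \<longlongrightarrow> 0) at_top"
     "((\<lambda>R. l2sq (\<lambda>x. fhat (truncate R f) x - g' x)) \<longlongrightarrow> 0) at_top"
    using assms unfolding is_L2_fourier_def tendsto_L2_iff by auto
  have [measurable]: "f \<in> borel_measurable borel" "g \<in> borel_measurable borel" "g' \<in> borel_measurable borel"
    using f g by (auto simp: square_integrable_def)
  have "l2sq (\<lambda>x. g x - g' x) \<le> 0"
  proof (rule ennreal_le_vanishing_error[where F="at_top :: real filter"])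
    fix R
    have "l2sq (\<lambda>x. g x - g' x) \<le> 2 * l2sq (\<lambda>x. g x - fhat (truncate R f) x) + 2 * l2sq (\<lambda>x. fhat (truncate R f) x - g' x)"
      by (rule l2sq_diff_triangle) simp_all
    then show "l2sq (\<lambda>x. g x - g' x) \<le> 0 + (2 * l2sq (\<lambda>x. fhat (truncate R f) x - g x) + 2 * l2sq (\<lambda>x. fhat (truncate R f) x - g' x))"
      unfolding l2sq_minus_commute[of g] by simp
  next
    have "((\<lambda>R. 2 * l2sq (\<lambda>x. fhat (truncate R f) x - g x) + 2 * l2sq (\<lambda>x. fhat (truncate R f) x - g' x)) \<longlongrightarrow> 0 + 0) at_top"
      by (intro tendsto_add ennreal_tendsto_0_cmult lim) simp_all
    then show "((\<lambda>R. 2 * l2sq (\<lambda>x. fhat (truncate R f) x - g x) + 2 * l2sq (\<lambda>x. fhat (truncate R f) x - g' x)) \<longlongrightarrow> 0) at_top"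
      by simp
  qed simp
  then have "AE \<xi> in lborel. g \<xi> - g' \<xi> = 0"
    using l2sq_eq_0_iff[of "\<lambda>x. g x - g' x"] by simp
  then show ?thesis by eventually_elim simp
qed

lemma is_L2_fourier_add:
  assumes "is_L2_fourier f g" "is_L2_fourier f' g'"
  shows "is_L2_fourier (\<lambda>x. f x + f' x) (\<lambda>x. g x + g' x)"
proof -
  have f: "square_integrable f" "square_integrable f'" and g: "square_integrable g" "square_integrable g'"
    and lim: "((\<lambda>R. l2sq (\<lambda>x. fhat (truncate R f) x - g x)) \<longlongrightarrow> 0) at_top"
     "((\<lambda>R. l2sq (\<lambda>x. fhat (truncate R f') x - g' x)) \<longlongrightarrow> 0) at_top"
    using assms unfolding is_L2_fourier_def tendsto_L2_iff by auto
  have [measurable]: "f \<in> borel_measurable borel" "g \<in> borel_measurable borel" "g' \<in> borel_measurable borel" "f' \<in> borel_measurable borel"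
    using f g by (auto simp: square_integrable_def)
  have eq: "fhat (truncate R (\<lambda>x. f x + f' x)) \<xi> = fhat (truncate R f) \<xi> + fhat (truncate R f') \<xi>" for R \<xi>
  proof -
    have "truncate R (\<lambda>x. f x + f' x) = (\<lambda>x. truncate R f x + truncate R f' x)"
      by (auto simp: truncate_def scaleR_add_right)
    then show ?thesis by (simp add: fhat_add integrable_truncate f)
  qed
  have "((\<lambda>R. l2sq (\<lambda>\<xi>. fhat (truncate R (\<lambda>x. f x + f' x)) \<xi> - (g \<xi> + g' \<xi>))) \<longlongrightarrow> 0) at_top"
  proof (rule tendsto_sandwich[OF _ _ tendsto_const])
    have "((\<lambda>R. 2 * l2sq (\<lambda>x. fhat (truncate R f) x - g x) + 2 * l2sq (\<lambda>x. fhat (truncate R f') x - g' x)) \<longlongrightarrow> 0 + 0) at_top"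
      by (intro tendsto_add ennreal_tendsto_0_cmult lim) simp_all
    then show "((\<lambda>R. 2 * l2sq (\<lambda>x. fhat (truncate R f) x - g x) + 2 * l2sq (\<lambda>x. fhat (truncate R f') x - g' x)) \<longlongrightarrow> 0) at_top"
      by simp
    show "\<forall>\<^sub>F R in at_top. l2sq (\<lambda>\<xi>. fhat (truncate R (\<lambda>x. f x + f' x)) \<xi> - (g \<xi> + g' \<xi>))
       \<le> 2 * l2sq (\<lambda>x. fhat (truncate R f) x - g x) + 2 * l2sq (\<lambda>x. fhat (truncate R f') x - g' x)"
    proof (intro always_eventually allI)
      fix R
      show "l2sq (\<lambda>\<xi>. fhat (truncate R (\<lambda>x. f x + f' x)) \<xi> - (g \<xi> + g' \<xi>))
        \<le> 2 * l2sq (\<lambda>x. fhat (truncate R f) x - g x) + 2 * l2sq (\<lambda>x. fhat (truncate R f') x - g' x)"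
        unfolding eq add_diff_add by (rule l2sq_add_le) simp_all
    qed
  qed simp
  then show ?thesis
    unfolding is_L2_fourier_def tendsto_L2_iff using f g by (simp add: square_integrable_add)
qed

lemma is_L2_fourier_cmult:
  assumes "is_L2_fourier f g"
  shows "is_L2_fourier (\<lambda>x. c * f x) (\<lambda>x. c * g x)"
proof -
  have f: "square_integrable f" and g: "square_integrable g"
    and lim: "((\<lambda>R. l2sq (\<lambda>x. fhat (truncate R f) x - g x)) \<longlongrightarrow> 0) at_top"
    using assms unfolding is_L2_fourier_def tendsto_L2_iff by auto
  have [measurable]: "f \<in> borel_measurable borel" "g \<in> borel_measurable borel"
    using f g by (auto simp: square_integrable_def)
  have "truncate R (\<lambda>x. c * f x) = (\<lambda>x. c * truncate R f x)" for R
    by (auto simp: truncate_def)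
  then have eq: "fhat (truncate R (\<lambda>x. c * f x)) \<xi> - c * g \<xi> = c * (fhat (truncate R f) \<xi> - g \<xi>)" for R \<xi>
    by (simp add: fhat_cmult right_diff_distrib)
  have "((\<lambda>R. l2sq (\<lambda>\<xi>. fhat (truncate R (\<lambda>x. c * f x)) \<xi> - c * g \<xi>)) \<longlongrightarrow> 0) at_top"
    unfolding eq by (subst l2sq_cmult, simp, rule ennreal_tendsto_0_cmult[OF lim]) simp
  moreover have "square_integrable (\<lambda>x. c * f x)" "square_integrable (\<lambda>x. c * g x)"
    using f g by (auto simp: square_integrable_iff_l2sq l2sq_cmult ennreal_mult_less_top)
  ultimately show ?thesis
    unfolding is_L2_fourier_def tendsto_L2_iff by simp
qed

section \<open>Sobolev norms and extensions from the half-line\<close>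

abbreviation sobolev_energy :: "real \<Rightarrow> (real \<Rightarrow> complex) \<Rightarrow> ennreal" where
  "sobolev_energy r g \<equiv> \<integral>\<^sup>+\<xi>. ennreal ((1 + \<xi>\<^sup>2) powr r * (cmod (g \<xi>))\<^sup>2) \<partial>lborel"

text \<open>The Hilbert choice in \<open>sobolev_norm\<close> is harmless, because any two transforms agree almost everywhere.\<close>

lemma sobolev_norm_eq:
  assumes "is_L2_fourier f g"
  shows "sobolev_norm s f = sqrt (LINT \<xi>|lborel. (1 + \<xi>\<^sup>2) powr s * (cmod (g \<xi>))\<^sup>2)"
proof -
  let ?g = "SOME g. is_L2_fourier f g"
  have g': "is_L2_fourier f ?g" using assms by (rule someI[of "is_L2_fourier f"])
  then have [measurable]: "?g \<in> borel_measurable borel" "g \<in> borel_measurable borel" 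
    using assms by (auto simp: is_L2_fourier_def square_integrable_def)
  have "AE \<xi> in lborel. ?g \<xi> = g \<xi>" by (rule is_L2_fourier_unique[OF g' assms])
  then have "(LINT \<xi>|lborel. (1 + \<xi>\<^sup>2) powr s * (cmod (?g \<xi>))\<^sup>2) = (LINT \<xi>|lborel. (1 + \<xi>\<^sup>2) powr s * (cmod (g \<xi>))\<^sup>2)"
    by (intro integral_cong_AE) auto
  then show ?thesis unfolding sobolev_norm_def Let_def by simp
qed

lemma sobolev_normI:
  assumes fg: "is_L2_fourier f g" 
    and X: "sobolev_energy s g \<le> ennreal (X\<^sup>2)" and "X \<ge> 0"
  shows "f \<in> sobolev s" "sobolev_norm s f \<le> X"
proof -
  have [measurable]: "g \<in> borel_measurable borel" 
    using fg by (auto simp: is_L2_fourier_def square_integrable_def)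
  have int: "integrable lborel (\<lambda>\<xi>. (1 + \<xi>\<^sup>2) powr s * (cmod (g \<xi>))\<^sup>2)"
    using X by (intro integrableI_bounded) (auto simp: le_less_trans)
  then show "f \<in> sobolev s" unfolding sobolev_def using fg by auto
  have "ennreal (LINT \<xi>|lborel. (1 + \<xi>\<^sup>2) powr s * (cmod (g \<xi>))\<^sup>2) \<le> ennreal (X\<^sup>2)"
    using X nn_integral_eq_integral[OF int] by simp
  then have "(LINT \<xi>|lborel. (1 + \<xi>\<^sup>2) powr s * (cmod (g \<xi>))\<^sup>2) \<le> X\<^sup>2" by simp
  then show "sobolev_norm s f \<le> X"
    unfolding sobolev_norm_eq[OF fg] using real_sqrt_le_mono \<open>X \<ge> 0\<close> by fastforce
qed

lemma sobolev_fourierE: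
  assumes "f \<in> sobolev s"
  obtains g where "is_L2_fourier f g" 
    "sobolev_energy s g = ennreal ((sobolev_norm s f)\<^sup>2)"
proof -
  obtain g where fg: "is_L2_fourier f g"
    and int: "integrable lborel (\<lambda>\<xi>. (1 + \<xi>\<^sup>2) powr s * (cmod (g \<xi>))\<^sup>2)"
    using assms unfolding sobolev_def by auto
  show thesis
  proof (rule that[OF fg])
    have "(LINT \<xi>|lborel. (1 + \<xi>\<^sup>2) powr s * (cmod (g \<xi>))\<^sup>2) \<ge> 0" by simp
    then show "sobolev_energy s g = ennreal ((sobolev_norm s f)\<^sup>2)"
      unfolding sobolev_norm_eq[OF fg] using nn_integral_eq_integral[OF int] by simp
  qed
qed

lemma sobolev_norm_nonneg: "sobolev_norm s f \<ge> 0"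
  unfolding sobolev_norm_def Let_def by simp

text \<open>The factor \<open>2\<close> is that of \<open>\<bar>a + b\<bar>\<^sup>2 \<le> 2 \<bar>a\<bar>\<^sup>2 + 2 \<bar>b\<bar>\<^sup>2\<close>; the constant in the final estimate absorbs it.\<close>

lemma sobolev_add:
  assumes "f \<in> sobolev s" "f' \<in> sobolev s"
  shows "(\<lambda>x. f x + f' x) \<in> sobolev s"
    and "sobolev_norm s (\<lambda>x. f x + f' x) \<le> 2 * (sobolev_norm s f + sobolev_norm s f')"
proof -
  obtain g where fg: "is_L2_fourier f g" and
    N: "sobolev_energy s g = ennreal ((sobolev_norm s f)\<^sup>2)"
    by (rule sobolev_fourierE[OF assms(1)])
  obtain g' where fg': "is_L2_fourier f' g'" and
    N': "sobolev_energy s g' = ennreal ((sobolev_norm s f')\<^sup>2)"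
    by (rule sobolev_fourierE[OF assms(2)])
  have [measurable]: "g \<in> borel_measurable borel" "g' \<in> borel_measurable borel"
    using fg fg' by (auto simp: is_L2_fourier_def square_integrable_def)
  let ?w = "\<lambda>\<xi>. (1 + \<xi>\<^sup>2) powr s"
  let ?a = "sobolev_norm s f" and ?b = "sobolev_norm s f'"
  have "(\<integral>\<^sup>+\<xi>. ennreal (?w \<xi> * (cmod (g \<xi> + g' \<xi>))\<^sup>2) \<partial>lborel)
    \<le> (\<integral>\<^sup>+\<xi>. 2 * ennreal (?w \<xi> * (cmod (g \<xi>))\<^sup>2) + 2 * ennreal (?w \<xi> * (cmod (g' \<xi>))\<^sup>2) \<partial>lborel)"
  proof (rule nn_integral_mono)
    fix \<xi> :: real
    have "?w \<xi> * (cmod (g \<xi> + g' \<xi>))\<^sup>2 \<le> ?w \<xi> * (2 * (cmod (g \<xi>))\<^sup>2 + 2 * (cmod (g' \<xi>))\<^sup>2)"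
      using norm_add_sq_weighted_le[of 1 "g \<xi>" "g' \<xi>"] by (intro mult_left_mono) simp_all
    also have "\<dots> = 2 * (?w \<xi> * (cmod (g \<xi>))\<^sup>2) + 2 * (?w \<xi> * (cmod (g' \<xi>))\<^sup>2)"
      by (simp add: algebra_simps)
    finally have "ennreal (?w \<xi> * (cmod (g \<xi> + g' \<xi>))\<^sup>2) \<le> ennreal (2 * (?w \<xi> * (cmod (g \<xi>))\<^sup>2) + 2 * (?w \<xi> * (cmod (g' \<xi>))\<^sup>2))"
      by (rule ennreal_leI)
    also have "\<dots> = 2 * ennreal (?w \<xi> * (cmod (g \<xi>))\<^sup>2) + 2 * ennreal (?w \<xi> * (cmod (g' \<xi>))\<^sup>2)"
      by (subst ennreal_plus) (simp_all add: ennreal_mult')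
    finally show "ennreal (?w \<xi> * (cmod (g \<xi> + g' \<xi>))\<^sup>2) \<le> 2 * ennreal (?w \<xi> * (cmod (g \<xi>))\<^sup>2) + 2 * ennreal (?w \<xi> * (cmod (g' \<xi>))\<^sup>2)" .
  qed
  also have "\<dots> = 2 * ennreal (?a\<^sup>2) + 2 * ennreal (?b\<^sup>2)"
    by (simp add: nn_integral_add nn_integral_cmult N N')
  also have "\<dots> = ennreal (2 * ?a\<^sup>2 + 2 * ?b\<^sup>2)"
    by (subst ennreal_plus) (simp_all add: ennreal_mult')
  also have "\<dots> \<le> ennreal ((2 * (?a + ?b))\<^sup>2)"
    using sobolev_norm_nonneg[of s f] sobolev_norm_nonneg[of s f']
    by (intro ennreal_leI) (simp add: power2_eq_square algebra_simps)
  finally have *: "(\<integral>\<^sup>+\<xi>. ennreal (?w \<xi> * (cmod (g \<xi> + g' \<xi>))\<^sup>2) \<partial>lborel) \<le> ennreal ((2 * (?a + ?b))\<^sup>2)" .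
  have "0 \<le> 2 * (?a + ?b)" using sobolev_norm_nonneg[of s f] sobolev_norm_nonneg[of s f'] by simp
  from sobolev_normI[OF is_L2_fourier_add[OF fg fg'] * this]
  show "(\<lambda>x. f x + f' x) \<in> sobolev s" "sobolev_norm s (\<lambda>x. f x + f' x) \<le> 2 * (?a + ?b)" by simp_all
qed

lemma sobolev_cmult:
  assumes "f \<in> sobolev s"
  shows "(\<lambda>x. c * f x) \<in> sobolev s"
    and "sobolev_norm s (\<lambda>x. c * f x) \<le> cmod c * sobolev_norm s f"
proof -
  obtain g where fg: "is_L2_fourier f g" and
    N: "sobolev_energy s g = ennreal ((sobolev_norm s f)\<^sup>2)"
    by (rule sobolev_fourierE[OF assms(1)])
  have [measurable]: "g \<in> borel_measurable borel"
    using fg by (auto simp: is_L2_fourier_def square_integrable_def)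
  have E: "(1 + \<xi>\<^sup>2) powr s * (cmod (c * g \<xi>))\<^sup>2 = (cmod c)\<^sup>2 * ((1 + \<xi>\<^sup>2) powr s * (cmod (g \<xi>))\<^sup>2)" for \<xi> :: real
    by (simp add: norm_mult power_mult_distrib)
  have "(\<integral>\<^sup>+\<xi>. ennreal ((1 + \<xi>\<^sup>2) powr s * (cmod (c * g \<xi>))\<^sup>2) \<partial>lborel)
    = (\<integral>\<^sup>+\<xi>. ennreal ((cmod c)\<^sup>2) * ennreal ((1 + \<xi>\<^sup>2) powr s * (cmod (g \<xi>))\<^sup>2) \<partial>lborel)"
    unfolding E by (intro nn_integral_cong ennreal_mult') simp
  also have "\<dots> = ennreal ((cmod c)\<^sup>2) * ennreal ((sobolev_norm s f)\<^sup>2)"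
    by (subst nn_integral_cmult) (simp_all add: N)
  also have "\<dots> = ennreal ((cmod c * sobolev_norm s f)\<^sup>2)"
    by (simp add: ennreal_mult' power_mult_distrib)
  finally have *: "(\<integral>\<^sup>+\<xi>. ennreal ((1 + \<xi>\<^sup>2) powr s * (cmod (c * g \<xi>))\<^sup>2) \<partial>lborel)
    \<le> ennreal ((cmod c * sobolev_norm s f)\<^sup>2)" by simp
  have "0 \<le> cmod c * sobolev_norm s f" using sobolev_norm_nonneg[of s f] by simp
  from sobolev_normI[OF is_L2_fourier_cmult[OF fg] * this]
  show "(\<lambda>x. c * f x) \<in> sobolev s" "sobolev_norm s (\<lambda>x. c * f x) \<le> cmod c * sobolev_norm s f" by simp_all
qed

text \<open>A bound on the quotient norm that is witnessed by an extension; such bounds are stable under sums and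
multiples, so the pieces of the contour can be treated one at a time.\<close>

definition half_line_bound :: "real \<Rightarrow> (real \<Rightarrow> complex) \<Rightarrow> real \<Rightarrow> bool" where
  "half_line_bound s u a \<longleftrightarrow>
     (\<exists>F\<in>sobolev s. (AE x in lborel. x > 0 \<longrightarrow> F x = u x) \<and> sobolev_norm s F \<le> a)"

lemma half_line_bound_sobolev_half_line:
  assumes "half_line_bound s u a"
  shows "u \<in> sobolev_half_line s" "sobolev_half_line_norm s u \<le> a"
proof -
  obtain F where F: "F \<in> half_line_extensions s u" "sobolev_norm s F \<le> a"
    using assms unfolding half_line_bound_def half_line_extensions_def by auto
  then show "u \<in> sobolev_half_line s" unfolding sobolev_half_line_def by auto
  have "sobolev_half_line_norm s u \<le> sobolev_norm s F"
    unfolding sobolev_half_line_norm_def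
    by (rule cInf_lower) (use F sobolev_norm_nonneg in \<open>auto intro!: bdd_belowI[of _ 0]\<close>)
  with F show "sobolev_half_line_norm s u \<le> a" by simp
qed

lemma half_line_bound_cong:
  assumes "half_line_bound s u a" "AE x in lborel. x > 0 \<longrightarrow> u x = u' x" "a \<le> a'"
  shows "half_line_bound s u' a'"
proof -
  obtain F where F: "F \<in> sobolev s" "AE x in lborel. x > 0 \<longrightarrow> F x = u x" "sobolev_norm s F \<le> a"
    using assms unfolding half_line_bound_def by auto
  have "AE x in lborel. x > 0 \<longrightarrow> F x = u' x" using F(2) assms(2) by eventually_elim simp
  moreover have "sobolev_norm s F \<le> a'" using F(3) assms(3) by simp
  ultimately show ?thesis unfolding half_line_bound_def using F(1) by (intro bexI[of _ F] conjI)
qed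

lemma half_line_bound_add:
  assumes "half_line_bound s u a" "half_line_bound s u' a'"
  shows "half_line_bound s (\<lambda>x. u x + u' x) (2 * (a + a'))"
proof -
  obtain F where F: "F \<in> sobolev s" "AE x in lborel. x > 0 \<longrightarrow> F x = u x" "sobolev_norm s F \<le> a"
    using assms unfolding half_line_bound_def by auto
  obtain F' where F': "F' \<in> sobolev s" "AE x in lborel. x > 0 \<longrightarrow> F' x = u' x" "sobolev_norm s F' \<le> a'"
    using assms unfolding half_line_bound_def by auto
  have "AE x in lborel. x > 0 \<longrightarrow> F x + F' x = u x + u' x" using F(2) F'(2) by eventually_elim simp
  moreover have "sobolev_norm s (\<lambda>x. F x + F' x) \<le> 2 * (a + a')"
    using sobolev_add(2)[OF F(1) F'(1)] F(3) F'(3) by simp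
  ultimately show ?thesis unfolding half_line_bound_def using sobolev_add(1)[OF F(1) F'(1)] by (intro bexI[of _ "\<lambda>x. F x + F' x"] conjI)
qed

lemma half_line_bound_cmult:
  assumes "half_line_bound s u a"
  shows "half_line_bound s (\<lambda>x. c * u x) (cmod c * a)"
proof -
  obtain F where F: "F \<in> sobolev s" "AE x in lborel. x > 0 \<longrightarrow> F x = u x" "sobolev_norm s F \<le> a"
    using assms unfolding half_line_bound_def by auto
  have "AE x in lborel. x > 0 \<longrightarrow> c * F x = c * u x" using F(2) by eventually_elim simp
  moreover have "sobolev_norm s (\<lambda>x. c * F x) \<le> cmod c * a"
    using sobolev_cmult(2)[OF F(1), of c] mult_left_mono[OF F(3), of "cmod c"] by simp
  ultimately show ?thesis unfolding half_line_bound_def using sobolev_cmult(1)[OF F(1)] by (intro bexI[of _ "\<lambda>x. c * F x"] conjI)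
qed

section \<open>Data with compact support\<close>

text \<open>By the Lindelof property countably many of the open sets in the definition of the support cover their
union, so the exceptional null sets add up to a null set.\<close>

lemma ess_support_AE:
  assumes "ess_support f \<subseteq> A"
  shows "AE x in lborel. x \<notin> A \<longrightarrow> f x = 0"
proof -
  let ?U = "{U. open U \<and> (AE x in lborel. x \<in> U \<longrightarrow> f x = 0)}"
  obtain V where V: "V \<subseteq> ?U" "countable V" "\<Union>V = \<Union>?U"
    using Lindelof[of ?U] by auto
  have "AE x in lborel. \<forall>U\<in>V. x \<in> U \<longrightarrow> f x = 0"
    using V(1,2) by (subst AE_ball_countable) auto
  then show ?thesis
  proof eventually_elim
    case (elim x)
    have "- A \<subseteq> \<Union>?U" using assms unfolding ess_support_def by blast
    then have "x \<in> \<Union>V" if "x \<notin> A" using that V(3) by auto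
    with elim show ?case by auto
  qed
qed

text \<open>The truncations agree with \<open>f\<close> as soon as the truncation parameter exceeds \<open>T\<close>, so the limit in \<open>L\<^sup>2\<close> is
the integral itself.\<close>

lemma fourier_of_compact_support:
  assumes fg: "is_L2_fourier f g" and supp: "AE x in lborel. x \<notin> {0..T} \<longrightarrow> f x = 0"
  shows "integrable lborel f" "is_L2_fourier f (fhat f)"
proof -
  have f: "square_integrable f" and g: "square_integrable g"
    and lim: "((\<lambda>R. l2sq (\<lambda>\<xi>. fhat (truncate R f) \<xi> - g \<xi>)) \<longlongrightarrow> 0) at_top"
    using fg unfolding is_L2_fourier_def tendsto_L2_iff by auto
  have [measurable]: "f \<in> borel_measurable borel" "g \<in> borel_measurable borel"
    using f g by (auto simp: square_integrable_def)
  have eq: "AE x in lborel. truncate R f x = f x" if "R \<ge> T" for R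
    using supp by eventually_elim (use that in \<open>auto simp: truncate_def indicator_def\<close>)
  show int: "integrable lborel f"
    using integrable_cong_AE[of "truncate T f" lborel f] integrable_truncate[OF f] eq[of T] by simp
  have fhat_eq: "fhat (truncate R f) \<xi> = fhat f \<xi>" if "R \<ge> T" for R \<xi>
    unfolding fourier_def using eq[OF that] by (intro integral_cong_AE) auto
  have "((\<lambda>R. l2sq (\<lambda>\<xi>. fhat f \<xi> - g \<xi>)) \<longlongrightarrow> 0) (at_top :: real filter)"
    by (rule Lim_transform_eventually[OF lim])
       (use eventually_ge_at_top[of T] in \<open>eventually_elim, simp add: fhat_eq\<close>)
  then have "l2sq (\<lambda>\<xi>. fhat f \<xi> - g \<xi>) = 0" by (simp add: tendsto_const_iff)
  then have ae: "AE \<xi> in lborel. fhat f \<xi> = g \<xi>" by (subst (asm) l2sq_eq_0_iff) auto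
  have "l2sq (\<lambda>\<xi>. fhat (truncate R f) \<xi> - fhat f \<xi>) = l2sq (\<lambda>\<xi>. fhat (truncate R f) \<xi> - g \<xi>)" for R
    by (rule l2sq_cong_AE) (use ae in \<open>eventually_elim, simp\<close>)
  then show "is_L2_fourier f (fhat f)"
    using lim f square_integrable_fhat[OF int f] unfolding is_L2_fourier_def tendsto_L2_iff by simp
qed

lemma sobolev_compact_support:
  assumes f: "f \<in> sobolev r" and r: "r \<ge> 0" and supp: "AE x in lborel. x \<notin> {0..T} \<longrightarrow> f x = 0"
  shows "integrable lborel f" "square_integrable f"
    and "sobolev_energy r (fhat f) = ennreal ((sobolev_norm r f)\<^sup>2)"
    and "l2sq f \<le> ennreal ((sobolev_norm r f)\<^sup>2)"
proof -
  obtain g where fg: "is_L2_fourier f g" 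
    and N: "sobolev_energy r g = ennreal ((sobolev_norm r f)\<^sup>2)"
    by (rule sobolev_fourierE[OF f])
  note ff = fourier_of_compact_support[OF fg supp]
  show int: "integrable lborel f" by (rule ff)
  show sq: "square_integrable f" using fg unfolding is_L2_fourier_def by simp
  have "AE \<xi> in lborel. fhat f \<xi> = g \<xi>" by (rule is_L2_fourier_unique[OF ff(2) fg])
  then have "sobolev_energy r (fhat f) 
     = sobolev_energy r g"
    by (intro nn_integral_cong_AE) (auto elim!: eventually_mono)
  then show *: "sobolev_energy r (fhat f) = ennreal ((sobolev_norm r f)\<^sup>2)"
    using N by simp
  have "1 * l2sq f \<le> ennreal (2 * pi) * l2sq f"
    using pi_gt3 by (intro mult_right_mono) (auto simp: ennreal_leI simp flip: ennreal_1)
  also have "\<dots> = l2sq (fhat f)" by (rule plancherel[OF int sq, symmetric])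
  also have "\<dots> \<le> sobolev_energy r (fhat f)"
    unfolding l2sq_def
  proof (intro nn_integral_mono ennreal_leI)
    fix \<xi> :: real
    have "1 \<le> (1 + \<xi>\<^sup>2) powr r" using r by (intro ge_one_powr_ge_zero) simp_all
    then show "(cmod (fhat f \<xi>))\<^sup>2 \<le> (1 + \<xi>\<^sup>2) powr r * (cmod (fhat f \<xi>))\<^sup>2"
      using mult_right_mono[of 1 _ "(cmod (fhat f \<xi>))\<^sup>2"] by simp
  qed
  finally show "l2sq f \<le> ennreal ((sobolev_norm r f)\<^sup>2)" unfolding * by simp
qed

text \<open>At complex frequencies the exponential is at most \<open>exp (\<bar>\<tau>\<bar> T)\<close> on the support; the
Cauchy-Schwarz inequality on \<open>[0, T]\<close> yields \<open>sqrt T\<close>.\<close>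

lemma fourier_compact_support_bound:
  assumes f: "square_integrable f" and supp: "AE x in lborel. x \<notin> {0..T} \<longrightarrow> f x = 0" and T: "T \<ge> 0"
    and X: "l2sq f \<le> ennreal (X\<^sup>2)" "X \<ge> 0"
  shows "cmod (fourier f \<tau>) \<le> exp (cmod \<tau> * T) * sqrt T * X"
proof -
  have [measurable]: "f \<in> borel_measurable borel" using f by (simp add: square_integrable_def)
  have "ennreal (cmod (fourier f \<tau>)) \<le> (\<integral>\<^sup>+t. ennreal (cmod (exp (- (\<i> * \<tau> * of_real t)) * f t)) \<partial>lborel)"
    unfolding fourier_def
    by (cases "integrable lborel (\<lambda>t. exp (- (\<i> * \<tau> * of_real t)) * f t)",
        rule integral_norm_bound_ennreal, assumption, simp add: not_integrable_integral_eq)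
  also have "\<dots> \<le> (\<integral>\<^sup>+t. ennreal (exp (cmod \<tau> * T)) * (ennreal (cmod (f t)) * indicator {0..T} t) \<partial>lborel)"
  proof (rule nn_integral_mono_AE)
    show "AE t in lborel. ennreal (cmod (exp (- (\<i> * \<tau> * of_real t)) * f t))
        \<le> ennreal (exp (cmod \<tau> * T)) * (ennreal (cmod (f t)) * indicator {0..T} t)"
      using supp
    proof eventually_elim
      case (elim t)
      show ?case
      proof (cases "t \<in> {0..T}")
        case True
        have "Im \<tau> * t \<le> cmod \<tau> * t" using True abs_Im_le_cmod[of \<tau>] by (intro mult_right_mono) simp_all
        also have "\<dots> \<le> cmod \<tau> * T" using True by (intro mult_left_mono) simp_all
        finally have "exp (Im \<tau> * t) \<le> exp (cmod \<tau> * T)" by simp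
        then have "exp (Im \<tau> * t) * cmod (f t) \<le> exp (cmod \<tau> * T) * cmod (f t)"
          by (rule mult_right_mono) simp
        then have "ennreal (cmod (exp (- (\<i> * \<tau> * of_real t)) * f t)) \<le> ennreal (exp (cmod \<tau> * T) * cmod (f t))"
          by (intro ennreal_leI) (simp add: norm_mult)
        then show ?thesis using True by (simp add: ennreal_mult)
      qed (use elim in simp)
    qed
  qed
  also have "\<dots> = ennreal (exp (cmod \<tau> * T)) * (\<integral>\<^sup>+t. ennreal (cmod (f t)) * indicator {0..T} t \<partial>lborel)"
    by (rule nn_integral_cmult) simp
  also have "\<dots> \<le> ennreal (exp (cmod \<tau> * T)) * ennreal (sqrt T * X)"
  proof (rule mult_left_mono)
    have "(\<integral>\<^sup>+t. ennreal (cmod (f t)) * indicator {0..T} t \<partial>lborel)\<^sup>2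
       \<le> (\<integral>\<^sup>+t. (ennreal (cmod (f t)))\<^sup>2 \<partial>lborel) * (\<integral>\<^sup>+t. (indicator {0..T} t)\<^sup>2 \<partial>lborel)"
      by (rule Cauchy_Schwarz_nn_integral) simp_all
    also have "(\<integral>\<^sup>+t. (ennreal (cmod (f t)))\<^sup>2 \<partial>lborel) = l2sq f"
      unfolding l2sq_def by (intro nn_integral_cong) (simp add: ennreal_power)
    also have "(\<integral>\<^sup>+t. (indicator {0..T} t :: ennreal)\<^sup>2 \<partial>lborel) = (\<integral>\<^sup>+t. indicator {0..T} t \<partial>lborel)"
      by (intro nn_integral_cong) (simp add: indicator_def)
    also have "\<dots> = ennreal T" using T by simp
    also have "l2sq f * ennreal T \<le> ennreal (X\<^sup>2) * ennreal T" by (intro mult_right_mono X) simp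
    also have "\<dots> = ennreal (X\<^sup>2 * T)" by (rule ennreal_mult'[symmetric]) simp
    also have "X\<^sup>2 * T = (sqrt T * X)\<^sup>2" using T by (simp add: power_mult_distrib)
    also have "ennreal ((sqrt T * X)\<^sup>2) = (ennreal (sqrt T * X))\<^sup>2"
      by (rule ennreal_power[symmetric]) (use T X in simp)
    finally have sq: "(\<integral>\<^sup>+t. ennreal (cmod (f t)) * indicator {0..T} t \<partial>lborel)\<^sup>2 \<le> (ennreal (sqrt T * X))\<^sup>2" .
    show "(\<integral>\<^sup>+t. ennreal (cmod (f t)) * indicator {0..T} t \<partial>lborel) \<le> ennreal (sqrt T * X)"
    proof (cases "\<integral>\<^sup>+t. ennreal (cmod (f t)) * indicator {0..T} t \<partial>lborel")
      case (real a)
      have "ennreal (a\<^sup>2) \<le> ennreal ((sqrt T * X)\<^sup>2)"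
        using sq T X(2) unfolding real by (subst (1 2) ennreal_power[symmetric]) (use real(1) in simp_all)
      then have "a\<^sup>2 \<le> (sqrt T * X)\<^sup>2" by simp
      then have "a \<le> sqrt T * X" by (rule power2_le_imp_le) (use T X(2) in simp)
      then show ?thesis unfolding real by (rule ennreal_leI)
    next
      case top
      have "(ennreal (sqrt T * X))\<^sup>2 < \<infinity>" by (subst ennreal_power) (use T X(2) in simp_all)
      then show ?thesis using sq unfolding top by (simp add: power2_eq_square top_unique)
    qed
  qed simp
  also have "\<dots> = ennreal (exp (cmod \<tau> * T) * (sqrt T * X))"
    by (rule ennreal_mult'[symmetric]) simp
  finally have "ennreal (cmod (fourier f \<tau>)) \<le> ennreal (exp (cmod \<tau> * T) * (sqrt T * X))" .
  then have "cmod (fourier f \<tau>) \<le> exp (cmod \<tau> * T) * (sqrt T * X)"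
    by (rule ennreal_le_iff[THEN iffD1, rotated]) (use T X in simp)
  then show ?thesis by (simp only: mult.assoc)
qed

section \<open>Schur's test and Hilbert's kernel\<close>

text \<open>An antiderivative is \<open>2 / sqrt b * arctan (sqrt (r / b))\<close>.\<close>

lemma hilbert_kernel_half:
  assumes "b > 0"
  shows "(\<integral>\<^sup>+r. ennreal (1 / (sqrt r * (r + b))) * indicator {0<..} r \<partial>lborel) = ennreal (pi / sqrt b)"
proof -
  let ?f = "\<lambda>r. 1 / (sqrt r * (r + b))"
  let ?F = "\<lambda>r. 2 / sqrt b * arctan (sqrt r / sqrt b)"
  have deriv: "DERIV ?F r :> ?f r" if "r > 0" for r
  proof -
    have "DERIV (\<lambda>r. arctan (sqrt r / sqrt b)) r :>
        inverse (1 + (sqrt r / sqrt b)\<^sup>2) * (inverse (sqrt r) / 2 / sqrt b)"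
      by (rule DERIV_chain2[OF DERIV_arctan DERIV_cdivide[OF DERIV_real_sqrt[OF that]]])
    then have D: "DERIV ?F r :> 2 / sqrt b * (inverse (1 + (sqrt r / sqrt b)\<^sup>2) * (inverse (sqrt r) / 2 / sqrt b))"
      by (rule DERIV_cmult)
    define t u where "t = sqrt b" and "u = sqrt r"
    have tu: "t > 0" "u > 0" "b = t * t" "r = u * u" using that assms by (auto simp: t_def u_def)
    define S where "S = u * u + t * t"
    have pos: "S > 0" using tu by (simp add: S_def add_pos_pos)
    have "2 / t * (inverse (1 + (u / t)\<^sup>2) * (inverse u / 2 / t)) = 1 / (u * S)"
    proof -
      have e: "1 + (u / t)\<^sup>2 = S / (t * t)"
        using tu by (simp add: power2_eq_square field_simps S_def)
      show ?thesis unfolding e using tu(1,2) pos by (simp add: field_simps)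
    qed
    then show ?thesis using D tu(3,4) unfolding t_def u_def S_def by simp
  qed
  have "((\<lambda>r. sqrt r / sqrt b) \<longlongrightarrow> sqrt 0 / sqrt b) (at_right 0)"
    by (intro tendsto_intros) (use assms in auto)
  then have A: "((?F \<circ> real_of_ereal) \<longlongrightarrow> 0) (at_right 0)"
    unfolding zero_ereal_def ereal_tendsto_simps
    using assms by (auto intro!: tendsto_eq_intros)
  have "filterlim (\<lambda>r. (1 / sqrt b) * sqrt r) at_top at_top"
    by (rule filterlim_tendsto_pos_mult_at_top[OF tendsto_const _ sqrt_at_top]) (use assms in simp)
  then have "filterlim (\<lambda>r. sqrt r / sqrt b) at_top at_top" by simp
  then have "((\<lambda>r. arctan (sqrt r / sqrt b)) \<longlongrightarrow> pi / 2) at_top"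
    by (rule filterlim_compose[OF tendsto_arctan_at_top])
  then have "(?F \<longlongrightarrow> 2 / sqrt b * (pi / 2)) at_top"
    by (rule tendsto_mult_left)
  then have B: "((?F \<circ> real_of_ereal) \<longlongrightarrow> pi / sqrt b) (at_left \<infinity>)"
    unfolding ereal_tendsto_simps by simp
  have cont: "isCont ?f r" if "0 < ereal r" for r
    using that assms by (intro continuous_intros) auto
  note ftc = interval_integral_FTC_nonneg[of 0 \<infinity> ?F ?f 0 "pi / sqrt b", OF _ _ _ _ A B]
  have int: "set_integrable lborel (einterval 0 \<infinity>) ?f"
    by (rule ftc(1)) (use deriv cont assms in auto)
  have val: "(LBINT x=0..\<infinity>. ?f x) = pi / sqrt b - 0"
    by (rule ftc(2)) (use deriv cont assms in auto)
  have ein: "einterval 0 \<infinity> = {0::real<..}" by (auto simp: einterval_def)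
  have "(\<integral>\<^sup>+r. ennreal (indicator {0<..} r *\<^sub>R ?f r) \<partial>lborel) = ennreal (LINT r|lborel. indicator {0<..} r *\<^sub>R ?f r)"
    by (rule nn_integral_eq_integral)
       (use int assms in \<open>auto simp: set_integrable_def ein indicator_def\<close>)
  also have "(LINT r|lborel. indicator {0<..} r *\<^sub>R ?f r) = pi / sqrt b"
    using val unfolding interval_lebesgue_integral_def set_lebesgue_integral_def ein by simp
  also have "(\<integral>\<^sup>+r. ennreal (indicator {0<..} r *\<^sub>R ?f r) \<partial>lborel)
     = (\<integral>\<^sup>+r. ennreal (?f r) * indicator {0<..} r \<partial>lborel)"
    by (intro nn_integral_cong) (simp add: indicator_def)
  finally show ?thesis .
qed

lemma hilbert_kernel:
  fixes c :: real
  assumes "b > 0"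
  shows "(\<integral>\<^sup>+r. ennreal (1 / (sqrt \<bar>r - c\<bar> * (\<bar>r - c\<bar> + b))) \<partial>lborel) = ennreal (2 * pi / sqrt b)"
proof -
  let ?f = "\<lambda>r. ennreal (1 / (sqrt \<bar>r\<bar> * (\<bar>r\<bar> + b)))"
  have "(\<integral>\<^sup>+r. ennreal (1 / (sqrt \<bar>r - c\<bar> * (\<bar>r - c\<bar> + b))) \<partial>lborel) = (\<integral>\<^sup>+r. ?f r \<partial>lborel)"
    using nn_integral_shift[of ?f "- c"] by simp
  also have "\<dots> = (\<integral>\<^sup>+r. ?f r * indicator {0<..} r + ?f (- r) * indicator {0<..} (- r) \<partial>lborel)"
    by (intro nn_integral_cong) (auto simp: indicator_def)
  also have "\<dots> = (\<integral>\<^sup>+r. ?f r * indicator {0<..} r \<partial>lborel) + (\<integral>\<^sup>+r. ?f (- r) * indicator {0<..} (- r) \<partial>lborel)"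
    by (rule nn_integral_add) simp_all
  also have "(\<integral>\<^sup>+r. ?f (- r) * indicator {0<..} (- r) \<partial>lborel) = (\<integral>\<^sup>+r. ?f r * indicator {0<..} r \<partial>lborel)"
    using nn_integral_real_affine[of "\<lambda>r. ?f r * indicator {0<..} r" "-1" 0] by simp
  also have "(\<integral>\<^sup>+r. ?f r * indicator {0<..} r \<partial>lborel) = ennreal (pi / sqrt b)"
    unfolding hilbert_kernel_half[OF assms, symmetric] by (intro nn_integral_cong) (auto simp: indicator_def)
  also have "ennreal (pi / sqrt b) + ennreal (pi / sqrt b) = ennreal (2 * pi / sqrt b)"
    by (subst ennreal_plus[symmetric]) (use assms in simp_all)
  finally show ?thesis .
qed

abbreviation l2sq_on :: "'a measure \<Rightarrow> ('a \<Rightarrow> complex) \<Rightarrow> ennreal" where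
  "l2sq_on M f \<equiv> \<integral>\<^sup>+\<rho>. ennreal ((cmod (f \<rho>))\<^sup>2) \<partial>M"

abbreviation kernel_energy :: "'a measure \<Rightarrow> ('a \<Rightarrow> complex) \<Rightarrow> (real \<Rightarrow> 'a \<Rightarrow> complex) \<Rightarrow> ennreal" where
  "kernel_energy M f K \<equiv> \<integral>\<^sup>+x. (\<integral>\<^sup>+\<rho>. ennreal (cmod (f \<rho> * K x \<rho>)) \<partial>M)\<^sup>2 \<partial>lborel"

text \<open>The Cauchy-Schwarz inequality for the splitting \<open>f K = (K p)\<^sup>1\<^sup>/\<^sup>2 * (f\<^sup>2 K / p)\<^sup>1\<^sup>/\<^sup>2\<close> uses \<open>h1\<close>; integrating the
second factor against \<open>P\<close> uses \<open>h2\<close>.\<close>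

lemma schur_test:
  fixes K :: "real \<Rightarrow> 'a \<Rightarrow> complex" and f :: "'a \<Rightarrow> complex"
  assumes M: "sigma_finite_measure M"
    and [measurable]: "case_prod K \<in> borel_measurable (lborel \<Otimes>\<^sub>M M)" "f \<in> borel_measurable M"
      "p \<in> borel_measurable M" "P \<in> borel_measurable borel"
    and p: "\<And>\<rho>. p \<rho> > 0" and P: "\<And>x. P x \<ge> 0" and A: "A \<ge> 0" and B: "B \<ge> 0"
    and h1: "AE x in lborel. (\<integral>\<^sup>+\<rho>. ennreal (cmod (K x \<rho>) * p \<rho>) \<partial>M) \<le> ennreal (A * P x)"
    and h2: "\<And>\<rho>. (\<integral>\<^sup>+x. ennreal (cmod (K x \<rho>) * P x) \<partial>lborel) \<le> ennreal (B * p \<rho>)"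
  shows "kernel_energy M f K
    \<le> ennreal (A * B) * l2sq_on M f"
proof -
  interpret sigma_finite_measure M by (rule M)
  interpret pair_sigma_finite lborel M by unfold_locales
  have step: "AE x in lborel. (\<integral>\<^sup>+\<rho>. ennreal (cmod (f \<rho> * K x \<rho>)) \<partial>M)\<^sup>2
     \<le> (\<integral>\<^sup>+\<rho>. ennreal (A * P x) * ennreal ((cmod (f \<rho>))\<^sup>2 * cmod (K x \<rho>) / p \<rho>) \<partial>M)"
    using h1
  proof eventually_elim
    case (elim x)
    have [measurable]: "K x \<in> borel_measurable M"
      using measurable_Pair2[of "case_prod K" lborel M borel x] by simp
    let ?a = "\<lambda>\<rho>. ennreal (sqrt (cmod (K x \<rho>) * p \<rho>))"
    let ?b = "\<lambda>\<rho>. ennreal (cmod (f \<rho>) * sqrt (cmod (K x \<rho>) / p \<rho>))"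
    have p': "0 \<le> p \<rho>" "p \<rho> \<noteq> 0" for \<rho> using p[of \<rho>] by auto
    have ab: "ennreal (cmod (f \<rho> * K x \<rho>)) = ?a \<rho> * ?b \<rho>" for \<rho>
    proof -
      have "sqrt (cmod (K x \<rho>) * p \<rho>) * sqrt (cmod (K x \<rho>) / p \<rho>) = cmod (K x \<rho>)"
        using p' by (simp add: real_sqrt_mult[symmetric])
      then have "sqrt (cmod (K x \<rho>) * p \<rho>) * (cmod (f \<rho>) * sqrt (cmod (K x \<rho>) / p \<rho>)) = cmod (f \<rho> * K x \<rho>)"
        by (simp only: mult.left_commute norm_mult)
      then show ?thesis using p' by (subst ennreal_mult[symmetric]) simp_all
    qed
    have "(\<integral>\<^sup>+\<rho>. ennreal (cmod (f \<rho> * K x \<rho>)) \<partial>M)\<^sup>2 \<le> (\<integral>\<^sup>+\<rho>. ?a \<rho> ^ 2 \<partial>M) * (\<integral>\<^sup>+\<rho>. ?b \<rho> ^ 2 \<partial>M)"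
      unfolding ab by (rule Cauchy_Schwarz_nn_integral) simp_all
    also have "(\<integral>\<^sup>+\<rho>. ?a \<rho> ^ 2 \<partial>M) = (\<integral>\<^sup>+\<rho>. ennreal (cmod (K x \<rho>) * p \<rho>) \<partial>M)"
      using p' by (intro nn_integral_cong) (simp add: ennreal_power)
    also have "(\<integral>\<^sup>+\<rho>. ?b \<rho> ^ 2 \<partial>M) = (\<integral>\<^sup>+\<rho>. ennreal ((cmod (f \<rho>))\<^sup>2 * cmod (K x \<rho>) / p \<rho>) \<partial>M)"
      using p' by (intro nn_integral_cong) (simp add: ennreal_power power_mult_distrib)
    also have "(\<integral>\<^sup>+\<rho>. ennreal (cmod (K x \<rho>) * p \<rho>) \<partial>M) * (\<integral>\<^sup>+\<rho>. ennreal ((cmod (f \<rho>))\<^sup>2 * cmod (K x \<rho>) / p \<rho>) \<partial>M)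
      \<le> ennreal (A * P x) * (\<integral>\<^sup>+\<rho>. ennreal ((cmod (f \<rho>))\<^sup>2 * cmod (K x \<rho>) / p \<rho>) \<partial>M)"
      by (intro mult_right_mono elim) simp
    also have "\<dots> = (\<integral>\<^sup>+\<rho>. ennreal (A * P x) * ennreal ((cmod (f \<rho>))\<^sup>2 * cmod (K x \<rho>) / p \<rho>) \<partial>M)"
      by (rule nn_integral_cmult[symmetric]) simp
    finally show ?case .
  qed
  have "kernel_energy M f K
    \<le> (\<integral>\<^sup>+x. \<integral>\<^sup>+\<rho>. ennreal (A * P x) * ennreal ((cmod (f \<rho>))\<^sup>2 * cmod (K x \<rho>) / p \<rho>) \<partial>M \<partial>lborel)"
    by (rule nn_integral_mono_AE[OF step])
  also have "\<dots> = (\<integral>\<^sup>+\<rho>. \<integral>\<^sup>+x. ennreal (A * P x) * ennreal ((cmod (f \<rho>))\<^sup>2 * cmod (K x \<rho>) / p \<rho>) \<partial>lborel \<partial>M)"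
    by (rule Fubini'[symmetric]) measurable
  also have "\<dots> \<le> (\<integral>\<^sup>+\<rho>. ennreal (A * B) * ennreal ((cmod (f \<rho>))\<^sup>2) \<partial>M)"
  proof (rule nn_integral_mono)
    fix \<rho> assume \<rho>: "\<rho> \<in> space M"
    have [measurable]: "(\<lambda>x. K x \<rho>) \<in> borel_measurable borel"
      using measurable_Pair1[of "case_prod K" lborel M borel \<rho>] \<rho> by simp
    have "(\<integral>\<^sup>+x. ennreal (A * P x) * ennreal ((cmod (f \<rho>))\<^sup>2 * cmod (K x \<rho>) / p \<rho>) \<partial>lborel)
      = (\<integral>\<^sup>+x. ennreal (A * (cmod (f \<rho>))\<^sup>2 / p \<rho>) * ennreal (cmod (K x \<rho>) * P x) \<partial>lborel)"
      using A P p[of \<rho>] by (intro nn_integral_cong) (simp add: ennreal_mult[symmetric] mult_ac)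
    also have "\<dots> = ennreal (A * (cmod (f \<rho>))\<^sup>2 / p \<rho>) * (\<integral>\<^sup>+x. ennreal (cmod (K x \<rho>) * P x) \<partial>lborel)"
      by (rule nn_integral_cmult) simp
    also have "\<dots> \<le> ennreal (A * (cmod (f \<rho>))\<^sup>2 / p \<rho>) * ennreal (B * p \<rho>)"
      by (intro mult_left_mono h2) simp
    also have "\<dots> = ennreal (A * B) * ennreal ((cmod (f \<rho>))\<^sup>2)"
      using A B p[of \<rho>] by (simp add: ennreal_mult[symmetric] mult_ac)
    finally show "(\<integral>\<^sup>+x. ennreal (A * P x) * ennreal ((cmod (f \<rho>))\<^sup>2 * cmod (K x \<rho>) / p \<rho>) \<partial>lborel)
      \<le> ennreal (A * B) * ennreal ((cmod (f \<rho>))\<^sup>2)" .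
  qed
  also have "\<dots> = ennreal (A * B) * l2sq_on M f"
    by (rule nn_integral_cmult) simp
  finally show ?thesis .
qed

section \<open>Extension of a decaying exponential\<close>

text \<open>Integrating the derivative of \<open>y\<^sup>n exp(-z y)\<close> over the half-line gives the recursion
\<open>z J\<^sub>n = n J\<^sub>n\<^sub>-\<^sub>1\<close>, with \<open>z J\<^sub>0 = 1\<close>.\<close>

lemma integral_power_exp:
  fixes z :: complex
  assumes z: "Re z > 0"
  shows "integrable lborel (\<lambda>y. indicator {0<..} y *\<^sub>R (of_real y ^ n * exp (- (z * of_real y))))"
    and "(LINT y|lborel. indicator {0<..} y *\<^sub>R (of_real y ^ n * exp (- (z * of_real y)))) = fact n / z ^ (n + 1)"
proof -
  have ein: "einterval 0 \<infinity> = {0::real<..}" by (auto simp: einterval_def)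
  have int: "integrable lborel (\<lambda>y. indicator {0<..} y *\<^sub>R (of_real y ^ n * exp (- (z * of_real y))))" for n
  proof (rule Bochner_Integration.integrable_bound)
    have "integrable lborel (erlang_density n (Re z))"
    proof (rule integrableI_nonneg)
      show "(\<integral>\<^sup>+x. ennreal (erlang_density n (Re z) x) \<partial>lborel) < \<infinity>"
        using nn_integral_erlang_ith_moment[OF z, of n 0] by simp
    qed (use z in auto)
    then show "integrable lborel (\<lambda>y. fact n / Re z ^ Suc n * erlang_density n (Re z) y)" by simp
    show "AE y in lborel. norm (indicator {0<..} y *\<^sub>R (complex_of_real y ^ n * exp (- (z * of_real y)))) 
       \<le> norm (fact n / Re z ^ Suc n * erlang_density n (Re z) y)"
      using z by (auto simp: erlang_density_def norm_mult norm_power indicator_def)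
  qed measurable
  then show "integrable lborel (\<lambda>y. indicator {0<..} y *\<^sub>R (of_real y ^ n * exp (- (z * of_real y))))" .
  let ?J = "\<lambda>n. LINT y|lborel. indicator {0<..} y *\<^sub>R (of_real y ^ n * exp (- (z * of_real y)))"
  have rec: "of_nat n * ?J (n - 1) - z * ?J n = 0 - (if n = 0 then 1 else 0)" for n
  proof -
    let ?F = "\<lambda>y. complex_of_real y ^ n * exp (- (z * of_real y))"
    let ?f = "\<lambda>y. of_nat n * (of_real y ^ (n - 1) * exp (- (z * of_real y))) - z * (of_real y ^ n * exp (- (z * of_real y)))"
    have e: "indicator {0<..} y *\<^sub>R ?f y = of_nat n * (indicator {0<..} y *\<^sub>R (complex_of_real y ^ (n - 1) * exp (- (z * of_real y))))
        - z * (indicator {0<..} y *\<^sub>R (complex_of_real y ^ n * exp (- (z * of_real y))))" for y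
      by (simp add: indicator_def)
    have "(LBINT y=0..\<infinity>. ?f y) = 0 - (if n = 0 then 1 else 0)"
    proof (rule interval_integral_FTC_integrable)
      show "set_integrable lborel (einterval 0 \<infinity>) ?f"
        unfolding set_integrable_def ein e by (intro Bochner_Integration.integrable_diff integrable_mult_right int)
      show "(?F has_vector_derivative ?f y) (at y)" for y
      proof -
        have "((\<lambda>w. w ^ n * exp (- (z * w))) has_field_derivative ?f y) (at (of_real y))"
          by (auto intro!: derivative_eq_intros simp: algebra_simps)
        then show ?thesis by (rule has_vector_derivative_real_field)
      qed
      show "isCont ?f y" for y by (intro continuous_intros)
      have "isCont ?F 0" by (intro continuous_intros)
      then have "(?F \<longlongrightarrow> (if n = 0 then 1 else 0)) (at 0)"
        by (simp add: isCont_def power_0_left)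
      then have "(?F \<longlongrightarrow> (if n = 0 then 1 else 0)) (at_right 0)"
        by (rule tendsto_mono[OF at_le[OF subset_UNIV]])
      then show "((?F \<circ> real_of_ereal) \<longlongrightarrow> (if n = 0 then 1 else 0)) (at_right 0)"
        unfolding zero_ereal_def ereal_tendsto_simps .
      have "((\<lambda>y. (1 / Re z ^ n) * ((Re z * y) ^ n / exp (Re z * y))) \<longlongrightarrow> (1 / Re z ^ n) * 0) at_top"
        by (intro tendsto_mult_left filterlim_compose[OF tendsto_power_div_exp_0] 
             filterlim_tendsto_pos_mult_at_top[OF tendsto_const z filterlim_ident])
      moreover have "norm (?F y) = (1 / Re z ^ n) * ((Re z * y) ^ n / exp (Re z * y))" if "y > 0" for y
      proof -
        have "norm (?F y) = y ^ n * exp (- (Re z * y))" using that by (simp add: norm_mult norm_power)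
        also have "\<dots> = (1 / Re z ^ n) * ((Re z * y) ^ n / exp (Re z * y))"
          using z by (simp add: power_mult_distrib exp_minus field_simps)
        finally show ?thesis .
      qed
      ultimately have "((\<lambda>y. norm (?F y)) \<longlongrightarrow> 0) at_top"
        by (subst filterlim_cong[OF refl refl eventually_mono[OF eventually_gt_at_top[of 0]]]) auto
      then have "(?F \<longlongrightarrow> 0) at_top" by (rule tendsto_norm_zero_cancel)
      then show "((?F \<circ> real_of_ereal) \<longlongrightarrow> 0) (at_left \<infinity>)"
        unfolding ereal_tendsto_simps .
    qed simp
    moreover have "(LBINT y=0..\<infinity>. ?f y) = of_nat n * ?J (n - 1) - z * ?J n"
      unfolding interval_lebesgue_integral_def set_lebesgue_integral_def ein
      by (simp only: e Bochner_Integration.integral_diff integrable_mult_right int integral_mult_right_zero) simp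
    ultimately show ?thesis by (simp only:)
  qed
  have z0: "z \<noteq> 0" using z by auto
  show "?J n = fact n / z ^ (n + 1)"
  proof (induction n)
    case 0
    show ?case using rec[of 0] z0 by (simp add: field_simps)
  next
    case (Suc n)
    have "of_nat (Suc n) * ?J n - z * ?J (Suc n) = 0" using rec[of "Suc n"] by simp
    then have "?J (Suc n) = of_nat (Suc n) * ?J n / z" using z0 by (simp add: field_simps)
    also have "\<dots> = fact (Suc n) / z ^ (Suc n + 1)" unfolding Suc by (simp add: field_simps)
    finally show ?case .
  qed
qed

text \<open>An extension to the line of \<open>exp(ikx)\<close>, \<open>x > 0\<close>, for \<open>Im k > 0\<close>. The polynomial is the one for which all
derivatives of order less than \<open>N\<close> match at \<open>x = 0\<close>.\<close>

definition ext_kernel :: "nat \<Rightarrow> complex \<Rightarrow> real \<Rightarrow> complex" where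
  "ext_kernel N k x = (if x > 0 then exp (\<i> * k * of_real x)
     else exp (\<i> * cnj k * of_real x) * of_real (\<Sum>j<N. (2 * Im k * \<bar>x\<bar>) ^ j / fact j))"

text \<open>The Fourier transform of \<open>ext_kernel\<close>, in the form that shows the decay of order \<open>N + 1\<close>.\<close>

definition ext_symbol :: "nat \<Rightarrow> complex \<Rightarrow> real \<Rightarrow> complex" where
  "ext_symbol N k \<xi> = of_real ((2 * Im k) ^ N) /
     (Complex (Im k) (\<xi> - Re k) * cnj (Complex (Im k) (\<xi> - Re k)) ^ N)"

lemma ext_kernel_measurable [measurable]:
  "(\<lambda>(x, k). ext_kernel N k x) \<in> borel_measurable (borel \<Otimes>\<^sub>M borel)"
  unfolding ext_kernel_def split_beta by measurable

lemma ext_symbol_measurable [measurable]: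
  "(\<lambda>(\<xi>, k). ext_symbol N k \<xi>) \<in> borel_measurable (borel \<Otimes>\<^sub>M borel)"
proof -
  have "(\<lambda>(\<xi>, k). ext_symbol N k \<xi>) = (\<lambda>(\<xi>, k). of_real ((2 * Im k) ^ N) /
     ((of_real (Im k) + \<i> * of_real (\<xi> - Re k)) * (of_real (Im k) - \<i> * of_real (\<xi> - Re k)) ^ N))"
    unfolding ext_symbol_def by (auto simp: Complex_eq)
  also have "\<dots> \<in> borel_measurable (borel \<Otimes>\<^sub>M borel)" unfolding split_beta by measurable
  finally show ?thesis .
qed

lemma norm_ext_kernel:
  "cmod (ext_kernel N k x) = exp (- (Im k * \<bar>x\<bar>)) *
     (if x > 0 then 1 else \<bar>\<Sum>j<N. (2 * Im k * \<bar>x\<bar>) ^ j / fact j\<bar>)"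
proof (cases "x > 0")
  case False
  then have "cmod (exp (\<i> * cnj k * of_real x)) = exp (- (Im k * \<bar>x\<bar>))" by simp
  then show ?thesis by (simp only: ext_kernel_def False if_False norm_mult norm_of_real)
qed (simp add: ext_kernel_def)

text \<open>The modulus depends on \<open>k\<close> and \<open>x\<close> only through \<open>Im k * x\<close>.\<close>

lemma ext_kernel_scale:
  assumes "Im k > 0"
  shows "cmod (ext_kernel N k x) = cmod (ext_kernel N \<i> (Im k * x))"
  unfolding norm_ext_kernel using assms by (simp add: abs_mult zero_less_mult_iff mult_ac)

text \<open>The partial fraction decomposition of the symbol: the summand \<open>1 / z\<close> is the transform of the part
on \<open>x > 0\<close>, and the others come from the monomials on \<open>x < 0\<close>.\<close>

lemma geometric_partial_sums:
  fixes z u :: complex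
  assumes "z \<noteq> 0" "u \<noteq> 0"
  shows "1 / z + (\<Sum>j<N. (z + u) ^ j / u ^ (j + 1)) = (z + u) ^ N / (z * u ^ N)"
proof (induction N)
  case (Suc N)
  have "1 / z + (\<Sum>j<Suc N. (z + u) ^ j / u ^ (j + 1)) = (z + u) ^ N / (z * u ^ N) + (z + u) ^ N / u ^ (N + 1)"
    using Suc by simp
  also have "\<dots> = (z + u) ^ Suc N / (z * u ^ Suc N)"
    using assms by (simp add: field_simps)
  finally show ?case .
qed simp

lemma fourier_ext_kernel:
  assumes k: "Im k > 0"
  shows "integrable lborel (ext_kernel N k)" and "fhat (ext_kernel N k) \<xi> = ext_symbol N k \<xi>"
proof -
  let ?E = "\<lambda>z n y. indicator {0<..} y *\<^sub>R (complex_of_real y ^ n * exp (- (z * of_real y)))"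
  let ?c = "\<lambda>j. complex_of_real ((2 * Im k) ^ j / fact j)"
  have decomp: "AE x in lborel. exp (- (\<i> * of_real \<xi> * of_real x)) * ext_kernel N k x
     = ?E (Complex (Im k) (\<xi> - Re k)) 0 x + (\<Sum>j<N. ?c j * ?E (cnj (Complex (Im k) (\<xi> - Re k))) j (- x))" for \<xi>
  proof -
    have "AE x in lborel. x \<noteq> (0::real)" by (rule AE_lborel_singleton)
    then show ?thesis
    proof eventually_elim
      case (elim x)
      have e1: "exp (- (\<i> * of_real \<xi> * of_real x)) * exp (\<i> * k * of_real x) = exp (- (Complex (Im k) (\<xi> - Re k) * of_real x))"
        unfolding exp_add[symmetric]
        by (rule arg_cong[where f=exp]) (simp add: complex_eq_iff algebra_simps)
      have e2: "exp (- (\<i> * of_real \<xi> * of_real x)) * exp (\<i> * cnj k * of_real x) = exp (- (cnj (Complex (Im k) (\<xi> - Re k)) * of_real (- x)))"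
        unfolding exp_add[symmetric]
        by (rule arg_cong[where f=exp]) (simp add: complex_eq_iff algebra_simps)
      show ?case
      proof (cases "x > 0")
        case True
        then show ?thesis unfolding ext_kernel_def using e1 by simp
      next
        case False
        with elim have x: "x < 0" by simp
        have "exp (- (\<i> * of_real \<xi> * of_real x)) * ext_kernel N k x
          = exp (- (cnj (Complex (Im k) (\<xi> - Re k)) * of_real (- x))) * (\<Sum>j<N. of_real ((2 * Im k * \<bar>x\<bar>) ^ j / fact j))"
          unfolding ext_kernel_def e2[symmetric] of_real_sum using False by (simp only: if_False mult.assoc)
        also have "\<dots> = (\<Sum>j<N. ?c j * ?E (cnj (Complex (Im k) (\<xi> - Re k))) j (- x))"
          unfolding sum_distrib_left
        proof (rule sum.cong[OF refl])
          fix j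
          have ax: "\<bar>x\<bar> = - x" using x by simp
          have "complex_of_real ((2 * Im k * \<bar>x\<bar>) ^ j / fact j) = of_real ((2 * Im k) ^ j / fact j * (- x) ^ j)"
            by (rule arg_cong[where f=of_real])
               (simp only: ax power_mult_distrib[of "2 * Im k" "- x"] times_divide_eq_left)
          also have "\<dots> = ?c j * of_real (- x) ^ j" by (simp only: of_real_mult of_real_power)
          finally have "complex_of_real ((2 * Im k * \<bar>x\<bar>) ^ j / fact j) = ?c j * of_real (- x) ^ j" .
          then show "exp (- (cnj (Complex (Im k) (\<xi> - Re k)) * of_real (- x))) * of_real ((2 * Im k * \<bar>x\<bar>) ^ j / fact j)
            = ?c j * ?E (cnj (Complex (Im k) (\<xi> - Re k))) j (- x)"
            using x by (simp add: mult_ac del: of_real_minus of_real_divide of_real_power)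
        qed
        finally show ?thesis using x by simp
      qed
    qed
  qed
  have z: "Re (Complex (Im k) (\<xi> - Re k)) > 0" "Re (cnj (Complex (Im k) (\<xi> - Re k))) > 0" for \<xi>
    using k by simp_all
  have reflint: "integrable lborel (\<lambda>x. ?E w j (- x))" "(LINT x|lborel. ?E w j (- x)) = fact j / w ^ (j + 1)"
    if "Re w > 0" for w j
    using lborel_integrable_real_affine[OF integral_power_exp(1)[OF that, of j], of "-1" 0]
      lborel_integral_real_affine[of "-1" "?E w j" 0] integral_power_exp(2)[OF that, of j]
    by simp_all
  have int: "integrable lborel (\<lambda>x. ?E (Complex (Im k) (\<xi> - Re k)) 0 x + (\<Sum>j<N. ?c j * ?E (cnj (Complex (Im k) (\<xi> - Re k))) j (- x)))" for \<xi>
    by (intro Bochner_Integration.integrable_add Bochner_Integration.integrable_sum integrable_mult_right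
         integral_power_exp(1) reflint z)
  have meas: "ext_kernel N k \<in> borel_measurable borel"
    using measurable_Pair1[OF ext_kernel_measurable, of k N] by simp
  show "integrable lborel (ext_kernel N k)"
    using int[of 0] decomp[of 0] meas by (subst (asm) integrable_cong_AE[OF _ _ AE_symmetric[OF decomp[of 0]]]) auto
  have "fhat (ext_kernel N k) \<xi> = (LINT x|lborel. ?E (Complex (Im k) (\<xi> - Re k)) 0 x + (\<Sum>j<N. ?c j * ?E (cnj (Complex (Im k) (\<xi> - Re k))) j (- x)))"
    unfolding fourier_def using meas int[of \<xi>] by (intro integral_cong_AE decomp) auto
  also have "\<dots> = (LINT x|lborel. ?E (Complex (Im k) (\<xi> - Re k)) 0 x) + (\<Sum>j<N. ?c j * (LINT x|lborel. ?E (cnj (Complex (Im k) (\<xi> - Re k))) j (- x)))"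
  proof -
    have i1: "integrable lborel (?E (Complex (Im k) (\<xi> - Re k)) 0)"
      by (rule integral_power_exp(1)[OF z(1)])
    have i2: "integrable lborel (\<lambda>x. ?c j * ?E (cnj (Complex (Im k) (\<xi> - Re k))) j (- x))" for j
      by (rule integrable_mult_right[OF reflint(1)[OF z(2)]])
    show ?thesis
      unfolding Bochner_Integration.integral_add[OF i1 Bochner_Integration.integrable_sum[OF i2]]
        Bochner_Integration.integral_sum[OF i2] integral_mult_right_zero ..
  qed
  also have "\<dots> = 1 / Complex (Im k) (\<xi> - Re k) + (\<Sum>j<N. ?c j * (fact j / cnj (Complex (Im k) (\<xi> - Re k)) ^ (j + 1)))"
    unfolding integral_power_exp(2)[OF z(1)] reflint(2)[OF z(2)]
    by (simp only: fact_0 add_0 power_one_right)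
  also have "\<dots> = 1 / Complex (Im k) (\<xi> - Re k) + (\<Sum>j<N. (Complex (Im k) (\<xi> - Re k) + cnj (Complex (Im k) (\<xi> - Re k))) ^ j / cnj (Complex (Im k) (\<xi> - Re k)) ^ (j + 1))"
    by (simp add: complex_add_cnj)
  also have "\<dots> = ext_symbol N k \<xi>"
    using k by (subst geometric_partial_sums) (auto simp: ext_symbol_def complex_add_cnj complex_eq_iff)
  finally show "fhat (ext_kernel N k) \<xi> = ext_symbol N k \<xi>" .
qed

lemma power_le_fact_exp:
  fixes y :: real
  assumes "y \<ge> 0"
  shows "y ^ n / fact n \<le> exp y"
proof -
  have "(\<Sum>j<Suc n. y ^ j / fact j) \<le> exp y"
    using assms sum_le_suminf[OF summable_exp, of "{..<Suc n}" y]
    by (simp add: exp_def divide_inverse mult.commute scaleR_conv_of_real)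
  moreover have "y ^ n / fact n \<le> (\<Sum>j<Suc n. y ^ j / fact j)"
    using assms by (intro member_le_sum) auto
  ultimately show ?thesis by simp
qed

text \<open>Every \<open>y\<^sup>j / j!\<close> is at most \<open>exp y\<close>, also after multiplication by \<open>y\<close> and up to a factor \<open>j + 1\<close>.\<close>

lemma ext_kernel_bound:
  obtains C where "C \<ge> 0" "\<And>k x. Im k > 0 \<Longrightarrow> cmod (ext_kernel N k x) \<le> C / (1 + Im k * \<bar>x\<bar>)"
proof
  let ?C = "1 + (\<Sum>j<N. 2 ^ j * (real j + 2))"
  show C: "?C \<ge> 0" by (intro add_nonneg_nonneg sum_nonneg) simp_all
  fix k :: complex and x :: real assume k: "Im k > 0"
  define y where "y = Im k * \<bar>x\<bar>"
  have y: "y \<ge> 0" using k by (simp add: y_def)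
  have e: "exp (- y) * (1 + y) \<le> 1"
    using mult_left_mono[OF exp_ge_add_one_self, of "exp (- y)" y] by (simp add: exp_minus)
  have "(1 + y) * (2 * y) ^ j / fact j \<le> 2 ^ j * (real j + 2) * exp y" for j
  proof -
    have "y * (y ^ j / fact j) = (real j + 1) * (y ^ Suc j / fact (Suc j))"
    proof -
      have "fact (Suc j) = (real j + 1) * fact j" by simp
      then show ?thesis by (simp only: power_Suc) simp
    qed
    also have "\<dots> \<le> (real j + 1) * exp y"
      by (intro mult_left_mono power_le_fact_exp y) simp
    finally have "(1 + y) * (y ^ j / fact j) \<le> (real j + 2) * exp y"
      using power_le_fact_exp[OF y, of j] by (simp only: distrib_right mult_1)
    then have "2 ^ j * ((1 + y) * (y ^ j / fact j)) \<le> 2 ^ j * ((real j + 2) * exp y)"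
      by (rule mult_left_mono) simp
    then show ?thesis by (simp add: power_mult_distrib mult_ac)
  qed
  then have "(\<Sum>j<N. (1 + y) * (2 * y) ^ j / fact j) \<le> (\<Sum>j<N. 2 ^ j * (real j + 2) * exp y)"
    by (intro sum_mono)
  then have "(1 + y) * (\<Sum>j<N. (2 * y) ^ j / fact j) \<le> (\<Sum>j<N. 2 ^ j * (real j + 2)) * exp y"
    by (simp add: sum_distrib_left sum_distrib_right)
  then have "exp (- y) * ((1 + y) * (\<Sum>j<N. (2 * y) ^ j / fact j)) \<le> exp (- y) * ((\<Sum>j<N. 2 ^ j * (real j + 2)) * exp y)"
    by (rule mult_left_mono) simp
  also have "\<dots> = (\<Sum>j<N. 2 ^ j * (real j + 2))" by (simp add: exp_minus)
  finally have s: "exp (- y) * (1 + y) * (\<Sum>j<N. (2 * y) ^ j / fact j) \<le> (\<Sum>j<N. 2 ^ j * (real j + 2))"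
    by (simp add: mult.assoc)
  have spos: "(\<Sum>j<N. (2 * y) ^ j / fact j) \<ge> 0" "(\<Sum>j<N. 2 ^ j * (real j + 2)) \<ge> 0"
    using y by (auto intro!: sum_nonneg)
  have "cmod (ext_kernel N k x) * (1 + y) \<le> ?C"
  proof -
    have n: "cmod (ext_kernel N k x) = exp (- y) * (if x > 0 then 1 else \<bar>\<Sum>j<N. (2 * y) ^ j / fact j\<bar>)"
      unfolding norm_ext_kernel y_def by (simp only: mult.assoc)
    show ?thesis
    proof (cases "x > 0")
      case True
      then show ?thesis using n e spos by (simp add: mult.commute)
    next
      case False
      then have "cmod (ext_kernel N k x) * (1 + y) = exp (- y) * (1 + y) * (\<Sum>j<N. (2 * y) ^ j / fact j)"
        using n spos by (simp only: if_False abs_of_nonneg mult_ac)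
      with s have "cmod (ext_kernel N k x) * (1 + y) \<le> (\<Sum>j<N. 2 ^ j * (real j + 2))" by (simp only:)
      then show ?thesis by linarith
    qed
  qed
  then show "cmod (ext_kernel N k x) \<le> ?C / (1 + Im k * \<bar>x\<bar>)"
    unfolding y_def[symmetric] using y by (simp add: pos_le_divide_eq)
qed

lemma norm_ext_symbol:
  assumes "Im k > 0"
  shows "cmod (ext_symbol N k \<xi>) = (2 * Im k) ^ N / cmod (of_real \<xi> - k) ^ (N + 1)"
proof -
  have "cmod (Complex (Im k) (\<xi> - Re k)) = cmod (of_real \<xi> - k)"
    by (simp add: cmod_def power2_commute)
  then show ?thesis using assms unfolding ext_symbol_def
    by (simp add: norm_divide norm_mult norm_power complex_mod_cnj)
qed

text \<open>The inequality \<open>1 + \<xi>\<^sup>2 \<le> 4 (1 + \<bar>k\<bar>\<^sup>2) (\<bar>\<xi> - k\<bar> / Im k)\<^sup>2\<close> moves the weight from \<open>\<xi>\<close> to \<open>k\<close> at the price of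
\<open>s\<close> factors \<open>\<bar>\<xi> - k\<bar> / Im k \<ge> 1\<close>, and the symbol contains \<open>N \<ge> s\<close> of their reciprocals. In the cone
\<open>\<bar>\<xi> - k\<bar>\<close> is comparable to \<open>\<bar>\<xi> - c\<bar> + Im k\<close>, so Hilbert's kernel is left.\<close>

lemma ext_symbol_weighted_bound:
  assumes k: "Im k > 0" and a: "\<bar>Re k - c\<bar> \<le> A * Im k" "A \<ge> 0" and N: "s \<le> real N" "s \<ge> 0"
  shows "(1 + \<xi>\<^sup>2) powr (s/2) * cmod (ext_symbol N k \<xi>)
     \<le> (4 powr (s/2) * 2 ^ N * (2 + A)) * (1 + (cmod k)\<^sup>2) powr (s/2) / (\<bar>\<xi> - c\<bar> + Im k)"
proof -
  define m w where "m = Im k" and "w = cmod (of_real \<xi> - k)"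
  have m: "m > 0" using k by (simp add: m_def)
  have mw: "m \<le> w" using abs_Im_le_cmod[of "of_real \<xi> - k"] k by (simp add: m_def w_def)
  have w: "w > 0" using m mw by simp
  have ratio: "w / m \<ge> 1" using m mw by simp
  have "1 + \<xi>\<^sup>2 \<le> 4 * (1 + (cmod k)\<^sup>2) * (w / m)\<^sup>2"
  proof -
    have "\<bar>\<xi>\<bar> \<le> w + cmod k"
      using norm_triangle_ineq[of "of_real \<xi> - k" k] by (simp add: w_def)
    then have "\<xi>\<^sup>2 \<le> (w + cmod k)\<^sup>2" using abs_le_square_iff[of \<xi> "w + cmod k"] w by simp
    also have "\<dots> \<le> 2 * w\<^sup>2 + 2 * (cmod k)\<^sup>2"
      using sum_squares_bound[of w "cmod k"] by (simp add: power2_sum)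
    finally have "1 + \<xi>\<^sup>2 \<le> 2 * (1 + (cmod k)\<^sup>2) * 1 + 2 * m\<^sup>2 * (w / m)\<^sup>2"
      using m by (simp add: power_divide)
    also have "\<dots> \<le> 2 * (1 + (cmod k)\<^sup>2) * (w / m)\<^sup>2 + 2 * (1 + (cmod k)\<^sup>2) * (w / m)\<^sup>2"
    proof (intro add_mono mult_left_mono mult_right_mono)
      show "1 \<le> (w / m)\<^sup>2" using ratio by (rule one_le_power)
      have "m\<^sup>2 \<le> (cmod k)\<^sup>2"
        using abs_Im_le_cmod[of k] m by (intro power_mono) (auto simp: m_def)
      then show "m\<^sup>2 \<le> 1 + (cmod k)\<^sup>2" by simp
    qed simp_all
    finally show ?thesis by (simp add: algebra_simps)
  qed
  then have "(1 + \<xi>\<^sup>2) powr (s/2) \<le> (4 * (1 + (cmod k)\<^sup>2) * (w / m)\<^sup>2) powr (s/2)"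
    using N(2) by (intro powr_mono2) (auto simp: add_nonneg_nonneg)
  also have "\<dots> = 4 powr (s/2) * (1 + (cmod k)\<^sup>2) powr (s/2) * (w / m) powr s"
  proof -
    have "((w / m)\<^sup>2) powr (s/2) = (w / m) powr s"
    proof -
      have "(w / m)\<^sup>2 = (w / m) powr 2" using m w by simp
      then show ?thesis by (simp only: powr_powr) simp
    qed
    then show ?thesis by (simp only: powr_mult)
  qed
  also have "\<dots> \<le> 4 powr (s/2) * (1 + (cmod k)\<^sup>2) powr (s/2) * (w / m) ^ N"
  proof (rule mult_left_mono)
    have "(w / m) powr s \<le> (w / m) powr real N" using ratio N by (intro powr_mono) simp_all
    also have "\<dots> = (w / m) ^ N" using m w by (intro powr_realpow) simp
    finally show "(w / m) powr s \<le> (w / m) ^ N" .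
  qed simp
  finally have 1: "(1 + \<xi>\<^sup>2) powr (s/2) \<le> 4 powr (s/2) * (1 + (cmod k)\<^sup>2) powr (s/2) * (w / m) ^ N" .
  have sym: "cmod (ext_symbol N k \<xi>) = (2 * m) ^ N / (w ^ N * w)"
    unfolding norm_ext_symbol[OF k] m_def w_def by (simp add: mult.commute)
  have "(1 + \<xi>\<^sup>2) powr (s/2) * cmod (ext_symbol N k \<xi>)
    \<le> 4 powr (s/2) * (1 + (cmod k)\<^sup>2) powr (s/2) * (w / m) ^ N * ((2 * m) ^ N / (w ^ N * w))"
    unfolding sym by (intro mult_right_mono 1) (use m w in simp)
  also have "\<dots> = (4 powr (s/2) * 2 ^ N) * (1 + (cmod k)\<^sup>2) powr (s/2) * (1 / w)"
    using m w by (simp add: power_divide power_mult_distrib)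
  also have "\<dots> \<le> (4 powr (s/2) * 2 ^ N) * (1 + (cmod k)\<^sup>2) powr (s/2) * ((2 + A) / (\<bar>\<xi> - c\<bar> + Im k))"
  proof (rule mult_left_mono)
    have "\<bar>\<xi> - c\<bar> \<le> \<bar>\<xi> - Re k\<bar> + \<bar>Re k - c\<bar>" by simp
    also have "\<bar>\<xi> - Re k\<bar> \<le> w" using abs_Re_le_cmod[of "of_real \<xi> - k"] by (simp add: w_def)
    also have "\<bar>Re k - c\<bar> \<le> A * w" using a mw mult_left_mono[OF mw a(2)] by (simp add: m_def)
    finally have "\<bar>\<xi> - c\<bar> + m \<le> (2 + A) * w" using mw by (simp add: algebra_simps)
    moreover have "\<bar>\<xi> - c\<bar> + m > 0" using m by simp
    ultimately show "1 / w \<le> (2 + A) / (\<bar>\<xi> - c\<bar> + Im k)"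
      using w by (simp add: field_simps m_def)
  qed simp
  finally show ?thesis by (simp add: mult_ac)
qed

section \<open>Superpositions of decaying exponentials\<close>

text \<open>A square integrable function is finite almost everywhere, so a finite \<open>X\<close> makes the integral over \<open>M\<close>
absolutely convergent for almost every \<open>x\<close>.\<close>

lemma integral_operator_L2:
  fixes K :: "real \<Rightarrow> 'a \<Rightarrow> complex" and f :: "'a \<Rightarrow> complex"
  assumes M: "sigma_finite_measure M"
    and [measurable]: "case_prod K \<in> borel_measurable (lborel \<Otimes>\<^sub>M M)" "f \<in> borel_measurable M"
    and bound: "kernel_energy M f K \<le> X"
  shows "(\<lambda>x. LINT \<rho>|M. f \<rho> * K x \<rho>) \<in> borel_measurable borel"
    and "l2sq (\<lambda>x. LINT \<rho>|M. f \<rho> * K x \<rho>) \<le> X"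
    and "X < \<infinity> \<Longrightarrow> AE x in lborel. integrable M (\<lambda>\<rho>. f \<rho> * K x \<rho>)"
proof -
  interpret sigma_finite_measure M by (rule M)
  have "(\<lambda>x. LINT \<rho>|M. f \<rho> * K x \<rho>) \<in> borel_measurable lborel" by measurable
  then show "(\<lambda>x. LINT \<rho>|M. f \<rho> * K x \<rho>) \<in> borel_measurable borel" by simp
  have Kx[measurable]: "K x \<in> borel_measurable M" for x
    using measurable_Pair2[of "case_prod K" lborel M borel x] by simp
  have le: "ennreal (cmod (LINT \<rho>|M. f \<rho> * K x \<rho>)) \<le> (\<integral>\<^sup>+\<rho>. ennreal (cmod (f \<rho> * K x \<rho>)) \<partial>M)" for x
    by (cases "integrable M (\<lambda>\<rho>. f \<rho> * K x \<rho>)",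
        rule integral_norm_bound_ennreal, assumption, simp add: not_integrable_integral_eq)
  have "l2sq (\<lambda>x. LINT \<rho>|M. f \<rho> * K x \<rho>) \<le> kernel_energy M f K"
    unfolding l2sq_def
  proof (rule nn_integral_mono)
    fix x
    show "ennreal ((cmod (LINT \<rho>|M. f \<rho> * K x \<rho>))\<^sup>2) \<le> (\<integral>\<^sup>+\<rho>. ennreal (cmod (f \<rho> * K x \<rho>)) \<partial>M)\<^sup>2"
      using power_mono[OF le[of x], of 2] by (simp add: ennreal_power)
  qed
  with bound show "l2sq (\<lambda>x. LINT \<rho>|M. f \<rho> * K x \<rho>) \<le> X" by (rule order_trans[rotated])
  assume "X < \<infinity>"
  then have fin: "kernel_energy M f K \<noteq> \<infinity>"
    using bound by (auto simp: top_unique)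
  have "AE x in lborel. (\<integral>\<^sup>+\<rho>. ennreal (cmod (f \<rho> * K x \<rho>)) \<partial>M)\<^sup>2 \<noteq> \<infinity>"
    by (rule nn_integral_PInf_AE[OF _ fin]) measurable
  then show "AE x in lborel. integrable M (\<lambda>\<rho>. f \<rho> * K x \<rho>)"
  proof eventually_elim
    case (elim x)
    then have "(\<integral>\<^sup>+\<rho>. ennreal (cmod (f \<rho> * K x \<rho>)) \<partial>M) < \<infinity>"
      by (auto simp: power_eq_top_ennreal less_top[symmetric])
    then show ?case by (intro integrableI_bounded) simp_all
  qed
qed

text \<open>A family of frequencies in the upper half-plane, indexed by a measure space \<open>M\<close>, that stays in a cone
with vertex \<open>c\<close> on the real axis. The assumption \<open>hilbert\<close> is one half of Schur's test for Hilbert's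
kernel with weight \<open>(Im k)\<^sup>-\<^sup>1\<^sup>/\<^sup>2\<close>; it controls the density of the family, and arc length on the curves
considered below satisfies it.\<close>

locale upper_curve = sigma_finite_measure M for M :: "'a measure" +
  fixes k :: "'a \<Rightarrow> complex" and c A B :: real
  assumes k_measurable [measurable]: "k \<in> borel_measurable M"
    and Im_pos: "\<And>\<rho>. Im (k \<rho>) > 0"
    and cone: "\<And>\<rho>. \<bar>Re (k \<rho>) - c\<bar> \<le> A * Im (k \<rho>)" "A \<ge> 0"
    and hilbert: "\<And>b. b > 0 \<Longrightarrow>
      (\<integral>\<^sup>+\<rho>. ennreal (1 / (sqrt (Im (k \<rho>)) * (Im (k \<rho>) + b))) \<partial>M) \<le> ennreal (B / sqrt b)" "B \<ge> 0"
begin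

text \<open>The test functions are \<open>(Im k)\<^sup>-\<^sup>1\<^sup>/\<^sup>2\<close> and \<open>\<bar>x - c\<bar>\<^sup>-\<^sup>1\<^sup>/\<^sup>2\<close>; the two conditions of Schur's test are the
assumption \<open>hilbert\<close> and \<open>hilbert_kernel\<close>.\<close>

lemma schur_translation:
  fixes K :: "real \<Rightarrow> 'a \<Rightarrow> complex"
  assumes [measurable]: "case_prod K \<in> borel_measurable (lborel \<Otimes>\<^sub>M M)" "f \<in> borel_measurable M"
    and K: "\<And>x \<rho>. cmod (K x \<rho>) \<le> D / (\<bar>x - c\<bar> + Im (k \<rho>))" and D: "D \<ge> 0"
  shows "kernel_energy M f K
    \<le> ennreal (D * B * (D * (2 * pi))) * l2sq_on M f"
proof (rule schur_test[where p="\<lambda>\<rho>. 1 / sqrt (Im (k \<rho>))" and P="\<lambda>x. 1 / sqrt \<bar>x - c\<bar>"])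
  have "AE x in lborel. x \<noteq> c" by (rule AE_lborel_singleton)
  then show "AE x in lborel. (\<integral>\<^sup>+\<rho>. ennreal (cmod (K x \<rho>) * (1 / sqrt (Im (k \<rho>)))) \<partial>M) \<le> ennreal (D * B * (1 / sqrt \<bar>x - c\<bar>))"
  proof eventually_elim
    case (elim x)
    have "(\<integral>\<^sup>+\<rho>. ennreal (cmod (K x \<rho>) * (1 / sqrt (Im (k \<rho>)))) \<partial>M)
      \<le> (\<integral>\<^sup>+\<rho>. ennreal D * ennreal (1 / (sqrt (Im (k \<rho>)) * (Im (k \<rho>) + \<bar>x - c\<bar>))) \<partial>M)"
    proof (rule nn_integral_mono)
      fix \<rho>
      have "cmod (K x \<rho>) * (1 / sqrt (Im (k \<rho>))) \<le> D / (\<bar>x - c\<bar> + Im (k \<rho>)) * (1 / sqrt (Im (k \<rho>)))"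
        using Im_pos[of \<rho>] by (intro mult_right_mono K) simp
      also have "\<dots> = D * (1 / (sqrt (Im (k \<rho>)) * (Im (k \<rho>) + \<bar>x - c\<bar>)))"
        by (simp add: mult.commute add.commute)
      finally show "ennreal (cmod (K x \<rho>) * (1 / sqrt (Im (k \<rho>))))
         \<le> ennreal D * ennreal (1 / (sqrt (Im (k \<rho>)) * (Im (k \<rho>) + \<bar>x - c\<bar>)))"
        using D by (simp add: ennreal_mult'[symmetric] ennreal_leI)
    qed
    also have "\<dots> = ennreal D * (\<integral>\<^sup>+\<rho>. ennreal (1 / (sqrt (Im (k \<rho>)) * (Im (k \<rho>) + \<bar>x - c\<bar>))) \<partial>M)"
      by (rule nn_integral_cmult) measurable
    also have "\<dots> \<le> ennreal D * ennreal (B / sqrt \<bar>x - c\<bar>)"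
      using elim by (intro mult_left_mono hilbert) simp_all
    also have "\<dots> = ennreal (D * B * (1 / sqrt \<bar>x - c\<bar>))"
      using D hilbert(2) by (simp add: ennreal_mult'[symmetric])
    finally show ?case .
  qed
  show "(\<integral>\<^sup>+x. ennreal (cmod (K x \<rho>) * (1 / sqrt \<bar>x - c\<bar>)) \<partial>lborel) \<le> ennreal (D * (2 * pi) * (1 / sqrt (Im (k \<rho>))))" for \<rho>
  proof -
    have "(\<integral>\<^sup>+x. ennreal (cmod (K x \<rho>) * (1 / sqrt \<bar>x - c\<bar>)) \<partial>lborel)
      \<le> (\<integral>\<^sup>+x. ennreal D * ennreal (1 / (sqrt \<bar>x - c\<bar> * (\<bar>x - c\<bar> + Im (k \<rho>)))) \<partial>lborel)"
    proof (rule nn_integral_mono)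
      fix x
      have "cmod (K x \<rho>) * (1 / sqrt \<bar>x - c\<bar>) \<le> D / (\<bar>x - c\<bar> + Im (k \<rho>)) * (1 / sqrt \<bar>x - c\<bar>)"
        by (intro mult_right_mono K) simp
      also have "\<dots> = D * (1 / (sqrt \<bar>x - c\<bar> * (\<bar>x - c\<bar> + Im (k \<rho>))))" by (simp add: mult.commute)
      finally show "ennreal (cmod (K x \<rho>) * (1 / sqrt \<bar>x - c\<bar>))
         \<le> ennreal D * ennreal (1 / (sqrt \<bar>x - c\<bar> * (\<bar>x - c\<bar> + Im (k \<rho>))))"
        using D by (simp add: ennreal_mult'[symmetric] ennreal_leI)
    qed
    also have "\<dots> = ennreal D * (\<integral>\<^sup>+x. ennreal (1 / (sqrt \<bar>x - c\<bar> * (\<bar>x - c\<bar> + Im (k \<rho>)))) \<partial>lborel)"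
      by (rule nn_integral_cmult) measurable
    also have "\<dots> = ennreal (D * (2 * pi) * (1 / sqrt (Im (k \<rho>))))"
      unfolding hilbert_kernel[OF Im_pos] using D Im_pos[of \<rho>] by (simp add: ennreal_mult'[symmetric])
    finally show ?thesis .
  qed
qed (use assms Im_pos hilbert(2) D in \<open>auto intro: sigma_finite_measure_axioms\<close>)

text \<open>Since \<open>1 / (1 + m \<bar>x\<bar>) = \<bar>x\<bar>\<^sup>-\<^sup>1 / (m + \<bar>x\<bar>\<^sup>-\<^sup>1)\<close>, this is again Hilbert's kernel, in the variables
\<open>m\<close> and \<open>1 / \<bar>x\<bar>\<close>.\<close>

lemma schur_dilation:
  fixes K :: "real \<Rightarrow> 'a \<Rightarrow> complex"
  assumes [measurable]: "case_prod K \<in> borel_measurable (lborel \<Otimes>\<^sub>M M)" "f \<in> borel_measurable M"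
    and K: "\<And>x \<rho>. cmod (K x \<rho>) \<le> D / (1 + Im (k \<rho>) * \<bar>x\<bar>)" and D: "D \<ge> 0"
  shows "kernel_energy M f K
    \<le> ennreal (D * B * (D * (2 * pi))) * l2sq_on M f"
proof (rule schur_test[where p="\<lambda>\<rho>. 1 / sqrt (Im (k \<rho>))" and P="\<lambda>x. 1 / sqrt \<bar>x\<bar>"])
  have "AE x in lborel. x \<noteq> (0::real)" by (rule AE_lborel_singleton)
  then show "AE x in lborel. (\<integral>\<^sup>+\<rho>. ennreal (cmod (K x \<rho>) * (1 / sqrt (Im (k \<rho>)))) \<partial>M) \<le> ennreal (D * B * (1 / sqrt \<bar>x\<bar>))"
  proof eventually_elim
    case (elim x)
    have "(\<integral>\<^sup>+\<rho>. ennreal (cmod (K x \<rho>) * (1 / sqrt (Im (k \<rho>)))) \<partial>M)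
      \<le> (\<integral>\<^sup>+\<rho>. ennreal (D / \<bar>x\<bar>) * ennreal (1 / (sqrt (Im (k \<rho>)) * (Im (k \<rho>) + 1 / \<bar>x\<bar>))) \<partial>M)"
    proof (rule nn_integral_mono)
      fix \<rho>
      have "cmod (K x \<rho>) * (1 / sqrt (Im (k \<rho>))) \<le> D / (1 + Im (k \<rho>) * \<bar>x\<bar>) * (1 / sqrt (Im (k \<rho>)))"
        using Im_pos[of \<rho>] by (intro mult_right_mono K) simp
      also have "1 + Im (k \<rho>) * \<bar>x\<bar> = \<bar>x\<bar> * (Im (k \<rho>) + 1 / \<bar>x\<bar>)"
        using elim by (simp add: field_simps)
      also have "D / (\<bar>x\<bar> * (Im (k \<rho>) + 1 / \<bar>x\<bar>)) * (1 / sqrt (Im (k \<rho>))) = D / \<bar>x\<bar> * (1 / (sqrt (Im (k \<rho>)) * (Im (k \<rho>) + 1 / \<bar>x\<bar>)))"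
        by (simp only: times_divide_times_eq mult_1_right mult_1_left mult_ac)
      finally show "ennreal (cmod (K x \<rho>) * (1 / sqrt (Im (k \<rho>))))
         \<le> ennreal (D / \<bar>x\<bar>) * ennreal (1 / (sqrt (Im (k \<rho>)) * (Im (k \<rho>) + 1 / \<bar>x\<bar>)))"
        using D by (subst ennreal_mult'[symmetric]) (simp_all only: ennreal_leI divide_nonneg_nonneg abs_ge_zero)
    qed
    also have "\<dots> = ennreal (D / \<bar>x\<bar>) * (\<integral>\<^sup>+\<rho>. ennreal (1 / (sqrt (Im (k \<rho>)) * (Im (k \<rho>) + 1 / \<bar>x\<bar>))) \<partial>M)"
      by (rule nn_integral_cmult) measurable
    also have "\<dots> \<le> ennreal (D / \<bar>x\<bar>) * ennreal (B / sqrt (1 / \<bar>x\<bar>))"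
      using elim by (intro mult_left_mono hilbert) simp_all
    also have "\<dots> = ennreal (D / \<bar>x\<bar> * (B / sqrt (1 / \<bar>x\<bar>)))"
      using D by (intro ennreal_mult'[symmetric]) simp
    also have "D / \<bar>x\<bar> * (B / sqrt (1 / \<bar>x\<bar>)) = D * B * (1 / sqrt \<bar>x\<bar>)"
    proof -
      define t where "t = sqrt \<bar>x\<bar>"
      have t: "t > 0" "\<bar>x\<bar> = t * t" using elim by (simp_all add: t_def)
      have "sqrt (1 / \<bar>x\<bar>) = 1 / t" by (simp add: real_sqrt_divide t_def)
      then show ?thesis unfolding t_def[symmetric] using t by (simp add: field_simps)
    qed
    finally show ?case .
  qed
  show "(\<integral>\<^sup>+x. ennreal (cmod (K x \<rho>) * (1 / sqrt \<bar>x\<bar>)) \<partial>lborel) \<le> ennreal (D * (2 * pi) * (1 / sqrt (Im (k \<rho>))))" for \<rho>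
  proof -
    let ?m = "Im (k \<rho>)"
    have "(\<integral>\<^sup>+x. ennreal (cmod (K x \<rho>) * (1 / sqrt \<bar>x\<bar>)) \<partial>lborel)
      \<le> (\<integral>\<^sup>+x. ennreal (D / ?m) * ennreal (1 / (sqrt \<bar>x - 0\<bar> * (\<bar>x - 0\<bar> + 1 / ?m))) \<partial>lborel)"
    proof (rule nn_integral_mono)
      fix x
      have "cmod (K x \<rho>) * (1 / sqrt \<bar>x\<bar>) \<le> D / (1 + ?m * \<bar>x\<bar>) * (1 / sqrt \<bar>x\<bar>)"
        by (intro mult_right_mono K) simp
      also have "1 + ?m * \<bar>x\<bar> = ?m * (\<bar>x\<bar> + 1 / ?m)" using Im_pos[of \<rho>] by (simp add: field_simps)
      also have "D / (?m * (\<bar>x\<bar> + 1 / ?m)) * (1 / sqrt \<bar>x\<bar>) = D / ?m * (1 / (sqrt \<bar>x\<bar> * (\<bar>x\<bar> + 1 / ?m)))"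
        by (simp only: times_divide_times_eq mult_1_right mult_1_left mult_ac)
      finally show "ennreal (cmod (K x \<rho>) * (1 / sqrt \<bar>x\<bar>))
         \<le> ennreal (D / ?m) * ennreal (1 / (sqrt \<bar>x - 0\<bar> * (\<bar>x - 0\<bar> + 1 / ?m)))"
        using D Im_pos[of \<rho>] by (subst ennreal_mult'[symmetric]) (simp_all only: ennreal_leI divide_nonneg_pos diff_0_right)
    qed
    also have "\<dots> = ennreal (D / ?m) * (\<integral>\<^sup>+x. ennreal (1 / (sqrt \<bar>x - 0\<bar> * (\<bar>x - 0\<bar> + 1 / ?m))) \<partial>lborel)"
      by (rule nn_integral_cmult) measurable
    also have "(\<integral>\<^sup>+x. ennreal (1 / (sqrt \<bar>x - 0\<bar> * (\<bar>x - 0\<bar> + 1 / ?m))) \<partial>lborel) = ennreal (2 * pi / sqrt (1 / ?m))"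
      by (rule hilbert_kernel) (use Im_pos[of \<rho>] in simp)
    also have "ennreal (D / ?m) * ennreal (2 * pi / sqrt (1 / ?m)) = ennreal (D / ?m * (2 * pi / sqrt (1 / ?m)))"
      using D Im_pos[of \<rho>] by (intro ennreal_mult'[symmetric]) simp
    also have "D / ?m * (2 * pi / sqrt (1 / ?m)) = D * (2 * pi) * (1 / sqrt ?m)"
    proof -
      define t where "t = sqrt ?m"
      have t: "t > 0" "?m = t * t" using Im_pos[of \<rho>] by (simp_all add: t_def)
      have "sqrt (1 / ?m) = 1 / t" by (simp add: real_sqrt_divide t_def)
      then show ?thesis unfolding t_def[symmetric] using t by (simp add: field_simps)
    qed
    finally show ?thesis .
  qed
qed (use assms Im_pos hilbert(2) D in \<open>auto intro: sigma_finite_measure_axioms\<close>)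

lemma ext_kernel_measurable_curve [measurable]:
  "(\<lambda>(x, \<rho>). ext_kernel N (k \<rho>) x) \<in> borel_measurable (lborel \<Otimes>\<^sub>M M)"
  using measurable_compose[of "\<lambda>(x, \<rho>). (x, k \<rho>)" "lborel \<Otimes>\<^sub>M M" "borel \<Otimes>\<^sub>M borel", OF _ ext_kernel_measurable[of N]]
  by (simp add: split_beta')

lemma ext_symbol_measurable_curve [measurable]:
  "(\<lambda>(x, \<rho>). ext_symbol N (k \<rho>) x) \<in> borel_measurable (lborel \<Otimes>\<^sub>M M)"
  using measurable_compose[of "\<lambda>(x, \<rho>). (x, k \<rho>)" "lborel \<Otimes>\<^sub>M M" "borel \<Otimes>\<^sub>M borel", OF _ ext_symbol_measurable[of N]]
  by (simp add: split_beta')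

text \<open>By scaling, the \<open>L\<^sup>1\<close> norm of \<open>ext_kernel N k\<close> is a multiple of \<open>1 / Im k\<close>, so the integrability
assumption is the one under which Fubini's theorem applies.\<close>

lemma fourier_superposition:
  assumes [measurable]: "g \<in> borel_measurable M"
    and fin: "(\<integral>\<^sup>+\<rho>. ennreal (cmod (g \<rho>) / Im (k \<rho>)) \<partial>M) < \<infinity>"
  shows "integrable lborel (\<lambda>x. LINT \<rho>|M. g \<rho> * ext_kernel N (k \<rho>) x)"
    and "fhat (\<lambda>x. LINT \<rho>|M. g \<rho> * ext_kernel N (k \<rho>) x) \<xi> = (LINT \<rho>|M. g \<rho> * ext_symbol N (k \<rho>) \<xi>)"
proof -
  interpret P: pair_sigma_finite lborel M by unfold_locales
  define L where "L = (\<integral>\<^sup>+x. ennreal (cmod (ext_kernel N \<i> x)) \<partial>lborel)"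
  have [measurable]: "ext_kernel N w \<in> borel_measurable borel" for w
    using measurable_Pair1[OF ext_kernel_measurable, of w N] by simp
  have L: "L < \<infinity>"
    using fourier_ext_kernel(1)[of \<i> N] unfolding L_def by (simp add: integrable_iff_bounded)
  have nrm: "(\<integral>\<^sup>+x. ennreal (cmod (ext_kernel N (k \<rho>) x)) \<partial>lborel) = ennreal (1 / Im (k \<rho>)) * L" for \<rho>
  proof -
    have "L = ennreal \<bar>Im (k \<rho>)\<bar> * (\<integral>\<^sup>+x. ennreal (cmod (ext_kernel N \<i> (0 + Im (k \<rho>) * x))) \<partial>lborel)"
      unfolding L_def using Im_pos[of \<rho>] by (intro nn_integral_real_affine) auto
    also have "(\<integral>\<^sup>+x. ennreal (cmod (ext_kernel N \<i> (0 + Im (k \<rho>) * x))) \<partial>lborel) = (\<integral>\<^sup>+x. ennreal (cmod (ext_kernel N (k \<rho>) x)) \<partial>lborel)"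
      by (simp add: ext_kernel_scale[OF Im_pos, of N])
    finally have "ennreal (1 / Im (k \<rho>)) * L = (ennreal (1 / Im (k \<rho>)) * ennreal \<bar>Im (k \<rho>)\<bar>) * (\<integral>\<^sup>+x. ennreal (cmod (ext_kernel N (k \<rho>) x)) \<partial>lborel)"
      by (simp only: mult.assoc)
    also have "ennreal (1 / Im (k \<rho>)) * ennreal \<bar>Im (k \<rho>)\<bar> = 1"
      using Im_pos[of \<rho>] by (subst ennreal_mult'[symmetric]) simp_all
    finally show ?thesis by simp
  qed
  have int: "integrable (lborel \<Otimes>\<^sub>M M) (\<lambda>(x, \<rho>). g \<rho> * ext_kernel N (k \<rho>) x)"
  proof (rule integrableI_bounded)
    show "(\<lambda>(x, \<rho>). g \<rho> * ext_kernel N (k \<rho>) x) \<in> borel_measurable (lborel \<Otimes>\<^sub>M M)" by measurable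
    have "(\<integral>\<^sup>+z. ennreal (norm (case z of (x, \<rho>) \<Rightarrow> g \<rho> * ext_kernel N (k \<rho>) x)) \<partial>(lborel \<Otimes>\<^sub>M M))
      = (\<integral>\<^sup>+\<rho>. \<integral>\<^sup>+x. ennreal (cmod (g \<rho> * ext_kernel N (k \<rho>) x)) \<partial>lborel \<partial>M)"
      by (subst P.nn_integral_snd[symmetric]) simp_all
    also have "\<dots> = (\<integral>\<^sup>+\<rho>. ennreal (cmod (g \<rho>) / Im (k \<rho>)) * L \<partial>M)"
    proof (rule nn_integral_cong)
      fix \<rho>
      have "(\<integral>\<^sup>+x. ennreal (cmod (g \<rho> * ext_kernel N (k \<rho>) x)) \<partial>lborel)
         = ennreal (cmod (g \<rho>)) * (\<integral>\<^sup>+x. ennreal (cmod (ext_kernel N (k \<rho>) x)) \<partial>lborel)"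
        by (subst nn_integral_cmult[symmetric]) (simp_all add: norm_mult ennreal_mult)
      also have "\<dots> = (ennreal (cmod (g \<rho>)) * ennreal (1 / Im (k \<rho>))) * L"
        unfolding nrm by (simp only: mult.assoc)
      also have "ennreal (cmod (g \<rho>)) * ennreal (1 / Im (k \<rho>)) = ennreal (cmod (g \<rho>) / Im (k \<rho>))"
        using Im_pos[of \<rho>] by (subst ennreal_mult'[symmetric]) simp_all
      finally show "(\<integral>\<^sup>+x. ennreal (cmod (g \<rho> * ext_kernel N (k \<rho>) x)) \<partial>lborel) = ennreal (cmod (g \<rho>) / Im (k \<rho>)) * L" .
    qed
    also have "\<dots> = (\<integral>\<^sup>+\<rho>. ennreal (cmod (g \<rho>) / Im (k \<rho>)) \<partial>M) * L"
      by (rule nn_integral_multc) measurable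
    also have "\<dots> < \<infinity>" using fin L by (simp add: ennreal_mult_less_top)
    finally show "(\<integral>\<^sup>+z. ennreal (norm (case z of (x, \<rho>) \<Rightarrow> g \<rho> * ext_kernel N (k \<rho>) x)) \<partial>(lborel \<Otimes>\<^sub>M M)) < \<infinity>" .
  qed
  show "integrable lborel (\<lambda>x. LINT \<rho>|M. g \<rho> * ext_kernel N (k \<rho>) x)"
    by (rule P.integrable_fst[OF int])
  have int': "integrable (lborel \<Otimes>\<^sub>M M) (\<lambda>(x, \<rho>). exp (- (\<i> * of_real \<xi> * of_real x)) * (g \<rho> * ext_kernel N (k \<rho>) x))"
    by (rule Bochner_Integration.integrable_bound[OF int]) (auto simp: norm_mult)
  have "fhat (\<lambda>x. LINT \<rho>|M. g \<rho> * ext_kernel N (k \<rho>) x) \<xi>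
    = (LINT x|lborel. LINT \<rho>|M. exp (- (\<i> * of_real \<xi> * of_real x)) * (g \<rho> * ext_kernel N (k \<rho>) x))"
    unfolding fourier_def integral_mult_right_zero ..
  also have "\<dots> = (LINT \<rho>|M. LINT x|lborel. exp (- (\<i> * of_real \<xi> * of_real x)) * (g \<rho> * ext_kernel N (k \<rho>) x))"
    by (rule P.Fubini_integral[OF int', symmetric])
  also have "\<dots> = (LINT \<rho>|M. g \<rho> * ext_symbol N (k \<rho>) \<xi>)"
  proof (rule Bochner_Integration.integral_cong[OF refl])
    fix \<rho>
    have "(LINT x|lborel. exp (- (\<i> * of_real \<xi> * of_real x)) * (g \<rho> * ext_kernel N (k \<rho>) x)) = fhat (\<lambda>x. g \<rho> * ext_kernel N (k \<rho>) x) \<xi>"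
      unfolding fourier_def ..
    then show "(LINT x|lborel. exp (- (\<i> * of_real \<xi> * of_real x)) * (g \<rho> * ext_kernel N (k \<rho>) x)) = g \<rho> * ext_symbol N (k \<rho>) \<xi>"
      by (simp only: fhat_cmult fourier_ext_kernel(2)[OF Im_pos])
  qed
  finally show "fhat (\<lambda>x. LINT \<rho>|M. g \<rho> * ext_kernel N (k \<rho>) x) \<xi> = (LINT \<rho>|M. g \<rho> * ext_symbol N (k \<rho>) \<xi>)" .
qed


text \<open>Away from the vertex \<open>1 / (Im k)\<^sup>2\<close> is dominated by the weighted Hilbert kernel at \<open>b = 1\<close>, so the assumption
\<open>hilbert\<close> bounds its integral.\<close>

lemma cutoff_summable:
  assumes [measurable]: "f \<in> borel_measurable M" and f: "l2sq_on M f < \<infinity>"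
    and e: "e > 0"
  shows "(\<integral>\<^sup>+\<rho>. ennreal (cmod (if Im (k \<rho>) \<ge> e then f \<rho> else 0) / Im (k \<rho>)) \<partial>M) < \<infinity>"
proof -
  define u where "u = sqrt e"
  have u: "u > 0" using e by (simp add: u_def)
  let ?L = "1 / u + 1 / u ^ 3"
  have "(\<integral>\<^sup>+\<rho>. ennreal (cmod (if Im (k \<rho>) \<ge> e then f \<rho> else 0) / Im (k \<rho>)) \<partial>M)
    \<le> (\<integral>\<^sup>+\<rho>. ennreal ((cmod (f \<rho>))\<^sup>2) + ennreal ?L * ennreal (1 / (sqrt (Im (k \<rho>)) * (Im (k \<rho>) + 1))) \<partial>M)"
  proof (rule nn_integral_mono)
    fix \<rho>
    define t where "t = sqrt (Im (k \<rho>))"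
    have t: "t > 0" "Im (k \<rho>) = t * t" using Im_pos[of \<rho>] by (simp_all add: t_def)
    have "cmod (if Im (k \<rho>) \<ge> e then f \<rho> else 0) / Im (k \<rho>) \<le> (cmod (f \<rho>))\<^sup>2 + ?L * (1 / (sqrt (Im (k \<rho>)) * (Im (k \<rho>) + 1)))"
    proof (cases "Im (k \<rho>) \<ge> e")
      case True
      then have ut: "u \<le> t" by (simp add: u_def t_def)
      have "cmod (f \<rho>) * (1 / (t * t)) \<le> (cmod (f \<rho>))\<^sup>2 + (1 / (t * t))\<^sup>2"
        using sum_squares_bound[of "cmod (f \<rho>)" "1 / (t * t)"] mult_nonneg_nonneg[of "cmod (f \<rho>)" "1 / (t * t)"] t(1)
        by (simp only: mult.assoc) (smt (verit) norm_ge_zero zero_le_divide_1_iff mult_nonneg_nonneg zero_le_square)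
      also have "(1 / (t * t))\<^sup>2 = (1 / t + 1 / t ^ 3) * (1 / (t * (t * t + 1)))"
      proof -
        have "1 / t + 1 / t ^ 3 = (t * t + 1) / t ^ 3"
          using t(1) by (simp add: field_simps power3_eq_cube)
        moreover have "t * t + 1 > 0" using t(1) by (simp add: add_pos_pos)
        ultimately show ?thesis using t(1) by (simp add: power2_eq_square power3_eq_cube)
      qed
      also have "\<dots> \<le> ?L * (1 / (t * (t * t + 1)))"
        using u ut t(1) by (intro mult_right_mono add_mono divide_left_mono power_mono) simp_all
      finally show ?thesis using True t unfolding t_def[symmetric] by simp
    next
      case False
      then show ?thesis using u Im_pos[of \<rho>] by simp
    qed
    then show "ennreal (cmod (if Im (k \<rho>) \<ge> e then f \<rho> else 0) / Im (k \<rho>))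
      \<le> ennreal ((cmod (f \<rho>))\<^sup>2) + ennreal ?L * ennreal (1 / (sqrt (Im (k \<rho>)) * (Im (k \<rho>) + 1)))"
      using u Im_pos[of \<rho>]
      by (subst ennreal_mult'[symmetric], simp, subst ennreal_plus[symmetric]) (auto intro!: ennreal_leI simp del: ennreal_plus)
  qed
  also have "\<dots> = l2sq_on M f
     + ennreal ?L * (\<integral>\<^sup>+\<rho>. ennreal (1 / (sqrt (Im (k \<rho>)) * (Im (k \<rho>) + 1))) \<partial>M)"
    by (subst nn_integral_add) (simp_all add: nn_integral_cmult)
  also have "\<dots> < \<infinity>"
    using f le_less_trans[OF hilbert(1)[of 1]] by (simp add: ennreal_mult_less_top)
  finally show ?thesis .
qed

text \<open>The operator bound, applied to \<open>fn n - f\<close>, reduces the convergence to dominated convergence in \<open>M\<close>.\<close>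

lemma operator_cutoff_tendsto:
  fixes K :: "real \<Rightarrow> 'a \<Rightarrow> complex"
  assumes [measurable]: "case_prod K \<in> borel_measurable (lborel \<Otimes>\<^sub>M M)" "f \<in> borel_measurable M"
    and f: "l2sq_on M f < \<infinity>"
    and bound: "\<And>g. g \<in> borel_measurable M \<Longrightarrow>
      kernel_energy M g K \<le> ennreal D * l2sq_on M g"
  defines "fn \<equiv> \<lambda>n::nat. \<lambda>\<rho>. if Im (k \<rho>) \<ge> 1 / (real n + 1) then f \<rho> else 0"
  shows "square_integrable (\<lambda>x. LINT \<rho>|M. f \<rho> * K x \<rho>)"
    and "\<And>n. square_integrable (\<lambda>x. LINT \<rho>|M. fn n \<rho> * K x \<rho>)"
    and "(\<lambda>n. l2sq (\<lambda>x. (LINT \<rho>|M. fn n \<rho> * K x \<rho>) - (LINT \<rho>|M. f \<rho> * K x \<rho>))) \<longlonglongrightarrow> 0"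
proof -
  have fn_meas[measurable]: "fn n \<in> borel_measurable M" for n unfolding fn_def by measurable
  note op = integral_operator_L2[OF sigma_finite_measure_axioms assms(1)]
  have sq: "square_integrable (\<lambda>x. LINT \<rho>|M. g \<rho> * K x \<rho>)" "AE x in lborel. integrable M (\<lambda>\<rho>. g \<rho> * K x \<rho>)"
    if g: "g \<in> borel_measurable M" "\<And>\<rho>. cmod (g \<rho>) \<le> cmod (f \<rho>)" for g
  proof -
    have "ennreal D * l2sq_on M g \<le> ennreal D * l2sq_on M f"
      by (intro mult_left_mono nn_integral_mono ennreal_leI power_mono g(2)) simp_all
    also have "\<dots> < \<infinity>" using f by (simp add: ennreal_mult_less_top)
    finally have fin: "ennreal D * l2sq_on M g < \<infinity>" .
    show "square_integrable (\<lambda>x. LINT \<rho>|M. g \<rho> * K x \<rho>)"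
      unfolding square_integrable_iff_l2sq
      using op(1)[OF g(1) bound[OF g(1)]] op(2)[OF g(1) bound[OF g(1)]] fin by (auto intro: le_less_trans)
    show "AE x in lborel. integrable M (\<lambda>\<rho>. g \<rho> * K x \<rho>)"
      by (rule op(3)[OF g(1) bound[OF g(1)] fin])
  qed
  show "square_integrable (\<lambda>x. LINT \<rho>|M. f \<rho> * K x \<rho>)" by (rule sq(1)) simp_all
  have fn_le: "cmod (fn n \<rho>) \<le> cmod (f \<rho>)" for n \<rho> by (simp add: fn_def)
  show "square_integrable (\<lambda>x. LINT \<rho>|M. fn n \<rho> * K x \<rho>)" for n by (rule sq(1)) (simp_all add: fn_le)
  have le: "l2sq (\<lambda>x. (LINT \<rho>|M. fn n \<rho> * K x \<rho>) - (LINT \<rho>|M. f \<rho> * K x \<rho>))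
     \<le> ennreal D * (\<integral>\<^sup>+\<rho>. ennreal ((cmod (fn n \<rho> - f \<rho>))\<^sup>2) \<partial>M)" for n
  proof -
    have "AE x in lborel. integrable M (\<lambda>\<rho>. fn n \<rho> * K x \<rho>)" "AE x in lborel. integrable M (\<lambda>\<rho>. f \<rho> * K x \<rho>)"
      by (rule sq(2); simp add: fn_le)+
    then have "AE x in lborel. (LINT \<rho>|M. fn n \<rho> * K x \<rho>) - (LINT \<rho>|M. f \<rho> * K x \<rho>) = (LINT \<rho>|M. (fn n \<rho> - f \<rho>) * K x \<rho>)"
    proof eventually_elim
      case (elim x)
      then show ?case by (subst Bochner_Integration.integral_diff[symmetric]) (simp_all add: left_diff_distrib)
    qed
    then have "l2sq (\<lambda>x. (LINT \<rho>|M. fn n \<rho> * K x \<rho>) - (LINT \<rho>|M. f \<rho> * K x \<rho>)) = l2sq (\<lambda>x. LINT \<rho>|M. (fn n \<rho> - f \<rho>) * K x \<rho>)"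
      by (rule l2sq_cong_AE)
    also have "\<dots> \<le> ennreal D * (\<integral>\<^sup>+\<rho>. ennreal ((cmod (fn n \<rho> - f \<rho>))\<^sup>2) \<partial>M)"
      by (rule op(2)[OF _ bound]) simp_all
    finally show ?thesis .
  qed
  have "(\<lambda>n. \<integral>\<^sup>+\<rho>. ennreal ((cmod (fn n \<rho> - f \<rho>))\<^sup>2) \<partial>M) \<longlonglongrightarrow> (\<integral>\<^sup>+\<rho>. 0 \<partial>M)"
  proof (rule nn_integral_dominated_convergence[where w="\<lambda>\<rho>. ennreal ((cmod (f \<rho>))\<^sup>2)"])
    show "AE \<rho> in M. ennreal ((cmod (fn n \<rho> - f \<rho>))\<^sup>2) \<le> ennreal ((cmod (f \<rho>))\<^sup>2)" for n
      by (auto simp: fn_def)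
    show "AE \<rho> in M. (\<lambda>n. ennreal ((cmod (fn n \<rho> - f \<rho>))\<^sup>2)) \<longlonglongrightarrow> 0"
    proof (rule AE_I2)
      fix \<rho>
      have "\<forall>\<^sub>F n in sequentially. real n \<ge> 1 / Im (k \<rho>)"
        using filterlim_real_sequentially unfolding filterlim_at_top by blast
      then have "\<forall>\<^sub>F n in sequentially. ennreal ((cmod (fn n \<rho> - f \<rho>))\<^sup>2) = 0"
      proof eventually_elim
        case (elim n)
        have "1 / (real n + 1) \<le> Im (k \<rho>)" using elim Im_pos[of \<rho>] by (simp add: field_simps)
        then show ?case by (simp add: fn_def)
      qed
      then show "(\<lambda>n. ennreal ((cmod (fn n \<rho> - f \<rho>))\<^sup>2)) \<longlonglongrightarrow> 0" by (rule tendsto_eventually)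
    qed
  qed (use f in simp_all)
  then have "(\<lambda>n. ennreal D * (\<integral>\<^sup>+\<rho>. ennreal ((cmod (fn n \<rho> - f \<rho>))\<^sup>2) \<partial>M)) \<longlonglongrightarrow> 0"
    by (intro ennreal_tendsto_0_cmult) simp_all
  then show "(\<lambda>n. l2sq (\<lambda>x. (LINT \<rho>|M. fn n \<rho> * K x \<rho>) - (LINT \<rho>|M. f \<rho> * K x \<rho>))) \<longlonglongrightarrow> 0"
    by (rule tendsto_sandwich[OF _ _ tendsto_const, rotated 2]) (auto intro: always_eventually le)
qed

text \<open>The extension is the superposition of the kernels \<open>ext_kernel N (k \<rho>)\<close>. For amplitudes cut off near
the vertex its transform is the superposition of the symbols by Fubini's theorem, and the general
case follows because the transform is closed in \<open>L\<^sup>2\<close>. The Sobolev norm is that of the superposition of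
symbols, which the weighted kernel bound and Schur's test control.\<close>

theorem laplace_superposition_half_line:
  assumes s: "s \<ge> 0"
  obtains D where "D \<ge> 0"
    "\<And>f Y. f \<in> borel_measurable M \<Longrightarrow> Y \<ge> 0 \<Longrightarrow>
      (\<integral>\<^sup>+\<rho>. ennreal ((1 + (cmod (k \<rho>))\<^sup>2) powr s * (cmod (f \<rho>))\<^sup>2) \<partial>M) \<le> ennreal (Y\<^sup>2) \<Longrightarrow>
      half_line_bound s (\<lambda>x. LINT \<rho>|M. f \<rho> * exp (\<i> * k \<rho> * of_real x)) (D * Y)"
proof -
  \<comment> \<open>smooth enough for order \<open>s\<close>, which need not be an integer\<close>
  define N where "N = nat \<lceil>s\<rceil>"
  have N: "s \<le> real N" unfolding N_def using s by linarith
  obtain C0 where C0: "C0 \<ge> 0" "\<And>w x. Im w > 0 \<Longrightarrow> cmod (ext_kernel N w x) \<le> C0 / (1 + Im w * \<bar>x\<bar>)"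
    using ext_kernel_bound[of N] by blast
  define E where "E r = 4 powr (r/2) * 2 ^ N * (2 + A)" for r :: real
  have E: "E r \<ge> 0" for r using cone(2) by (simp add: E_def)
  define D where "D = sqrt (E s * B * (E s * (2 * pi)))"
  have D2: "D\<^sup>2 = E s * B * (E s * (2 * pi))" using E[of s] hilbert(2) by (simp add: D_def)
  let ?W = "\<lambda>\<rho>. (1 + (cmod (k \<rho>))\<^sup>2) powr (s/2)"
  have Wpos: "?W \<rho> > 0" for \<rho>
  proof -
    have "1 + (cmod (k \<rho>))\<^sup>2 > 0" by (simp add: add_pos_nonneg)
    then show ?thesis by simp
  qed
  have W1: "?W \<rho> \<ge> 1" for \<rho> using s by (intro ge_one_powr_ge_zero) simp_all
  have W2: "(1 + t) powr s = ((1 + t) powr (s/2))\<^sup>2" if "t \<ge> 0" for t :: real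
    by (simp add: power2_eq_square powr_add[symmetric])
  let ?KE = "\<lambda>x \<rho>. ext_kernel N (k \<rho>) x" and ?KS = "\<lambda>\<xi> \<rho>. ext_symbol N (k \<rho>) \<xi>"
  let ?KW = "\<lambda>\<xi> \<rho>. of_real ((1 + \<xi>\<^sup>2) powr (s/2) / ?W \<rho>) * ext_symbol N (k \<rho>) \<xi>"
  have mE: "case_prod ?KE \<in> borel_measurable (lborel \<Otimes>\<^sub>M M)" by measurable
  have mS: "case_prod ?KS \<in> borel_measurable (lborel \<Otimes>\<^sub>M M)" by measurable
  have mW: "case_prod ?KW \<in> borel_measurable (lborel \<Otimes>\<^sub>M M)" by measurable
  have bE: "kernel_energy M g ?KE
     \<le> ennreal (C0 * B * (C0 * (2 * pi))) * l2sq_on M g" if "g \<in> borel_measurable M" for g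
    by (rule schur_dilation[OF mE that C0(2)[OF Im_pos] C0(1)])
  have kS: "cmod (?KS \<xi> \<rho>) \<le> E 0 / (\<bar>\<xi> - c\<bar> + Im (k \<rho>))" for \<xi> \<rho>
  proof -
    have "(1 + \<xi>\<^sup>2) powr (0/2) = 1" "(1 + (cmod (k \<rho>))\<^sup>2) powr (0/2) = 1" by (simp_all add: add_nonneg_eq_0_iff)
    then show ?thesis
      using ext_symbol_weighted_bound[OF Im_pos[of \<rho>] cone(1)[of \<rho>] cone(2), where s=0 and N=N and \<xi>=\<xi>] unfolding E_def by simp
  qed
  have bS: "kernel_energy M g ?KS
     \<le> ennreal (E 0 * B * (E 0 * (2 * pi))) * l2sq_on M g" if "g \<in> borel_measurable M" for g
    by (rule schur_translation[OF mS that kS E])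
  have kW: "cmod (?KW \<xi> \<rho>) \<le> E s / (\<bar>\<xi> - c\<bar> + Im (k \<rho>))" for \<xi> \<rho>
  proof -
    have "cmod (?KW \<xi> \<rho>) = (1 + \<xi>\<^sup>2) powr (s/2) * cmod (?KS \<xi> \<rho>) / ?W \<rho>"
      by (simp add: norm_mult norm_divide)
    also have "\<dots> \<le> (E s * ?W \<rho> / (\<bar>\<xi> - c\<bar> + Im (k \<rho>))) / ?W \<rho>"
      unfolding E_def using ext_symbol_weighted_bound[OF Im_pos[of \<rho>] cone(1)[of \<rho>] cone(2) N s, where \<xi>=\<xi>] Wpos[of \<rho>]
      by (intro divide_right_mono) simp_all
    also have "\<dots> = E s / (\<bar>\<xi> - c\<bar> + Im (k \<rho>))" using Wpos[of \<rho>] by simp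
    finally show ?thesis .
  qed
  show thesis
  proof (rule that[of D])
    show "D \<ge> 0" unfolding D_def using E[of s] hilbert(2) by simp
    fix f Y
    assume f[measurable]: "f \<in> borel_measurable M" and Y: "Y \<ge> 0"
      and norm_f: "(\<integral>\<^sup>+\<rho>. ennreal ((1 + (cmod (k \<rho>))\<^sup>2) powr s * (cmod (f \<rho>))\<^sup>2) \<partial>M) \<le> ennreal (Y\<^sup>2)"
    \<comment> \<open>moving the weight into the amplitude turns the Sobolev norm into an unweighted operator bound\<close>
    define fw where "fw \<rho> = f \<rho> * of_real (?W \<rho>)" for \<rho>
    have [measurable]: "fw \<in> borel_measurable M" unfolding fw_def by measurable
    have fw2: "(cmod (fw \<rho>))\<^sup>2 = (1 + (cmod (k \<rho>))\<^sup>2) powr s * (cmod (f \<rho>))\<^sup>2" for \<rho>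
      unfolding W2[OF zero_le_power2] fw_def by (simp add: norm_mult power_mult_distrib)
    have norm_fw: "l2sq_on M fw \<le> ennreal (Y\<^sup>2)"
      unfolding fw2 by (rule norm_f)
    have "l2sq_on M f \<le> l2sq_on M fw"
    proof (intro nn_integral_mono ennreal_leI power_mono)
      show "cmod (f \<rho>) \<le> cmod (fw \<rho>)" for \<rho>
        using mult_left_mono[OF W1[of \<rho>], of "cmod (f \<rho>)"] by (simp add: fw_def norm_mult)
    qed simp
    also note norm_fw
    also have "ennreal (Y\<^sup>2) < \<infinity>" by simp
    finally have fin: "l2sq_on M f < \<infinity>" .
    let ?F = "\<lambda>x. LINT \<rho>|M. f \<rho> * ?KE x \<rho>" and ?G = "\<lambda>\<xi>. LINT \<rho>|M. f \<rho> * ?KS \<xi> \<rho>"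
    define fn where "fn n \<rho> = (if Im (k \<rho>) \<ge> 1 / (real n + 1) then f \<rho> else 0)" for n :: nat and \<rho>
    have [measurable]: "fn n \<in> borel_measurable M" for n unfolding fn_def by measurable
    have fn_int: "(\<integral>\<^sup>+\<rho>. ennreal (cmod (fn n \<rho>) / Im (k \<rho>)) \<partial>M) < \<infinity>" for n
      unfolding fn_def by (rule cutoff_summable[OF f fin]) (simp add: add_pos_nonneg)
    note super = fourier_superposition[OF _ fn_int, where N=N]
    note limE = operator_cutoff_tendsto[OF mE f fin bE, folded fn_def]
    note limS = operator_cutoff_tendsto[OF mS f fin bS, folded fn_def]
    have FG: "is_L2_fourier ?F ?G"
    proof (rule is_L2_fourier_closed[where F="\<lambda>n x. LINT \<rho>|M. fn n \<rho> * ?KE x \<rho>"])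
      show "square_integrable ?F" by (rule limE(1))
      show "square_integrable ?G" by (rule limS(1))
      show "integrable lborel (\<lambda>x. LINT \<rho>|M. fn n \<rho> * ?KE x \<rho>)" for n by (rule super(1)) simp
      show "square_integrable (\<lambda>x. LINT \<rho>|M. fn n \<rho> * ?KE x \<rho>)" for n by (rule limE(2))
      show "(\<lambda>n. l2sq (\<lambda>x. (LINT \<rho>|M. fn n \<rho> * ?KE x \<rho>) - ?F x)) \<longlonglongrightarrow> 0" by (rule limE(3))
      have "fhat (\<lambda>x. LINT \<rho>|M. fn n \<rho> * ?KE x \<rho>) \<xi> = (LINT \<rho>|M. fn n \<rho> * ?KS \<xi> \<rho>)" for n \<xi>
        by (rule super(2)) simp
      then show "(\<lambda>n. l2sq (\<lambda>\<xi>. fhat (\<lambda>x. LINT \<rho>|M. fn n \<rho> * ?KE x \<rho>) \<xi> - ?G \<xi>)) \<longlonglongrightarrow> 0"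
        using limS(3) by simp
    qed
    have GW: "(1 + \<xi>\<^sup>2) powr s * (cmod (?G \<xi>))\<^sup>2 = (cmod (LINT \<rho>|M. fw \<rho> * ?KW \<xi> \<rho>))\<^sup>2" for \<xi>
    proof -
      have "fw \<rho> * ?KW \<xi> \<rho> = of_real ((1 + \<xi>\<^sup>2) powr (s/2)) * (f \<rho> * ?KS \<xi> \<rho>)" for \<rho>
        unfolding fw_def using Wpos[of \<rho>] by simp
      then have "(LINT \<rho>|M. fw \<rho> * ?KW \<xi> \<rho>) = of_real ((1 + \<xi>\<^sup>2) powr (s/2)) * ?G \<xi>"
        by (simp only: integral_mult_right_zero)
      then show ?thesis unfolding W2[OF zero_le_power2] by (simp add: norm_mult power_mult_distrib)
    qed
    have "sobolev_energy s ?G = l2sq (\<lambda>\<xi>. LINT \<rho>|M. fw \<rho> * ?KW \<xi> \<rho>)"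
      unfolding GW l2sq_def ..
    also have "\<dots> \<le> ennreal (E s * B * (E s * (2 * pi))) * l2sq_on M fw"
      by (rule integral_operator_L2(2)[OF sigma_finite_measure_axioms mW _ schur_translation[OF mW _ kW E]]) simp_all
    also have "\<dots> \<le> ennreal (E s * B * (E s * (2 * pi))) * ennreal (Y\<^sup>2)"
      by (intro mult_left_mono norm_fw) simp
    also have "\<dots> = ennreal ((D * Y)\<^sup>2)"
      unfolding D2[symmetric] by (simp add: ennreal_mult'[symmetric] power_mult_distrib)
    finally have bound: "sobolev_energy s ?G \<le> ennreal ((D * Y)\<^sup>2)" .
    have "0 \<le> D * Y" using \<open>D \<ge> 0\<close> Y by simp
    note sob = sobolev_normI[OF FG bound this]
    have "?F x = (LINT \<rho>|M. f \<rho> * exp (\<i> * k \<rho> * of_real x))" if "x > 0" for x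
      using that by (simp add: ext_kernel_def)
    then show "half_line_bound s (\<lambda>x. LINT \<rho>|M. f \<rho> * exp (\<i> * k \<rho> * of_real x)) (D * Y)"
      unfolding half_line_bound_def using sob by (intro bexI[of _ ?F]) auto
  qed
qed

end

section \<open>Change of variables and the dispersion relation\<close>

text \<open>By the mean value theorem a nonvanishing derivative makes \<open>h\<close> injective; an inequality remains because
the image of \<open>I\<close> need not be the whole line.\<close>

lemma nn_integral_substitution_le:
  fixes h h' W :: "real \<Rightarrow> real"
  assumes I: "open I" "is_interval I"
    and deriv: "\<And>t. t \<in> I \<Longrightarrow> (h has_real_derivative h' t) (at t)"
    and nz: "\<And>t. t \<in> I \<Longrightarrow> h' t \<noteq> 0"
    and W: "integrable lborel W" "\<And>x. W x \<ge> 0"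
    and meas: "(\<lambda>t. indicator I t * (\<bar>h' t\<bar> * W (h t))) \<in> borel_measurable borel"
  shows "(\<integral>\<^sup>+t. ennreal (indicator I t * (\<bar>h' t\<bar> * W (h t))) \<partial>lborel) \<le> (\<integral>\<^sup>+x. ennreal (W x) \<partial>lborel)"
proof -
  have inj: "inj_on h I"
  proof (rule linorder_inj_onI)
    fix x y assume xy: "x < y" "x \<in> I" "y \<in> I"
    then have sub: "z \<in> I" if "x \<le> z" "z \<le> y" for z
      using I(2) that unfolding is_interval_1 by blast
    obtain z where "x < z" "z < y" "h y - h x = (y - x) * h' z"
      using MVT2[of x y h h'] xy deriv sub by blast
    with nz[of z] sub[of z] xy show "h x \<noteq> h y" by auto
  qed auto
  have cont: "continuous_on I h"
    using deriv by (intro continuous_at_imp_continuous_on ballI) (blast intro: DERIV_isCont)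
  have "is_interval (h ` I)"
    using connected_continuous_image[OF cont] I(2) by (simp add: is_interval_connected_1)
  then have hI: "h ` I \<in> sets lebesgue"
    by (intro sets_completionI_sets) (simp add: real_interval_borel_measurable)
  have Wleb: "W absolutely_integrable_on UNIV"
    using W(1) unfolding set_integrable_def by (simp add: integrable_completion)
  have WhI: "W absolutely_integrable_on h ` I"
    by (rule set_integrable_subset[OF Wleb hI]) simp
  have IS: "I \<in> sets lebesgue" using I(1) by (intro sets_completionI_sets) simp
  have "(\<lambda>x. \<bar>h' x\<bar> * W (h x)) absolutely_integrable_on I \<and>
       integral I (\<lambda>x. \<bar>h' x\<bar> * W (h x)) = integral (h ` I) W"
    by (subst has_absolute_integral_change_of_variables_1'[OF IS _ inj])
       (use deriv WhI in \<open>auto intro: DERIV_subset\<close>)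
  then have sub: "set_integrable lebesgue I (\<lambda>x. \<bar>h' x\<bar> * W (h x))"
      "integral I (\<lambda>x. \<bar>h' x\<bar> * W (h x)) = integral (h ` I) W" by auto
  have int: "integrable lborel (\<lambda>t. indicator I t * (\<bar>h' t\<bar> * W (h t)))"
    using sub(1) meas unfolding set_integrable_def by (simp add: integrable_completion)
  have "(\<integral>\<^sup>+t. ennreal (indicator I t * (\<bar>h' t\<bar> * W (h t))) \<partial>lborel) = ennreal (LINT t|lborel. indicator I t * (\<bar>h' t\<bar> * W (h t)))"
    by (rule nn_integral_eq_integral[OF int]) (simp add: W(2))
  also have "(LINT t|lborel. indicator I t * (\<bar>h' t\<bar> * W (h t))) = (LINT t:I|lebesgue. \<bar>h' t\<bar> * W (h t))"
    using meas unfolding set_lebesgue_integral_def by (simp add: integral_completion)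
  also have "\<dots> = integral (h ` I) W"
    using set_lebesgue_integral_eq_integral(2)[OF sub(1)] sub(2) by simp
  also have "\<dots> = (LINT t:h ` I|lebesgue. W t)"
    using set_lebesgue_integral_eq_integral(2)[OF WhI] by simp
  also have "\<dots> \<le> (LINT t:UNIV|lebesgue. W t)"
    using WhI Wleb unfolding set_lebesgue_integral_def set_integrable_def
    by (rule integral_mono) (simp add: indicator_def W(2))
  also have "\<dots> = (LINT t|lborel. W t)"
    using W(1) unfolding set_lebesgue_integral_def by (simp add: integral_completion)
  finally show ?thesis
    using nn_integral_eq_integral[OF W(1)] W(2) by (simp add: ennreal_leI)
qed

locale dispersion =
  fixes \<alpha> \<beta> \<delta> l :: real
  assumes beta: "\<beta> < 0" and adm: "admissible_l \<alpha> \<beta> \<delta> l"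
begin

definition disc :: real where "disc = \<alpha>\<^sup>2 + 3 * \<beta> * \<delta>"

definition centre :: real where "centre = \<alpha> / (3 * \<beta>)"

lemma l_pos: "l > 0"
proof (cases "disc < 0")
  case True
  then have "l = sqrt (- 3 * disc) / (- 3 * \<beta>)" using adm by (simp add: admissible_l_def disc_def)
  also have "0 < sqrt (- 3 * disc) / (- 3 * \<beta>)"
    using True beta by (intro divide_pos_pos) simp_all
  finally show ?thesis .
next
  case False
  then have "sqrt disc / (- \<beta>) < l" using adm by (simp add: admissible_l_def disc_def)
  moreover have "0 \<le> sqrt disc / (- \<beta>)" using False beta by (intro divide_nonneg_pos) simp_all
  ultimately show ?thesis by simp
qed

lemma disc_ge: "disc \<ge> - (3 * \<beta>\<^sup>2 * l\<^sup>2)"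
proof (cases "disc < 0")
  case True
  then have "l = sqrt (- 3 * disc) / (- 3 * \<beta>)" using adm by (simp add: admissible_l_def disc_def)
  then have "l\<^sup>2 = - 3 * disc / (9 * \<beta>\<^sup>2)" using True by (simp add: power_divide power_mult_distrib)
  then have "3 * \<beta>\<^sup>2 * l\<^sup>2 = - disc" using beta by (simp add: field_simps)
  then show ?thesis by simp
next
  case False
  have "0 \<le> 3 * \<beta>\<^sup>2 * l\<^sup>2" by simp
  then show ?thesis using False by linarith
qed

lemma q_eq: "q \<alpha> \<beta> \<delta> m = sqrt (3 * \<beta>\<^sup>2 * m\<^sup>2 + disc)"
  by (simp add: q_def disc_def add.assoc)

lemma q_sq:
  assumes "m \<ge> l"
  shows "(q \<alpha> \<beta> \<delta> m)\<^sup>2 = 3 * \<beta>\<^sup>2 * m\<^sup>2 + disc"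
proof -
  have "l\<^sup>2 \<le> m\<^sup>2" using assms l_pos by (intro power_mono) simp_all
  then have "3 * \<beta>\<^sup>2 * l\<^sup>2 \<le> 3 * \<beta>\<^sup>2 * m\<^sup>2" by (intro mult_left_mono) simp_all
  then have "0 \<le> 3 * \<beta>\<^sup>2 * m\<^sup>2 + disc" using disc_ge by linarith
  then show ?thesis by (simp add: q_eq)
qed

lemma q_nonneg: "q \<alpha> \<beta> \<delta> m \<ge> 0" if "m \<ge> l"
  using q_sq[OF that] unfolding q_eq by (metis real_sqrt_ge_zero zero_le_power2 real_sqrt_pow2_iff abs_ge_zero real_sqrt_abs)

lemma q_ge:
  assumes "m > l"
  shows "q \<alpha> \<beta> \<delta> m \<ge> - \<beta> * sqrt (m\<^sup>2 - l\<^sup>2)" "q \<alpha> \<beta> \<delta> m > 0"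
proof -
  have lm: "m\<^sup>2 - l\<^sup>2 > 0" using assms l_pos by (simp add: power_strict_mono)
  have "(- \<beta> * sqrt (m\<^sup>2 - l\<^sup>2))\<^sup>2 = \<beta>\<^sup>2 * (m\<^sup>2 - l\<^sup>2)" using lm by (simp add: power_mult_distrib)
  also have "\<dots> \<le> 3 * (\<beta>\<^sup>2 * (m\<^sup>2 - l\<^sup>2))" using lm by simp
  also have "\<dots> \<le> 3 * \<beta>\<^sup>2 * m\<^sup>2 + disc" using disc_ge by (simp add: algebra_simps)
  finally have "- \<beta> * sqrt (m\<^sup>2 - l\<^sup>2) \<le> sqrt (3 * \<beta>\<^sup>2 * m\<^sup>2 + disc)" by (rule real_le_rsqrt)
  then show "q \<alpha> \<beta> \<delta> m \<ge> - \<beta> * sqrt (m\<^sup>2 - l\<^sup>2)" unfolding q_eq .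
  moreover have "- \<beta> * sqrt (m\<^sup>2 - l\<^sup>2) > 0" using lm beta by (intro mult_pos_pos) simp_all
  ultimately show "q \<alpha> \<beta> \<delta> m > 0" by linarith
qed

text \<open>The frequency at which the transform of the data is evaluated. It is real on the unbounded parts of
the contour.\<close>

definition tau :: "complex \<Rightarrow> complex" where
  "tau k = of_real \<beta> * k ^ 3 - of_real \<alpha> * k\<^sup>2 - of_real \<delta> * k"

definition tau' :: "complex \<Rightarrow> complex" where
  "tau' k = 3 * of_real \<beta> * k\<^sup>2 - 2 * of_real \<alpha> * k - of_real \<delta>"

lemma i_omega: "\<i> * omega \<alpha> \<beta> \<delta> k = tau k"
  unfolding omega_def tau_def by (simp add: algebra_simps)

lemma tau_deriv: "(tau has_field_derivative tau' k) (at k)"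
  unfolding tau_def[abs_def] tau'_def by (auto intro!: derivative_eq_intros simp: algebra_simps power2_eq_square)

lemma tau'_eq:
  "tau' k = 3 * of_real \<beta> * ((k - of_real centre)\<^sup>2 - of_real (disc / (9 * \<beta>\<^sup>2)))"
proof -
  have b: "complex_of_real \<beta> \<noteq> 0" using beta by simp
  show ?thesis unfolding tau'_def centre_def disc_def using b
    by (simp add: field_simps power2_eq_square)
qed

text \<open>In terms of \<open>\<kappa> = k - centre\<close> the derivative of \<open>tau\<close> is a multiple of \<open>\<kappa>\<^sup>2 - disc / (9 \<beta>\<^sup>2)\<close>. Both the real
half-lines and the hyperbola satisfy the assumptions, with different \<open>y\<close>.\<close>

lemma tau'_lower:
  obtains c0 where "c0 > 0"
    "\<And>k y. y \<ge> l\<^sup>2 / 3 \<Longrightarrow> (cmod (k - of_real centre))\<^sup>2 \<le> 2 * y + \<bar>disc\<bar> / (9 * \<beta>\<^sup>2) \<Longrightarrow>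
       cmod ((k - of_real centre)\<^sup>2 - of_real (disc / (9 * \<beta>\<^sup>2))) \<ge> y \<Longrightarrow>
       c0 * (1 + (cmod k)\<^sup>2) \<le> cmod (tau' k)"
proof -
  define E where "E = 1 + 2 * (\<bar>disc\<bar> / (9 * \<beta>\<^sup>2)) + 2 * centre\<^sup>2"
  have E: "E \<ge> 0" unfolding E_def by (intro add_nonneg_nonneg) simp_all
  define L where "L = 4 + E * 3 / l\<^sup>2"
  have L: "L > 0" unfolding L_def using E by (intro add_pos_nonneg) simp_all
  show thesis
  proof (rule that[of "3 * (- \<beta>) / L"])
    show c0: "3 * (- \<beta>) / L > 0" using beta L by (intro divide_pos_pos) simp_all
    fix k :: complex and y
    assume y: "y \<ge> l\<^sup>2 / 3" and kb: "(cmod (k - of_real centre))\<^sup>2 \<le> 2 * y + \<bar>disc\<bar> / (9 * \<beta>\<^sup>2)"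
      and low: "cmod ((k - of_real centre)\<^sup>2 - of_real (disc / (9 * \<beta>\<^sup>2))) \<ge> y"
    have "(cmod k)\<^sup>2 \<le> 2 * (cmod (k - of_real centre))\<^sup>2 + 2 * centre\<^sup>2"
      using norm_add_sq_weighted_le[of 1 "k - of_real centre" "of_real centre"] by simp
    with kb have "1 + (cmod k)\<^sup>2 \<le> 4 * y + E * 1" by (simp add: E_def)
    also have "E * 1 \<le> E * (y * 3 / l\<^sup>2)"
      using y l_pos E by (intro mult_left_mono) (simp_all add: field_simps)
    finally have "1 + (cmod k)\<^sup>2 \<le> L * y" by (simp add: L_def algebra_simps)
    also have "\<dots> \<le> L * cmod ((k - of_real centre)\<^sup>2 - of_real (disc / (9 * \<beta>\<^sup>2)))"
      using L low by (intro mult_left_mono) simp_all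
    finally have "3 * (- \<beta>) / L * (1 + (cmod k)\<^sup>2) \<le> 3 * (- \<beta>) / L * (L * cmod ((k - of_real centre)\<^sup>2 - of_real (disc / (9 * \<beta>\<^sup>2))))"
      by (rule mult_left_mono[OF _ less_imp_le[OF c0]])
    also have "\<dots> = cmod (tau' k)"
      unfolding tau'_eq norm_mult using L beta by simp
    finally show "3 * (- \<beta>) / L * (1 + (cmod k)\<^sup>2) \<le> cmod (tau' k)" .
  qed
qed

text \<open>The leading term \<open>\<beta> k\<^sup>3\<close> dominates the others for \<open>\<bar>k\<bar> \<ge> K0\<close>; the remaining \<open>k\<close> form a bounded set.\<close>

lemma tau_growth:
  obtains K where "K > 0" "\<And>k. (1 + (cmod k)\<^sup>2) ^ 3 \<le> K * (1 + (cmod (tau k))\<^sup>2)"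
proof -
  \<comment> \<open>beyond \<open>K0\<close> the lower order terms are at most half of the leading one\<close>
  define K0 where "K0 = 1 + 2 * (\<bar>\<alpha>\<bar> + \<bar>\<delta>\<bar>) / \<bar>\<beta>\<bar>"
  have K0: "K0 \<ge> 1" by (simp add: K0_def)
  define K where "K = (1 + K0\<^sup>2) ^ 3 + 32 / \<beta>\<^sup>2"
  have K1: "0 \<le> 32 / \<beta>\<^sup>2" "0 < (1 + K0\<^sup>2) ^ 3" by (simp_all add: add_pos_nonneg)
  show thesis
  proof (rule that[of K])
    show "K > 0" using add_pos_nonneg[OF K1(2,1)] by (simp only: K_def)
    fix k
    define r where "r = cmod k"
    have r: "r \<ge> 0" by (simp add: r_def)
    show "(1 + (cmod k)\<^sup>2) ^ 3 \<le> K * (1 + (cmod (tau k))\<^sup>2)"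
    proof (cases "r \<le> K0")
      case True
      have "(1 + (cmod k)\<^sup>2) ^ 3 \<le> (1 + K0\<^sup>2) ^ 3 * 1"
        using True r unfolding r_def[symmetric] by (simp add: power_mono add_nonneg_nonneg)
      also have "\<dots> \<le> K * (1 + (cmod (tau k))\<^sup>2)"
        using K1 by (intro mult_mono) (simp_all add: K_def)
      finally show ?thesis .
    next
      case False
      then have rK: "r > K0" and r1: "r \<ge> 1" using K0 by simp_all
      have "\<bar>\<alpha>\<bar> * r\<^sup>2 + \<bar>\<delta>\<bar> * r \<le> (\<bar>\<alpha>\<bar> + \<bar>\<delta>\<bar>) * r\<^sup>2"
        using mult_left_mono[OF mult_left_mono[OF r1 r], of "\<bar>\<delta>\<bar>"] by (simp add: power2_eq_square algebra_simps)
      also have "\<dots> \<le> (\<bar>\<beta>\<bar> * r / 2) * r\<^sup>2"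
      proof (rule mult_right_mono)
        have "2 * (\<bar>\<alpha>\<bar> + \<bar>\<delta>\<bar>) / \<bar>\<beta>\<bar> \<le> r" using rK by (simp add: K0_def)
        then show "\<bar>\<alpha>\<bar> + \<bar>\<delta>\<bar> \<le> \<bar>\<beta>\<bar> * r / 2" using beta by (simp add: field_simps)
      qed simp
      finally have low: "\<bar>\<alpha>\<bar> * r\<^sup>2 + \<bar>\<delta>\<bar> * r \<le> \<bar>\<beta>\<bar> * r ^ 3 / 2" by (simp add: power3_eq_cube power2_eq_square)
      have "\<bar>\<beta>\<bar> * r ^ 3 = cmod (tau k + (of_real \<alpha> * k\<^sup>2 + of_real \<delta> * k))"
        by (simp add: tau_def r_def norm_mult norm_power)
      also have "\<dots> \<le> cmod (tau k) + (\<bar>\<alpha>\<bar> * r\<^sup>2 + \<bar>\<delta>\<bar> * r)"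
        using norm_triangle_ineq[of "of_real \<alpha> * k\<^sup>2" "of_real \<delta> * k"]
          norm_triangle_ineq[of "tau k" "of_real \<alpha> * k\<^sup>2 + of_real \<delta> * k"]
        by (simp add: norm_mult norm_power r_def)
      finally have "\<bar>\<beta>\<bar> * r ^ 3 / 2 \<le> cmod (tau k)" using low by simp
      then have "(\<bar>\<beta>\<bar> * r ^ 3 / 2)\<^sup>2 \<le> (cmod (tau k))\<^sup>2" using r by (intro power_mono) simp_all
      then have "\<beta>\<^sup>2 * r ^ 6 / 4 \<le> (cmod (tau k))\<^sup>2" by (simp add: power_mult_distrib power_divide flip: power_mult)
      then have r6: "r ^ 6 \<le> 4 / \<beta>\<^sup>2 * (cmod (tau k))\<^sup>2" using beta by (simp add: field_simps)
      have "(1 + r\<^sup>2) ^ 3 \<le> (2 * r\<^sup>2) ^ 3" using r1 by (intro power_mono) (simp_all add: one_le_power)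
      also have "\<dots> = 8 * r ^ 6" by (simp add: power_mult_distrib flip: power_mult)
      also have "\<dots> \<le> 32 / \<beta>\<^sup>2 * (cmod (tau k))\<^sup>2" using r6 by simp
      also have "\<dots> \<le> K * (1 + (cmod (tau k))\<^sup>2)"
        using K1 by (intro mult_mono) (simp_all add: K_def)
      finally show ?thesis unfolding r_def .
    qed
  qed
qed

text \<open>The root \<open>nu_plus\<close> grows linearly, since the modulus of \<open>csqrt z\<close> is the square root of the modulus of \<open>z\<close>.\<close>

lemma phi_growth:
  obtains K where "K > 0" "\<And>j k. j \<le> 1 \<Longrightarrow> (cmod (phi \<alpha> \<beta> \<delta> j k))\<^sup>2 \<le> K * (1 + (cmod k)\<^sup>2) ^ (2 - j)"
proof -
  define e where "e = sqrt (\<bar>4 * disc / (9 * \<beta>\<^sup>2)\<bar>)"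
  define K1 where "K1 = 3 + \<bar>\<alpha> / \<beta>\<bar> + \<bar>centre\<bar> + e"
  have e: "e \<ge> 0" by (simp add: e_def)
  have K1: "K1 \<ge> 1" using e by (simp add: K1_def)
  have nu: "cmod (nu_plus \<alpha> \<beta> \<delta> k) \<le> K1 * (1 + cmod k)" for k
  proof -
    let ?z = "(k - of_real centre)\<^sup>2 - of_real (4 * disc / (9 * \<beta>\<^sup>2))"
    have "cmod ?z \<le> (cmod (k - of_real centre))\<^sup>2 + e\<^sup>2"
      using norm_triangle_ineq4[of "(k - of_real centre)\<^sup>2" "of_real (4 * disc / (9 * \<beta>\<^sup>2))"]
      by (simp only: norm_power norm_of_real e_def) simp
    also have "\<dots> \<le> (cmod (k - of_real centre) + e)\<^sup>2"
      using e by (simp add: power2_sum)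
    finally have "sqrt (cmod ?z) \<le> cmod (k - of_real centre) + e"
      using e by (intro real_le_lsqrt) simp_all
    then have sq: "cmod (csqrt ?z) \<le> cmod k + \<bar>centre\<bar> + e"
      using norm_triangle_ineq4[of k "of_real centre"] by simp
    have s3: "sqrt 3 / 2 \<le> 1" by (simp add: real_le_lsqrt)
    have "nu_plus \<alpha> \<beta> \<delta> k = - (1/2) * (k - of_real (\<alpha> / \<beta>)) + \<i> * of_real (sqrt 3 / 2) * csqrt ?z"
      unfolding nu_plus_def centre_def disc_def ..
    then have "cmod (nu_plus \<alpha> \<beta> \<delta> k) \<le> cmod (- (1/2) * (k - of_real (\<alpha> / \<beta>))) + cmod (\<i> * of_real (sqrt 3 / 2) * csqrt ?z)"
      by (simp only: norm_triangle_ineq)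
    also have "cmod (- (1/2) * (k - of_real (\<alpha> / \<beta>))) = 1/2 * cmod (k - of_real (\<alpha> / \<beta>))"
      by (simp only: norm_mult norm_minus_cancel) simp
    also have "cmod (\<i> * of_real (sqrt 3 / 2) * csqrt ?z) = sqrt 3 / 2 * cmod (csqrt ?z)"
      by (simp only: norm_mult norm_of_real norm_ii) simp
    also have "1/2 * cmod (k - of_real (\<alpha> / \<beta>)) \<le> cmod k + \<bar>\<alpha> / \<beta>\<bar>"
      using norm_triangle_ineq4[of k "of_real (\<alpha> / \<beta>)"] norm_ge_zero[of "k - of_real (\<alpha> / \<beta>)"]
      by (simp only: norm_of_real)
    also have "sqrt 3 / 2 * cmod (csqrt ?z) \<le> 1 * (cmod k + \<bar>centre\<bar> + e)"
      using s3 sq by (intro mult_mono) simp_all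
    also have "cmod k + \<bar>\<alpha> / \<beta>\<bar> + 1 * (cmod k + \<bar>centre\<bar> + e) \<le> K1 * (1 + cmod k)"
    proof -
      have "0 \<le> (\<bar>\<alpha> / \<beta>\<bar> + \<bar>centre\<bar> + e) * cmod k" using e by simp
      then show ?thesis unfolding K1_def by (simp add: algebra_simps del: abs_divide)
    qed
    finally show ?thesis by simp
  qed
  have diff: "cmod (k - nu_plus \<alpha> \<beta> \<delta> k) \<le> 2 * K1 * (1 + cmod k)" for k
  proof -
    have "cmod (k - nu_plus \<alpha> \<beta> \<delta> k) \<le> cmod k + K1 * (1 + cmod k)"
      using norm_triangle_ineq4[of k "nu_plus \<alpha> \<beta> \<delta> k"] nu[of k] by simp
    moreover have "cmod k \<le> K1 * (1 + cmod k)"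
      using mult_right_mono[OF K1, of "1 + cmod k"] by simp
    ultimately show ?thesis unfolding mult.assoc by linarith
  qed
  define K2 where "K2 = \<bar>\<alpha>\<bar> + \<bar>\<beta>\<bar> + \<bar>\<beta>\<bar> * K1"
  have K2: "K2 \<ge> 0" using K1 by (simp add: K2_def)
  have snd: "cmod (of_real \<alpha> - of_real \<beta> * k - of_real \<beta> * nu_plus \<alpha> \<beta> \<delta> k) \<le> K2 * (1 + cmod k)" for k
  proof -
    have "cmod (of_real \<alpha> - of_real \<beta> * k - of_real \<beta> * nu_plus \<alpha> \<beta> \<delta> k) \<le> \<bar>\<alpha>\<bar> + \<bar>\<beta>\<bar> * cmod k + \<bar>\<beta>\<bar> * cmod (nu_plus \<alpha> \<beta> \<delta> k)"
      using norm_triangle_ineq4[of "of_real \<alpha> - of_real \<beta> * k" "of_real \<beta> * nu_plus \<alpha> \<beta> \<delta> k"]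
        norm_triangle_ineq4[of "of_real \<alpha>" "of_real \<beta> * k"]
      by (simp add: norm_mult)
    also have "\<dots> \<le> \<bar>\<alpha>\<bar> + \<bar>\<beta>\<bar> * cmod k + \<bar>\<beta>\<bar> * (K1 * (1 + cmod k))"
      by (intro add_left_mono mult_left_mono nu) simp
    also have "\<dots> \<le> K2 * (1 + cmod k)"
      unfolding K2_def by (simp add: algebra_simps)
    finally show ?thesis .
  qed
  have sq1: "(1 + cmod k)\<^sup>2 \<le> 2 * (1 + (cmod k)\<^sup>2)" for k
    using sum_squares_bound[of 1 "cmod k"] by (simp add: power2_sum)
  define K where "K = 1 + (2 * K1 * K2)\<^sup>2 * 4 + (\<bar>\<beta>\<bar> * (2 * K1))\<^sup>2 * 2"
  show thesis
  proof (rule that[of K])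
    show "K > 0" unfolding K_def by (intro add_pos_nonneg) simp_all
    fix j :: nat and k assume j: "j \<le> 1"
    show "(cmod (phi \<alpha> \<beta> \<delta> j k))\<^sup>2 \<le> K * (1 + (cmod k)\<^sup>2) ^ (2 - j)"
    proof (cases "j = 0")
      case True
      have "cmod (phi \<alpha> \<beta> \<delta> j k) \<le> (2 * K1 * (1 + cmod k)) * (K2 * (1 + cmod k))"
        unfolding phi_def using True K1 by (simp only: norm_mult simp_thms if_True) (intro mult_mono diff snd, simp_all)
      also have "\<dots> = 2 * K1 * K2 * (1 + cmod k)\<^sup>2" by (simp add: power2_eq_square)
      also have "\<dots> \<le> 2 * K1 * K2 * (2 * (1 + (cmod k)\<^sup>2))" using K1 K2 by (intro mult_left_mono sq1) simp
      finally have "(cmod (phi \<alpha> \<beta> \<delta> j k))\<^sup>2 \<le> (2 * K1 * K2 * (2 * (1 + (cmod k)\<^sup>2)))\<^sup>2"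
        by (rule power_mono) simp
      also have "\<dots> = (2 * K1 * K2)\<^sup>2 * 4 * (1 + (cmod k)\<^sup>2)\<^sup>2"
        by (simp only: power_mult_distrib) simp
      also have "\<dots> \<le> K * (1 + (cmod k)\<^sup>2)\<^sup>2"
        by (intro mult_right_mono) (simp_all add: K_def)
      finally show ?thesis using True by simp
    next
      case False
      have "cmod (phi \<alpha> \<beta> \<delta> j k) \<le> \<bar>\<beta>\<bar> * (2 * K1 * (1 + cmod k))"
        unfolding phi_def using False by (simp only: norm_mult if_False norm_ii norm_of_real mult_1_left) (intro mult_left_mono diff, simp)
      then have "(cmod (phi \<alpha> \<beta> \<delta> j k))\<^sup>2 \<le> (\<bar>\<beta>\<bar> * (2 * K1 * (1 + cmod k)))\<^sup>2"
        by (rule power_mono) simp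
      also have "\<dots> = (\<bar>\<beta>\<bar> * (2 * K1))\<^sup>2 * (1 + cmod k)\<^sup>2" by (simp add: power_mult_distrib)
      also have "\<dots> \<le> (\<bar>\<beta>\<bar> * (2 * K1))\<^sup>2 * (2 * (1 + (cmod k)\<^sup>2))" by (intro mult_left_mono sq1) simp
      also have "\<dots> = (\<bar>\<beta>\<bar> * (2 * K1))\<^sup>2 * 2 * (1 + (cmod k)\<^sup>2)" by simp
      also have "\<dots> \<le> K * (1 + (cmod k)\<^sup>2)"
        by (intro mult_right_mono) (simp_all add: K_def)
      finally have "(cmod (phi \<alpha> \<beta> \<delta> j k))\<^sup>2 \<le> K * (1 + (cmod k)\<^sup>2)" .
      moreover have "j = 1" using False j by simp
      ultimately show ?thesis by simp
    qed
  qed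
qed

end

section \<open>Integrals along the contour\<close>

abbreviation curve_norm_sq :: "real \<Rightarrow> real set \<Rightarrow> (real \<Rightarrow> complex) \<Rightarrow> (real \<Rightarrow> complex) \<Rightarrow> (real \<Rightarrow> complex) \<Rightarrow> ennreal" where
  "curve_norm_sq s I \<gamma> \<gamma>' g \<equiv>
    \<integral>\<^sup>+m. ennreal (indicator I m * ((1 + (cmod (\<gamma> m))\<^sup>2) powr s * (cmod (g m))\<^sup>2 * cmod (\<gamma>' m))) \<partial>lborel"

text \<open>This is \<open>laplace_superposition_half_line\<close> with \<open>M\<close> the arc length of the curve; the unit tangent becomes
part of the amplitude. Arc length, rather than the parameter, has to be the reference measure, since
the speed of the hyperbola need not be square integrable at its vertex.\<close>

lemma curve_superposition_half_line:
  fixes \<gamma> \<gamma>' :: "real \<Rightarrow> complex" and I :: "real set"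
  assumes [measurable]: "I \<in> sets borel" "\<gamma> \<in> borel_measurable borel" "\<gamma>' \<in> borel_measurable borel"
    and pos: "\<And>m. m \<in> I \<Longrightarrow> Im (\<gamma> m) > 0"
    and cone: "\<And>m. m \<in> I \<Longrightarrow> \<bar>Re (\<gamma> m) - c\<bar> \<le> A * Im (\<gamma> m)" "A \<ge> 0"
    and hilbert: "\<And>b. b > 0 \<Longrightarrow>
      (\<integral>\<^sup>+m. ennreal (indicator I m * (cmod (\<gamma>' m) / (sqrt (Im (\<gamma> m)) * (Im (\<gamma> m) + b)))) \<partial>lborel) \<le> ennreal (B / sqrt b)"
      "B \<ge> 0"
    and s: "s \<ge> 0"
  obtains D where "D \<ge> 0"
    "\<And>g Y. g \<in> borel_measurable borel \<Longrightarrow> Y \<ge> 0 \<Longrightarrow>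
      curve_norm_sq s I \<gamma> \<gamma>' g \<le> ennreal (Y\<^sup>2) \<Longrightarrow>
      half_line_bound s (\<lambda>x. LINT m:I|lborel. exp (\<i> * \<gamma> m * of_real x) * g m * \<gamma>' m) (D * Y)"
proof -
  define w where "w m = indicator I m * cmod (\<gamma>' m)" for m
  have w0: "w m \<ge> 0" for m by (simp add: w_def)
  have [measurable]: "w \<in> borel_measurable borel" unfolding w_def by measurable
  define M where "M = Nonnegative_Lebesgue_Integration.density lborel (\<lambda>m. ennreal (w m))"
  \<comment> \<open>off \<open>I\<close>, a set of measure \<open>0\<close>, any point on the axis of the cone will do\<close>
  define k where "k m = (if m \<in> I then \<gamma> m else Complex c 1)" for m
  have [measurable]: "k \<in> borel_measurable borel" unfolding k_def by measurable
  have MM: "measurable M = measurable borel" unfolding M_def by (intro ext) (simp add: measurable_def)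
  have nn: "(\<integral>\<^sup>+m. ennreal (u m) \<partial>M) = (\<integral>\<^sup>+m. ennreal (w m * u m) \<partial>lborel)"
    if [measurable]: "u \<in> borel_measurable borel" for u :: "real \<Rightarrow> real"
    unfolding M_def by (subst nn_integral_density) (simp_all add: ennreal_mult'[OF w0])
  have "sigma_finite_measure M"
    unfolding M_def by (subst sigma_finite_measure.sigma_finite_iff_density_finite[OF sigma_finite_lborel]) auto
  then interpret M: sigma_finite_measure M .
  interpret upper_curve M k c A B
  proof unfold_locales
    show "k \<in> borel_measurable M" unfolding MM by measurable
    show "Im (k \<rho>) > 0" for \<rho> using pos by (simp add: k_def)
    show "\<bar>Re (k \<rho>) - c\<bar> \<le> A * Im (k \<rho>)" for \<rho> using cone by (simp add: k_def)
    show "A \<ge> 0" "B \<ge> 0" by fact+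
    fix b :: real assume b: "b > 0"
    have "(\<integral>\<^sup>+\<rho>. ennreal (1 / (sqrt (Im (k \<rho>)) * (Im (k \<rho>) + b))) \<partial>M)
      = (\<integral>\<^sup>+m. ennreal (w m * (1 / (sqrt (Im (k m)) * (Im (k m) + b)))) \<partial>lborel)"
      by (rule nn) measurable
    also have "\<dots> = (\<integral>\<^sup>+m. ennreal (indicator I m * (cmod (\<gamma>' m) / (sqrt (Im (\<gamma> m)) * (Im (\<gamma> m) + b)))) \<partial>lborel)"
      by (intro nn_integral_cong) (simp add: w_def k_def indicator_def)
    also have "\<dots> \<le> ennreal (B / sqrt b)" by (rule hilbert(1)[OF b])
    finally show "(\<integral>\<^sup>+\<rho>. ennreal (1 / (sqrt (Im (k \<rho>)) * (Im (k \<rho>) + b))) \<partial>M) \<le> ennreal (B / sqrt b)" .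
  qed
  obtain D where D: "D \<ge> 0"
    "\<And>f Y. f \<in> borel_measurable M \<Longrightarrow> Y \<ge> 0 \<Longrightarrow>
      (\<integral>\<^sup>+\<rho>. ennreal ((1 + (cmod (k \<rho>))\<^sup>2) powr s * (cmod (f \<rho>))\<^sup>2) \<partial>M) \<le> ennreal (Y\<^sup>2) \<Longrightarrow>
      half_line_bound s (\<lambda>x. LINT \<rho>|M. f \<rho> * exp (\<i> * k \<rho> * of_real x)) (D * Y)"
    using laplace_superposition_half_line[OF s] by blast
  show thesis
  proof (rule that[OF D(1)])
    fix g :: "real \<Rightarrow> complex" and Y :: real
    assume [measurable]: "g \<in> borel_measurable borel" and Y: "Y \<ge> 0"
      and b: "curve_norm_sq s I \<gamma> \<gamma>' g \<le> ennreal (Y\<^sup>2)"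
    \<comment> \<open>the amplitude with respect to arc length; at a point of speed \<open>0\<close> it is \<open>0\<close>\<close>
    define f where "f m = g m * (\<gamma>' m / of_real (cmod (\<gamma>' m)))" for m
    have [measurable]: "f \<in> borel_measurable borel" unfolding f_def by measurable
    have "(\<integral>\<^sup>+\<rho>. ennreal ((1 + (cmod (k \<rho>))\<^sup>2) powr s * (cmod (f \<rho>))\<^sup>2) \<partial>M)
      = (\<integral>\<^sup>+m. ennreal (w m * ((1 + (cmod (k m))\<^sup>2) powr s * (cmod (f m))\<^sup>2)) \<partial>lborel)"
      by (rule nn) measurable
    also have "\<dots> = curve_norm_sq s I \<gamma> \<gamma>' g"
      by (intro nn_integral_cong) (simp add: w_def k_def f_def indicator_def norm_mult norm_divide)
    also note b
    finally have "half_line_bound s (\<lambda>x. LINT \<rho>|M. f \<rho> * exp (\<i> * k \<rho> * of_real x)) (D * Y)"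
      by (intro D(2) Y) (simp_all add: MM)
    moreover have "(LINT \<rho>|M. f \<rho> * exp (\<i> * k \<rho> * of_real x)) = (LINT m:I|lborel. exp (\<i> * \<gamma> m * of_real x) * g m * \<gamma>' m)" for x :: real
    proof -
      have "(LINT \<rho>|M. f \<rho> * exp (\<i> * k \<rho> * of_real x)) = (LINT m|lborel. w m *\<^sub>R (f m * exp (\<i> * k m * of_real x)))"
        unfolding M_def by (rule integral_density) (simp_all add: w0)
      also have "\<dots> = (LINT m:I|lborel. exp (\<i> * \<gamma> m * of_real x) * g m * \<gamma>' m)"
        unfolding set_lebesgue_integral_def
        by (intro Bochner_Integration.integral_cong refl)
           (simp add: w_def k_def f_def indicator_def scaleR_conv_of_real)
      finally show ?thesis .
    qed
    ultimately show "half_line_bound s (\<lambda>x. LINT m:I|lborel. exp (\<i> * \<gamma> m * of_real x) * g m * \<gamma>' m) (D * Y)"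
      by simp
  qed
qed

abbreviation wave where
  "wave \<alpha> \<beta> \<delta> j \<psi> t x \<equiv> \<lambda>k. exp (\<i> * k * complex_of_real x) * Defs.density \<alpha> \<beta> \<delta> j \<psi> t k"

text \<open>The datum \<open>\<psi>\<^sub>j\<close> with a bound \<open>X\<close> for its norm of order \<open>(s + 1 - j)/3\<close>, in terms of the transform given
by the integral.\<close>

definition boundary_datum :: "real \<Rightarrow> nat \<Rightarrow> (real \<Rightarrow> complex) \<Rightarrow> real \<Rightarrow> bool" where
  "boundary_datum s j \<psi> X \<longleftrightarrow> j \<le> 1 \<and> integrable lborel \<psi> \<and> X \<ge> 0 \<and>
     sobolev_energy ((s + 1 - real j) / 3) (fhat \<psi>) \<le> ennreal (X\<^sup>2)"

lemma boundary_datumD: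
  assumes "boundary_datum s j \<psi> X"
  shows "j \<le> 1" "integrable lborel \<psi>" "X \<ge> 0"
    "sobolev_energy ((s + 1 - real j) / 3) (fhat \<psi>) \<le> ennreal (X\<^sup>2)"
  using assms by (simp_all add: boundary_datum_def)

definition compact_datum :: "real \<Rightarrow> (real \<Rightarrow> complex) \<Rightarrow> real \<Rightarrow> bool" where
  "compact_datum T \<psi> X \<longleftrightarrow> square_integrable \<psi> \<and> (AE x in lborel. x \<notin> {0..T} \<longrightarrow> \<psi> x = 0) \<and>
     l2sq \<psi> \<le> ennreal (X\<^sup>2) \<and> X \<ge> 0"

lemma compact_datumD:
  assumes "compact_datum T \<psi> X"
  shows "square_integrable \<psi>" "AE x in lborel. x \<notin> {0..T} \<longrightarrow> \<psi> x = 0"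
    "l2sq \<psi> \<le> ennreal (X\<^sup>2)" "X \<ge> 0"
  using assms by (simp_all add: compact_datum_def)

lemma csqrt_measurable [measurable]: "csqrt \<in> borel_measurable borel"
proof -
  have "csqrt = (\<lambda>z. of_real (sqrt ((cmod z + Re z) / 2)) +
      \<i> * of_real ((if Im z = 0 then 1 else sgn (Im z)) * sqrt ((cmod z - Re z) / 2)))"
    by (rule ext) (simp add: complex_eq_iff)
  also have "\<dots> \<in> borel_measurable borel" by measurable
  finally show ?thesis .
qed

lemma density_measurable:
  assumes [measurable]: "\<psi> \<in> borel_measurable borel"
  shows "Defs.density \<alpha> \<beta> \<delta> j \<psi> t \<in> borel_measurable borel"
proof -
  have nu[measurable]: "nu_plus \<alpha> \<beta> \<delta> \<in> borel_measurable borel" unfolding nu_plus_def by measurable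
  have [measurable]: "phi \<alpha> \<beta> \<delta> j \<in> borel_measurable borel"
    unfolding phi_def by (cases "j = 0") simp_all
  have [measurable]: "omega \<alpha> \<beta> \<delta> \<in> borel_measurable borel" unfolding omega_def by measurable
  show ?thesis unfolding Defs.density_def by measurable
qed

context dispersion
begin

text \<open>If \<open>tau k\<close> is real, then \<open>omega k\<close> is imaginary and the time factor has modulus one.\<close>

lemma density_on_real_symbol:
  assumes "Im (tau k) = 0"
  shows "(cmod (Defs.density \<alpha> \<beta> \<delta> j \<psi> t k))\<^sup>2 = (cmod (phi \<alpha> \<beta> \<delta> j k))\<^sup>2 * (cmod (fhat \<psi> (Re (tau k))))\<^sup>2"
proof -
  have om: "omega \<alpha> \<beta> \<delta> k = - \<i> * tau k"
    by (simp add: i_omega[symmetric])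
  have "tau k = of_real (Re (tau k))" using assms by (simp add: complex_eq_iff)
  then have "fourier \<psi> (\<i> * omega \<alpha> \<beta> \<delta> k) = fhat \<psi> (Re (tau k))" unfolding i_omega by simp
  moreover have "cmod (exp (- omega \<alpha> \<beta> \<delta> k * of_real t)) = 1"
    unfolding om using assms by simp
  ultimately show ?thesis unfolding Defs.density_def
    by (simp only: norm_mult mult_1_left power_mult_distrib)
qed

text \<open>With \<open>h(m) = tau (\<gamma> m)\<close> as new variable the measure \<open>\<bar>d\<gamma>\<bar>\<close> becomes \<open>dh / \<bar>tau'\<bar>\<close>, so of the factor
\<open>\<bar>\<phi>\<^sub>j\<bar>\<^sup>2\<close>, which is of order \<open>(1 + \<bar>k\<bar>\<^sup>2)\<^sup>2\<^sup>-\<^sup>j\<close>, one power of \<open>1 + \<bar>k\<bar>\<^sup>2\<close> is absorbed. What remains is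
\<open>(1 + \<bar>k\<bar>\<^sup>2)\<close> to the power \<open>s + 1 - j\<close>, and \<open>tau_growth\<close> turns it into \<open>(1 + h\<^sup>2)\<close> to the
power \<open>(s + 1 - j)/3\<close>.\<close>

lemma curve_energy:
  fixes I :: "real set" and \<gamma> \<gamma>' :: "real \<Rightarrow> complex"
  assumes I: "open I" "is_interval I"
    and meas: "\<gamma> \<in> borel_measurable borel" "\<gamma>' \<in> borel_measurable borel"
    and deriv: "\<And>m. m \<in> I \<Longrightarrow> (\<gamma> has_vector_derivative \<gamma>' m) (at m)"
    and nz: "\<And>m. m \<in> I \<Longrightarrow> \<gamma>' m \<noteq> 0"
    and real: "\<And>m. m \<in> I \<Longrightarrow> Im (tau (\<gamma> m)) = 0"
    and low: "c0 > 0" "\<And>m. m \<in> I \<Longrightarrow> c0 * (1 + (cmod (\<gamma> m))\<^sup>2) \<le> cmod (tau' (\<gamma> m))"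
    and s: "s \<ge> 0"
  obtains C where "C \<ge> 0"
    "\<And>j \<psi> t X. boundary_datum s j \<psi> X \<Longrightarrow>
      curve_norm_sq s I \<gamma> \<gamma>' (\<lambda>m. Defs.density \<alpha> \<beta> \<delta> j \<psi> t (\<gamma> m)) \<le> ennreal ((C * X)\<^sup>2)"
proof -
  have [measurable]: "I \<in> sets borel" using I by simp
  note [measurable] = meas
  obtain Kt where Kt: "Kt > 0" "\<And>k. (1 + (cmod k)\<^sup>2) ^ 3 \<le> Kt * (1 + (cmod (tau k))\<^sup>2)"
    using tau_growth by blast
  obtain Kp where Kp: "Kp > 0" "\<And>j k. j \<le> 1 \<Longrightarrow> (cmod (phi \<alpha> \<beta> \<delta> j k))\<^sup>2 \<le> Kp * (1 + (cmod k)\<^sup>2) ^ (2 - j)"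
    using phi_growth by blast
  define r where "r j = (s + 1 - real j) / 3" for j
  define Q where "Q = Kp * (Kt powr r 0 + Kt powr r 1) / c0"
  have Q: "Q \<ge> 0" using Kp low by (simp add: Q_def)
  define h where "h m = Re (tau (\<gamma> m))" for m
  define h' where "h' m = Re (tau' (\<gamma> m) * \<gamma>' m)" for m
  have [measurable]: "tau \<in> borel_measurable borel" "tau' \<in> borel_measurable borel"
    unfolding tau_def[abs_def] tau'_def[abs_def] by measurable
  have [measurable]: "h \<in> borel_measurable borel" "h' \<in> borel_measurable borel"
    unfolding h_def h'_def by measurable
  have vd: "((\<lambda>m. tau (\<gamma> m)) has_vector_derivative \<gamma>' m * tau' (\<gamma> m)) (at m)" if "m \<in> I" for m
    using field_vector_diff_chain_at[OF deriv[OF that] tau_deriv] by (simp add: o_def)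
  have h_deriv: "(h has_real_derivative h' m) (at m)" if "m \<in> I" for m
    using bounded_linear.has_vector_derivative[OF bounded_linear_Re vd[OF that]]
    unfolding has_real_derivative_iff_has_vector_derivative h_def h'_def by (simp add: mult.commute)
  \<comment> \<open>the symbol is real along the curve, hence so is its derivative, and no length is lost in \<open>h\<close>\<close>
  have im0: "Im (tau' (\<gamma> m) * \<gamma>' m) = 0" if m: "m \<in> I" for m
  proof -
    have "((\<lambda>m. Im (tau (\<gamma> m))) has_vector_derivative Im (\<gamma>' m * tau' (\<gamma> m))) (at m)"
      by (rule bounded_linear.has_vector_derivative[OF bounded_linear_Im vd[OF m]])
    then have "((\<lambda>m. 0) has_vector_derivative Im (\<gamma>' m * tau' (\<gamma> m))) (at m)"
      by (rule has_vector_derivative_transform_within_open[OF _ I(1) m]) (rule real)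
    then show ?thesis
      using vector_derivative_unique_at[OF _ has_vector_derivative_const] by (metis mult.commute)
  qed
  have h'_abs: "\<bar>h' m\<bar> = cmod (tau' (\<gamma> m)) * cmod (\<gamma>' m)" if "m \<in> I" for m
    using im0[OF that] by (simp add: h'_def norm_mult[symmetric] cmod_eq_Re)
  have h'_low: "c0 * (1 + (cmod (\<gamma> m))\<^sup>2) * cmod (\<gamma>' m) \<le> \<bar>h' m\<bar>" if "m \<in> I" for m
    unfolding h'_abs[OF that] by (intro mult_right_mono low that) simp
  have h'_nz: "h' m \<noteq> 0" if m: "m \<in> I" for m
  proof -
    have "0 < c0 * (1 + (cmod (\<gamma> m))\<^sup>2) * cmod (\<gamma>' m)"
      using nz[OF m] low(1) by (simp add: add_pos_nonneg)
    with h'_low[OF m] show ?thesis by auto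
  qed
  have point: "(1 + (cmod (\<gamma> m))\<^sup>2) powr s * (cmod (phi \<alpha> \<beta> \<delta> j (\<gamma> m)))\<^sup>2 * cmod (\<gamma>' m)
     \<le> Q * ((1 + (h m)\<^sup>2) powr r j * \<bar>h' m\<bar>)" if m: "m \<in> I" and j: "j \<le> 1" for m j
  proof -
    define X where "X = 1 + (cmod (\<gamma> m))\<^sup>2"
    have X: "X > 0" by (simp add: X_def add_pos_nonneg)
    have rj: "r j \<ge> 0" using j s by (simp add: r_def)
    have tau_h: "(cmod (tau (\<gamma> m)))\<^sup>2 = (h m)\<^sup>2" using real[OF m] by (simp add: h_def cmod_eq_Re)
    have "X powr (s + 1 - real j) = (X ^ 3) powr r j"
    proof -
      have "X ^ 3 = X powr 3" using X by simp
      moreover have "3 * r j = s + 1 - real j" by (simp add: r_def)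
      ultimately show ?thesis by (simp only: powr_powr)
    qed
    also have "\<dots> \<le> (Kt * (1 + (h m)\<^sup>2)) powr r j"
      using Kt(2)[of "\<gamma> m"] X rj unfolding tau_h X_def[symmetric] by (intro powr_mono2) simp_all
    also have "\<dots> = Kt powr r j * (1 + (h m)\<^sup>2) powr r j" by (simp only: powr_mult)
    also have "\<dots> \<le> (Kt powr r 0 + Kt powr r 1) * (1 + (h m)\<^sup>2) powr r j"
      using j by (intro mult_right_mono) (auto simp: le_Suc_eq)
    finally have 1: "X powr (s + 1 - real j) \<le> (Kt powr r 0 + Kt powr r 1) * (1 + (h m)\<^sup>2) powr r j" .
    have 2: "X * cmod (\<gamma>' m) \<le> \<bar>h' m\<bar> / c0"
      using h'_low[OF m] low(1) unfolding X_def[symmetric] by (simp add: field_simps)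
    have e: "X powr s * X ^ (2 - j) = X powr (s + 1 - real j) * X"
    proof -
      have "X ^ (2 - j) = X powr real (2 - j)" using X by (simp add: powr_realpow)
      then have "X powr s * X ^ (2 - j) = X powr (s + real (2 - j))" by (simp only: powr_add)
      also have "s + real (2 - j) = (s + 1 - real j) + 1" using j by (simp add: of_nat_diff)
      also have "X powr ((s + 1 - real j) + 1) = X powr (s + 1 - real j) * X powr 1" by (rule powr_add)
      finally show ?thesis using X by simp
    qed
    have "X powr s * (cmod (phi \<alpha> \<beta> \<delta> j (\<gamma> m)))\<^sup>2 * cmod (\<gamma>' m) \<le> X powr s * (Kp * X ^ (2 - j)) * cmod (\<gamma>' m)"
      using Kp(2)[OF j, of "\<gamma> m"] by (intro mult_right_mono mult_left_mono) (simp_all add: X_def)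
    also have "\<dots> = Kp * ((X powr s * X ^ (2 - j)) * cmod (\<gamma>' m))" by (simp only: mult_ac)
    also have "\<dots> = Kp * (X powr (s + 1 - real j) * (X * cmod (\<gamma>' m)))" unfolding e by (simp only: mult.assoc)
    also have "\<dots> \<le> Kp * (((Kt powr r 0 + Kt powr r 1) * (1 + (h m)\<^sup>2) powr r j) * (\<bar>h' m\<bar> / c0))"
      using Kp(1) X low(1) by (intro mult_left_mono mult_mono 1 2) simp_all
    also have "\<dots> = Q * ((1 + (h m)\<^sup>2) powr r j * \<bar>h' m\<bar>)" by (simp add: Q_def)
    finally show ?thesis unfolding X_def .
  qed
  show thesis
  proof (rule that[of "sqrt Q"])
    show "sqrt Q \<ge> 0" using Q by simp
    fix j \<psi> t and X :: real
    assume dat: "boundary_datum s j \<psi> X"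
    note j = boundary_datumD(1)[OF dat] and \<psi> = boundary_datumD(2)[OF dat]
      and X = boundary_datumD(3)[OF dat] and b = boundary_datumD(4)[OF dat]
    have [measurable]: "\<psi> \<in> borel_measurable borel" using \<psi> by auto
    define W where "W \<xi> = (1 + \<xi>\<^sup>2) powr r j * (cmod (fhat \<psi> \<xi>))\<^sup>2" for \<xi> :: real
    have [measurable]: "W \<in> borel_measurable borel" unfolding W_def by measurable
    have W0: "W \<xi> \<ge> 0" for \<xi> by (simp add: W_def)
    have bW: "(\<integral>\<^sup>+\<xi>. ennreal (W \<xi>) \<partial>lborel) \<le> ennreal (X\<^sup>2)" using b by (simp add: W_def r_def)
    have W: "integrable lborel W"
      by (rule integrableI_nonneg) (use W0 bW in \<open>auto intro: le_less_trans\<close>)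
    have "curve_norm_sq s I \<gamma> \<gamma>' (\<lambda>m. Defs.density \<alpha> \<beta> \<delta> j \<psi> t (\<gamma> m))
      \<le> (\<integral>\<^sup>+m. ennreal Q * ennreal (indicator I m * (\<bar>h' m\<bar> * W (h m))) \<partial>lborel)"
    proof (rule nn_integral_mono)
      fix m
      have "indicator I m * ((1 + (cmod (\<gamma> m))\<^sup>2) powr s *
         (cmod (Defs.density \<alpha> \<beta> \<delta> j \<psi> t (\<gamma> m)))\<^sup>2 * cmod (\<gamma>' m)) \<le> Q * (indicator I m * (\<bar>h' m\<bar> * W (h m)))"
      proof (cases "m \<in> I")
        case True
        have "(1 + (cmod (\<gamma> m))\<^sup>2) powr s * (cmod (Defs.density \<alpha> \<beta> \<delta> j \<psi> t (\<gamma> m)))\<^sup>2 * cmod (\<gamma>' m)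
          = ((1 + (cmod (\<gamma> m))\<^sup>2) powr s * (cmod (phi \<alpha> \<beta> \<delta> j (\<gamma> m)))\<^sup>2 * cmod (\<gamma>' m)) * (cmod (fhat \<psi> (h m)))\<^sup>2"
          unfolding density_on_real_symbol[OF real[OF True]] h_def by (simp only: mult_ac)
        also have "\<dots> \<le> (Q * ((1 + (h m)\<^sup>2) powr r j * \<bar>h' m\<bar>)) * (cmod (fhat \<psi> (h m)))\<^sup>2"
          by (intro mult_right_mono point True j) simp
        also have "\<dots> = Q * (\<bar>h' m\<bar> * W (h m))" unfolding W_def by (simp only: mult_ac)
        finally show ?thesis using True by simp
      qed simp
      then show "ennreal (indicator I m * ((1 + (cmod (\<gamma> m))\<^sup>2) powr s *
         (cmod (Defs.density \<alpha> \<beta> \<delta> j \<psi> t (\<gamma> m)))\<^sup>2 * cmod (\<gamma>' m))) \<le> ennreal Q * ennreal (indicator I m * (\<bar>h' m\<bar> * W (h m)))"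
        using Q by (simp only: ennreal_mult'[symmetric] ennreal_leI)
    qed
    also have "\<dots> = ennreal Q * (\<integral>\<^sup>+m. ennreal (indicator I m * (\<bar>h' m\<bar> * W (h m))) \<partial>lborel)"
      by (rule nn_integral_cmult) measurable
    also have "\<dots> \<le> ennreal Q * (\<integral>\<^sup>+\<xi>. ennreal (W \<xi>) \<partial>lborel)"
      by (intro mult_left_mono nn_integral_substitution_le I h_deriv h'_nz W W0) simp_all
    also have "\<dots> \<le> ennreal Q * ennreal (X\<^sup>2)" by (intro mult_left_mono bW) simp
    also have "\<dots> = ennreal ((sqrt Q * X)\<^sup>2)"
      using Q by (simp add: ennreal_mult' power_mult_distrib)
    finally show "curve_norm_sq s I \<gamma> \<gamma>' (\<lambda>m. Defs.density \<alpha> \<beta> \<delta> j \<psi> t (\<gamma> m)) \<le> ennreal ((sqrt Q * X)\<^sup>2)" .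
  qed
qed


text \<open>By Fourier inversion the piece is its own extension, and \<open>curve_energy\<close> bounds its norm. The
assumption \<open>far\<close> keeps \<open>I\<close> away from the critical points of \<open>tau\<close>.\<close>

lemma real_piece_half_line:
  fixes I S :: "real set"
  assumes I: "open I" "is_interval I" and S: "AE t in lborel. t \<in> S \<longleftrightarrow> t \<in> I" "S \<in> sets borel"
    and far: "\<And>t. t \<in> I \<Longrightarrow> (q \<alpha> \<beta> \<delta> l)\<^sup>2 / (9 * \<beta>\<^sup>2) \<le> (t - centre)\<^sup>2"
    and s: "s \<ge> 0"
  obtains C where "C \<ge> 0"
    "\<And>j \<psi> t X w. boundary_datum s j \<psi> X \<Longrightarrow>
      is_L2_inv_fourier (\<lambda>k. indicator S k *\<^sub>R Defs.density \<alpha> \<beta> \<delta> j \<psi> t (of_real k)) w \<Longrightarrow>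
      half_line_bound s w (C * X)"
proof -
  obtain c0 where c0: "c0 > 0" "\<And>k y. y \<ge> l\<^sup>2 / 3 \<Longrightarrow> (cmod (k - of_real centre))\<^sup>2 \<le> 2 * y + \<bar>disc\<bar> / (9 * \<beta>\<^sup>2) \<Longrightarrow>
       cmod ((k - of_real centre)\<^sup>2 - of_real (disc / (9 * \<beta>\<^sup>2))) \<ge> y \<Longrightarrow>
       c0 * (1 + (cmod k)\<^sup>2) \<le> cmod (tau' k)"
    by (rule tau'_lower) blast
  have low: "c0 * (1 + (cmod (complex_of_real t))\<^sup>2) \<le> cmod (tau' (of_real t))" if t: "t \<in> I" for t
  proof (rule c0(2)[of "(t - centre)\<^sup>2 - disc / (9 * \<beta>\<^sup>2)"])
    have "(q \<alpha> \<beta> \<delta> l)\<^sup>2 / (9 * \<beta>\<^sup>2) = l\<^sup>2 / 3 + disc / (9 * \<beta>\<^sup>2)"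
      using beta by (simp add: q_sq add_divide_distrib)
    then show y: "(t - centre)\<^sup>2 - disc / (9 * \<beta>\<^sup>2) \<ge> l\<^sup>2 / 3" using far[OF t] by simp
    have n: "cmod (of_real t - of_real centre) = \<bar>t - centre\<bar>"
      by (simp only: of_real_diff[symmetric] norm_of_real)
    have weaken: "z \<le> 2 * (z - d) + e" if "d \<le> e" "0 \<le> L" "L \<le> z - d" for z d e L :: real
      using that unfolding right_diff_distrib by linarith
    show "(cmod (of_real t - of_real centre))\<^sup>2 \<le> 2 * ((t - centre)\<^sup>2 - disc / (9 * \<beta>\<^sup>2)) + \<bar>disc\<bar> / (9 * \<beta>\<^sup>2)"
      unfolding n power2_abs by (rule weaken[OF _ _ y]) (simp_all add: divide_right_mono)
    have "(of_real t - of_real centre)\<^sup>2 - complex_of_real (disc / (9 * \<beta>\<^sup>2)) = of_real ((t - centre)\<^sup>2 - disc / (9 * \<beta>\<^sup>2))"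
      by simp
    then show "(t - centre)\<^sup>2 - disc / (9 * \<beta>\<^sup>2) \<le> cmod ((of_real t - of_real centre)\<^sup>2 - of_real (disc / (9 * \<beta>\<^sup>2)))"
      by (simp only: norm_of_real abs_ge_self)
  qed
  obtain C where C: "C \<ge> 0"
    "\<And>j \<psi> t X. boundary_datum s j \<psi> X \<Longrightarrow>
      curve_norm_sq s I complex_of_real (\<lambda>_. 1) (\<lambda>m. Defs.density \<alpha> \<beta> \<delta> j \<psi> t (of_real m)) \<le> ennreal ((C * X)\<^sup>2)"
  proof (rule curve_energy[where I=I and \<gamma>=of_real and \<gamma>'="\<lambda>_. 1" and s=s, OF I _ _ _ _ _ c0(1) low s])
    show "(complex_of_real has_vector_derivative 1) (at m)" for m
      using has_vector_derivative_of_real[OF DERIV_ident] by simp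
    show "Im (tau (of_real m)) = 0" for m
      by (simp add: tau_def flip: of_real_power)
  qed (use that in auto)
  show thesis
  proof (rule that[OF C(1)])
    fix j \<psi> t w and X :: real
    assume dat: "boundary_datum s j \<psi> X"
      and w: "is_L2_inv_fourier (\<lambda>k. indicator S k *\<^sub>R Defs.density \<alpha> \<beta> \<delta> j \<psi> t (of_real k)) w"
    note j = boundary_datumD(1)[OF dat] and \<psi> = boundary_datumD(2)[OF dat]
      and X = boundary_datumD(3)[OF dat] and b = boundary_datumD(4)[OF dat]
    let ?g = "\<lambda>k. indicator S k *\<^sub>R Defs.density \<alpha> \<beta> \<delta> j \<psi> t (complex_of_real k)"
    have "sobolev_energy s ?g
      = curve_norm_sq s I complex_of_real (\<lambda>_. 1) (\<lambda>m. Defs.density \<alpha> \<beta> \<delta> j \<psi> t (of_real m))"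
      by (rule nn_integral_cong_AE) (use S(1) in \<open>eventually_elim, auto simp: indicator_def\<close>)
    also have "\<dots> \<le> ennreal ((C * X)\<^sup>2)" by (rule C(2)[OF dat])
    finally have bound: "sobolev_energy s ?g \<le> ennreal ((C * X)\<^sup>2)" .
    have "0 \<le> C * X" using C(1) X by simp
    from sobolev_normI[OF is_L2_inv_fourier_imp_is_L2_fourier[OF w] bound this]
    show "half_line_bound s w (C * X)" unfolding half_line_bound_def by auto
  qed
qed

lemma far_left: "(q \<alpha> \<beta> \<delta> l)\<^sup>2 / (9 * \<beta>\<^sup>2) \<le> (t - centre)\<^sup>2" if "t \<le> c1 \<alpha> \<beta> \<delta> l"
proof -
  have "c1 \<alpha> \<beta> \<delta> l = centre + q \<alpha> \<beta> \<delta> l / (3 * \<beta>)" by (simp add: c1_def centre_def add_divide_distrib)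
  with that have "q \<alpha> \<beta> \<delta> l / (- 3 * \<beta>) \<le> centre - t" by simp
  moreover have "0 \<le> q \<alpha> \<beta> \<delta> l / (- 3 * \<beta>)" using q_nonneg[of l] beta by (intro divide_nonneg_pos) simp_all
  ultimately have "(q \<alpha> \<beta> \<delta> l / (- 3 * \<beta>))\<^sup>2 \<le> (centre - t)\<^sup>2" by (rule power_mono)
  then show ?thesis by (simp add: power_divide power_mult_distrib power2_commute)
qed

lemma far_right: "(q \<alpha> \<beta> \<delta> l)\<^sup>2 / (9 * \<beta>\<^sup>2) \<le> (t - centre)\<^sup>2" if "t \<ge> c2 \<alpha> \<beta> \<delta> l"
proof -
  have "c2 \<alpha> \<beta> \<delta> l = centre - q \<alpha> \<beta> \<delta> l / (3 * \<beta>)" by (simp add: c2_def centre_def diff_divide_distrib)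
  with that have "q \<alpha> \<beta> \<delta> l / (- 3 * \<beta>) \<le> t - centre" by simp
  moreover have "0 \<le> q \<alpha> \<beta> \<delta> l / (- 3 * \<beta>)" using q_nonneg[of l] beta by (intro divide_nonneg_pos) simp_all
  ultimately have "(q \<alpha> \<beta> \<delta> l / (- 3 * \<beta>))\<^sup>2 \<le> (t - centre)\<^sup>2" by (rule power_mono)
  then show ?thesis by (simp add: power_divide power_mult_distrib)
qed

text \<open>The value \<open>\<sigma> = 1\<close> gives \<open>gamma3\<close> and \<open>\<sigma> = -1\<close> gives \<open>gamma4\<close>, the two branches of a hyperbola.\<close>

definition branch :: "real \<Rightarrow> real \<Rightarrow> complex" where
  "branch \<sigma> m = Complex ((\<alpha> + \<sigma> * q \<alpha> \<beta> \<delta> m) / (3 * \<beta>)) m"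

definition branch' :: "real \<Rightarrow> real \<Rightarrow> complex" where
  "branch' \<sigma> m = Complex (\<sigma> * \<beta> * m / q \<alpha> \<beta> \<delta> m) 1"

lemma gamma3_eq: "gamma3 \<alpha> \<beta> \<delta> = branch 1" and gamma4_eq: "gamma4 \<alpha> \<beta> \<delta> = branch (- 1)"
  by (auto simp: gamma3_def gamma4_def branch_def)

lemma branch_measurable [measurable]:
  "branch \<sigma> \<in> borel_measurable borel" "branch' \<sigma> \<in> borel_measurable borel"
proof -
  have [measurable]: "q \<alpha> \<beta> \<delta> \<in> borel_measurable borel" unfolding q_def[abs_def] by measurable
  show "branch \<sigma> \<in> borel_measurable borel" "branch' \<sigma> \<in> borel_measurable borel"
    unfolding branch_def[abs_def] branch'_def[abs_def] Complex_eq by measurable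
qed

lemma branch_deriv:
  assumes "m > l"
  shows "(branch \<sigma> has_vector_derivative branch' \<sigma> m) (at m)"
proof -
  have pos: "3 * \<beta>\<^sup>2 * m\<^sup>2 + disc > 0"
    using q_sq[OF less_imp_le[OF assms]] zero_less_power[OF q_ge(2)[OF assms], of 2] by simp
  have qm: "q \<alpha> \<beta> \<delta> m > 0" by (rule q_ge(2)[OF assms])
  have inner: "((\<lambda>m. 3 * \<beta>\<^sup>2 * m\<^sup>2 + disc) has_real_derivative 6 * \<beta>\<^sup>2 * m) (at m)"
    by (auto intro!: derivative_eq_intros)
  have "((\<lambda>m. sqrt (3 * \<beta>\<^sup>2 * m\<^sup>2 + disc)) has_real_derivative
      inverse (sqrt (3 * \<beta>\<^sup>2 * m\<^sup>2 + disc)) / 2 * (6 * \<beta>\<^sup>2 * m)) (at m)"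
    by (rule DERIV_chain2[OF DERIV_real_sqrt[OF pos] inner])
  also have "inverse (sqrt (3 * \<beta>\<^sup>2 * m\<^sup>2 + disc)) / 2 * (6 * \<beta>\<^sup>2 * m) = 3 * \<beta>\<^sup>2 * m / q \<alpha> \<beta> \<delta> m"
  proof -
    have "inverse r / 2 * (6 * a * b) = 3 * a * b / r" if "r > 0" for r a b :: real
      using that by (simp add: field_simps)
    from this[OF qm] show ?thesis by (simp only: q_eq)
  qed
  also have "(\<lambda>m. sqrt (3 * \<beta>\<^sup>2 * m\<^sup>2 + disc)) = q \<alpha> \<beta> \<delta>" by (rule ext) (rule q_eq[symmetric])
  finally have "(q \<alpha> \<beta> \<delta> has_real_derivative 3 * \<beta>\<^sup>2 * m / q \<alpha> \<beta> \<delta> m) (at m)" .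
  then have "((\<lambda>m. (\<alpha> + \<sigma> * q \<alpha> \<beta> \<delta> m) / (3 * \<beta>)) has_real_derivative (0 + \<sigma> * (3 * \<beta>\<^sup>2 * m / q \<alpha> \<beta> \<delta> m)) / (3 * \<beta>)) (at m)"
    by (intro DERIV_cdivide DERIV_add DERIV_const DERIV_cmult)
  also have "(0 + \<sigma> * (3 * \<beta>\<^sup>2 * m / q \<alpha> \<beta> \<delta> m)) / (3 * \<beta>) = \<sigma> * \<beta> * m / q \<alpha> \<beta> \<delta> m"
    using beta by (simp add: power2_eq_square)
  finally have re: "((\<lambda>m. (\<alpha> + \<sigma> * q \<alpha> \<beta> \<delta> m) / (3 * \<beta>)) has_real_derivative \<sigma> * \<beta> * m / q \<alpha> \<beta> \<delta> m) (at m)" .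
  have "((\<lambda>m. of_real ((\<alpha> + \<sigma> * q \<alpha> \<beta> \<delta> m) / (3 * \<beta>)) + \<i> * of_real m) has_vector_derivative
      of_real (\<sigma> * \<beta> * m / q \<alpha> \<beta> \<delta> m) + \<i> * of_real 1) (at m)"
    by (rule has_vector_derivative_add[OF has_vector_derivative_of_real[OF re]
          has_vector_derivative_mult_right[OF has_vector_derivative_of_real[OF DERIV_ident]]])
  then show ?thesis
    unfolding branch_def[abs_def] branch'_def Complex_eq .
qed

text \<open>For \<open>k = a + i m\<close> the imaginary part of \<open>tau k\<close> is \<open>m\<close> times a quadratic polynomial in \<open>a\<close>, and the
branches are the solutions \<open>a\<close> of the quadratic equation.\<close>

lemma branch_tau_real:
  assumes "m \<ge> l" "\<sigma> = 1 \<or> \<sigma> = - 1"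
  shows "Im (tau (branch \<sigma> m)) = 0"
proof -
  define a where "a = (\<alpha> + \<sigma> * q \<alpha> \<beta> \<delta> m) / (3 * \<beta>)"
  have s2: "\<sigma> * \<sigma> = 1" using assms(2) by auto
  have a3: "3 * \<beta> * a = \<alpha> + \<sigma> * q \<alpha> \<beta> \<delta> m" using beta by (simp add: a_def)
  have "(3 * \<beta> * a - \<alpha>)\<^sup>2 = (q \<alpha> \<beta> \<delta> m)\<^sup>2"
    unfolding a3 using s2 by (simp add: power2_eq_square algebra_simps)
  then have "(3 * \<beta> * a - \<alpha>)\<^sup>2 = 3 * \<beta>\<^sup>2 * m\<^sup>2 + \<alpha>\<^sup>2 + 3 * \<beta> * \<delta>"
    using q_sq[OF assms(1)] by (simp add: disc_def)
  then have "3 * \<beta> * (3 * \<beta> * a\<^sup>2 - \<beta> * m\<^sup>2 - 2 * \<alpha> * a - \<delta>) = 0"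
    by (simp add: power2_eq_square algebra_simps)
  then have "3 * \<beta> * a\<^sup>2 - \<beta> * m\<^sup>2 - 2 * \<alpha> * a - \<delta> = 0" using beta by simp
  moreover have "Im (tau (Complex a m)) = m * (3 * \<beta> * a\<^sup>2 - \<beta> * m\<^sup>2 - 2 * \<alpha> * a - \<delta>)"
    by (simp add: tau_def power3_eq_cube power2_eq_square algebra_simps)
  ultimately show ?thesis unfolding branch_def a_def by simp
qed

lemma branch_minus_centre: "branch \<sigma> m - of_real centre = Complex (\<sigma> * q \<alpha> \<beta> \<delta> m / (3 * \<beta>)) m"
  by (simp add: branch_def centre_def complex_eq_iff add_divide_distrib)

lemma branch_cone:
  assumes "m > l" "\<sigma> = 1 \<or> \<sigma> = - 1"
  shows "\<bar>Re (branch \<sigma> m) - centre\<bar> \<le> sqrt (3 * \<beta>\<^sup>2 + \<bar>disc\<bar> / l\<^sup>2) / (3 * \<bar>\<beta>\<bar>) * m"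
proof -
  have m: "m > 0" using assms l_pos by simp
  have "Re (branch \<sigma> m) - centre = \<sigma> * q \<alpha> \<beta> \<delta> m / (3 * \<beta>)"
    using arg_cong[OF branch_minus_centre, of Re] by simp
  then have e: "\<bar>Re (branch \<sigma> m) - centre\<bar> = q \<alpha> \<beta> \<delta> m / (3 * \<bar>\<beta>\<bar>)"
    using assms(2) q_ge(2)[OF assms(1)] by (auto simp: abs_mult)
  have "\<bar>disc\<bar> * 1 \<le> \<bar>disc\<bar> * (m\<^sup>2 / l\<^sup>2)"
    using assms(1) l_pos by (intro mult_left_mono) (simp_all add: power_mono)
  then have "3 * \<beta>\<^sup>2 * m\<^sup>2 + disc \<le> (3 * \<beta>\<^sup>2 + \<bar>disc\<bar> / l\<^sup>2) * m\<^sup>2"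
    by (simp add: algebra_simps)
  then have "q \<alpha> \<beta> \<delta> m \<le> sqrt ((3 * \<beta>\<^sup>2 + \<bar>disc\<bar> / l\<^sup>2) * m\<^sup>2)"
    unfolding q_eq by (rule real_sqrt_le_mono)
  also have "\<dots> = sqrt (3 * \<beta>\<^sup>2 + \<bar>disc\<bar> / l\<^sup>2) * m"
    using m by (simp add: real_sqrt_mult)
  finally have "q \<alpha> \<beta> \<delta> m / (3 * \<bar>\<beta>\<bar>) \<le> sqrt (3 * \<beta>\<^sup>2 + \<bar>disc\<bar> / l\<^sup>2) * m / (3 * \<bar>\<beta>\<bar>)"
    by (rule divide_right_mono) simp
  then show ?thesis unfolding e by simp
qed

text \<open>If \<open>disc < 0\<close>, then \<open>q\<close> vanishes at \<open>m = l\<close>, and the speed has a singularity of order \<open>-1/2\<close> there.\<close>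

lemma branch_speed:
  assumes "m > l" "\<sigma> = 1 \<or> \<sigma> = - 1"
  shows "cmod (branch' \<sigma> m) \<le> 1 + sqrt m / sqrt (m - l)"
proof -
  have m: "m > 0" using assms l_pos by simp
  note qm = q_ge[OF assms(1)]
  have "sqrt (m - l) * sqrt m \<le> sqrt (m\<^sup>2 - l\<^sup>2)"
  proof -
    have "m * l \<ge> l * l" using assms l_pos by (intro mult_right_mono) simp_all
    then have "(m - l) * m \<le> m\<^sup>2 - l\<^sup>2" by (simp add: power2_eq_square algebra_simps)
    then show ?thesis by (simp add: real_sqrt_mult[symmetric])
  qed
  then have "- \<beta> * (sqrt (m - l) * sqrt m) \<le> q \<alpha> \<beta> \<delta> m"
    using qm(1) beta mult_left_mono[of "sqrt (m - l) * sqrt m" "sqrt (m\<^sup>2 - l\<^sup>2)" "- \<beta>"] by linarith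
  then have "- \<beta> * m / q \<alpha> \<beta> \<delta> m \<le> - \<beta> * m / (- \<beta> * (sqrt (m - l) * sqrt m))"
    using m assms(1) beta by (intro divide_left_mono mult_pos_pos) (simp_all add: mult_nonpos_nonneg qm)
  also have "\<dots> = sqrt m / sqrt (m - l)"
  proof -
    define u where "u = sqrt m"
    have u: "u > 0" "m = u * u" using m by (simp_all add: u_def)
    have "m / (sqrt (m - l) * u) = u / sqrt (m - l)" using u(1) by (subst u(2)) simp
    then show ?thesis using beta by (simp add: u_def)
  qed
  finally have 1: "- \<beta> * m / q \<alpha> \<beta> \<delta> m \<le> sqrt m / sqrt (m - l)" .
  have "cmod (branch' \<sigma> m) \<le> \<bar>\<sigma> * \<beta> * m / q \<alpha> \<beta> \<delta> m\<bar> + 1"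
    unfolding branch'_def using cmod_le[of "Complex (\<sigma> * \<beta> * m / q \<alpha> \<beta> \<delta> m) 1"] by simp
  also have "\<bar>\<sigma> * \<beta> * m / q \<alpha> \<beta> \<delta> m\<bar> = - \<beta> * m / q \<alpha> \<beta> \<delta> m"
    using assms(2) beta m qm(2) by (auto simp: abs_mult)
  finally show ?thesis using 1 by simp
qed

text \<open>The second term of \<open>branch_speed\<close> replaces the weight \<open>m\<^sup>-\<^sup>1\<^sup>/\<^sup>2\<close> by \<open>(m - l)\<^sup>-\<^sup>1\<^sup>/\<^sup>2\<close>, and the
result is at most a translate of the integrand that the first term gives.\<close>

lemma branch_hilbert:
  assumes b: "b > 0" and \<sigma>: "\<sigma> = 1 \<or> \<sigma> = - 1"
  shows "(\<integral>\<^sup>+m. ennreal (indicator {l<..} m * (cmod (branch' \<sigma> m) / (sqrt (Im (branch \<sigma> m)) * (Im (branch \<sigma> m) + b)))) \<partial>lborel)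
    \<le> ennreal (2 * pi / sqrt b)"
proof -
  let ?f = "\<lambda>r. ennreal (1 / (sqrt r * (r + b))) * indicator {0<..} r"
  have "(\<integral>\<^sup>+m. ennreal (indicator {l<..} m * (cmod (branch' \<sigma> m) / (sqrt (Im (branch \<sigma> m)) * (Im (branch \<sigma> m) + b)))) \<partial>lborel)
     \<le> (\<integral>\<^sup>+m. ?f m + ?f (m + (- l)) \<partial>lborel)"
  proof (rule nn_integral_mono)
    fix m
    show "ennreal (indicator {l<..} m * (cmod (branch' \<sigma> m) / (sqrt (Im (branch \<sigma> m)) * (Im (branch \<sigma> m) + b)))) \<le> ?f m + ?f (m + (- l))"
    proof (cases "m > l")
      case True
      have m: "m > 0" using True l_pos by simp
      have "cmod (branch' \<sigma> m) / (sqrt m * (m + b)) \<le> (1 + sqrt m / sqrt (m - l)) / (sqrt m * (m + b))"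
        using m b by (intro divide_right_mono branch_speed True \<sigma>) simp
      also have "\<dots> = 1 / (sqrt m * (m + b)) + 1 / (sqrt (m - l) * (m + b))"
        using m b True by (simp add: add_divide_distrib)
      also have "1 / (sqrt (m - l) * (m + b)) \<le> 1 / (sqrt (m - l) * (m - l + b))"
        using True b l_pos by (intro divide_left_mono mult_left_mono mult_pos_pos) simp_all
      finally have "cmod (branch' \<sigma> m) / (sqrt m * (m + b)) \<le> 1 / (sqrt m * (m + b)) + 1 / (sqrt (m - l) * (m - l + b))"
        by simp
      then have "ennreal (cmod (branch' \<sigma> m) / (sqrt m * (m + b))) \<le> ennreal (1 / (sqrt m * (m + b)) + 1 / (sqrt (m - l) * (m - l + b)))"
        by (rule ennreal_leI)
      also have "\<dots> = ennreal (1 / (sqrt m * (m + b))) + ennreal (1 / (sqrt (m - l) * (m - l + b)))"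
        using True m b by (intro ennreal_plus) simp_all
      finally show ?thesis using True m by (simp add: branch_def)
    qed simp
  qed
  also have "\<dots> = (\<integral>\<^sup>+m. ?f m \<partial>lborel) + (\<integral>\<^sup>+m. ?f (m + (- l)) \<partial>lborel)"
    by (rule nn_integral_add) measurable
  also have "(\<integral>\<^sup>+m. ?f (m + (- l)) \<partial>lborel) = (\<integral>\<^sup>+m. ?f m \<partial>lborel)"
    by (rule nn_integral_shift) measurable
  also have "(\<integral>\<^sup>+m. ?f m \<partial>lborel) + (\<integral>\<^sup>+m. ?f m \<partial>lborel) = ennreal (2 * pi / sqrt b)"
    unfolding hilbert_kernel_half[OF b] by (subst ennreal_plus[symmetric]) (use b in simp_all)
  finally show ?thesis .
qed

text \<open>The derivative may fail to exist at the end point \<open>m = l\<close>, which is a null set.\<close>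

lemma branch_curve_integral:
  assumes f: "(\<lambda>m. f (branch \<sigma> m)) \<in> borel_measurable borel"
  shows "curve_integral {l..} (branch \<sigma>) f = (LINT m:{l<..}|lborel. f (branch \<sigma> m) * branch' \<sigma> m)"
proof -
  note [measurable] = f
  let ?v = "\<lambda>m. vector_derivative (branch \<sigma>) (at m)"
  let ?h = "\<lambda>m. indicator {l<..} m *\<^sub>R (f (branch \<sigma> m) * branch' \<sigma> m)"
  have v: "?v m = branch' \<sigma> m" if "m > l" for m
    using branch_deriv[OF that] by (rule vector_derivative_at)
  have e: "indicator {l..} m *\<^sub>R (f (branch \<sigma> m) * ?v m) = (if m = l then f (branch \<sigma> l) * ?v l else ?h m)" for m
    using v[of m] by (auto simp: indicator_def)
  have ae: "AE m in lborel. m \<noteq> l" by (rule AE_lborel_singleton)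
  have "curve_integral {l..} (branch \<sigma>) f = (LINT m|lborel. (if m = l then f (branch \<sigma> l) * ?v l else ?h m))"
    unfolding curve_integral_def set_lebesgue_integral_def e ..
  also have "\<dots> = (LINT m|lborel. ?h m)"
  proof (rule integral_cong_AE)
    show "AE m in lborel. (if m = l then f (branch \<sigma> l) * ?v l else ?h m) = ?h m"
      using ae by eventually_elim simp
  qed simp_all
  finally show ?thesis unfolding set_lebesgue_integral_def .
qed

lemma branch_piece_half_line:
  assumes \<sigma>: "\<sigma> = 1 \<or> \<sigma> = - 1" and s: "s \<ge> 0"
  obtains C where "C \<ge> 0"
    "\<And>j \<psi> t X. boundary_datum s j \<psi> X \<Longrightarrow>
      half_line_bound s (\<lambda>x. curve_integral {l..} (branch \<sigma>) (wave \<alpha> \<beta> \<delta> j \<psi> t x)) (C * X)"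
proof -
  obtain c0 where c0: "c0 > 0" "\<And>k y. y \<ge> l\<^sup>2 / 3 \<Longrightarrow> (cmod (k - of_real centre))\<^sup>2 \<le> 2 * y + \<bar>disc\<bar> / (9 * \<beta>\<^sup>2) \<Longrightarrow>
       cmod ((k - of_real centre)\<^sup>2 - of_real (disc / (9 * \<beta>\<^sup>2))) \<ge> y \<Longrightarrow>
       c0 * (1 + (cmod k)\<^sup>2) \<le> cmod (tau' k)"
    by (rule tau'_lower) blast
  have low: "c0 * (1 + (cmod (branch \<sigma> m))\<^sup>2) \<le> cmod (tau' (branch \<sigma> m))" if "m \<in> {l<..}" for m
  proof (rule c0(2)[of "2 * m\<^sup>2 / 3"])
    have m: "m > l" using that by simp
    have "l\<^sup>2 \<le> m\<^sup>2" using m l_pos by (intro power_mono) simp_all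
    then show "l\<^sup>2 / 3 \<le> 2 * m\<^sup>2 / 3" using zero_le_power2[of m] by linarith
    have s2: "\<sigma>\<^sup>2 = 1" using \<sigma> by auto
    have "(\<sigma> * q \<alpha> \<beta> \<delta> m / (3 * \<beta>))\<^sup>2 = (q \<alpha> \<beta> \<delta> m)\<^sup>2 / (9 * \<beta>\<^sup>2)"
      using s2 by (simp add: power_divide power_mult_distrib)
    also have "\<dots> = m\<^sup>2 / 3 + disc / (9 * \<beta>\<^sup>2)"
      using beta m by (simp add: q_sq add_divide_distrib)
    finally have q2: "(\<sigma> * q \<alpha> \<beta> \<delta> m / (3 * \<beta>))\<^sup>2 = m\<^sup>2 / 3 + disc / (9 * \<beta>\<^sup>2)" .
    have "disc / (9 * \<beta>\<^sup>2) \<le> \<bar>disc\<bar> / (9 * \<beta>\<^sup>2)" by (intro divide_right_mono) simp_all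
    then show "(cmod (branch \<sigma> m - of_real centre))\<^sup>2 \<le> 2 * (2 * m\<^sup>2 / 3) + \<bar>disc\<bar> / (9 * \<beta>\<^sup>2)"
      unfolding branch_minus_centre cmod_power2 complex.sel q2 by linarith
    have "Re ((branch \<sigma> m - of_real centre)\<^sup>2 - of_real (disc / (9 * \<beta>\<^sup>2)))
       = (\<sigma> * q \<alpha> \<beta> \<delta> m / (3 * \<beta>))\<^sup>2 - m\<^sup>2 - disc / (9 * \<beta>\<^sup>2)"
      unfolding branch_minus_centre by (simp only: minus_complex.sel Re_power2 complex.sel Re_complex_of_real)
    then have "\<bar>Re ((branch \<sigma> m - of_real centre)\<^sup>2 - of_real (disc / (9 * \<beta>\<^sup>2)))\<bar> = 2 * m\<^sup>2 / 3"
      unfolding q2 by simp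
    then show "2 * m\<^sup>2 / 3 \<le> cmod ((branch \<sigma> m - of_real centre)\<^sup>2 - of_real (disc / (9 * \<beta>\<^sup>2)))"
      using abs_Re_le_cmod by metis
  qed
  obtain C where C: "C \<ge> 0"
    "\<And>j \<psi> t X. boundary_datum s j \<psi> X \<Longrightarrow>
      curve_norm_sq s {l<..} (branch \<sigma>) (branch' \<sigma>) (\<lambda>m. Defs.density \<alpha> \<beta> \<delta> j \<psi> t (branch \<sigma> m)) \<le> ennreal ((C * X)\<^sup>2)"
  proof (rule curve_energy[where I="{l<..}" and \<gamma>="branch \<sigma>" and \<gamma>'="branch' \<sigma>" and s=s, OF _ _ _ _ _ _ _ c0(1) low s])
    show "branch' \<sigma> m \<noteq> 0" for m by (simp add: branch'_def complex_eq_iff)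
    show "Im (tau (branch \<sigma> m)) = 0" if "m \<in> {l<..}" for m
      using branch_tau_real[OF _ \<sigma>, of m] that by simp
    show "is_interval {l<..}" by (simp add: is_interval_1)
  qed (use that branch_deriv in auto)
  define A where "A = sqrt (3 * \<beta>\<^sup>2 + \<bar>disc\<bar> / l\<^sup>2) / (3 * \<bar>\<beta>\<bar>)"
  have A: "A \<ge> 0" by (simp add: A_def)
  obtain D where D: "D \<ge> 0"
    "\<And>g Y. g \<in> borel_measurable borel \<Longrightarrow> Y \<ge> 0 \<Longrightarrow>
      curve_norm_sq s {l<..} (branch \<sigma>) (branch' \<sigma>) g \<le> ennreal (Y\<^sup>2) \<Longrightarrow>
      half_line_bound s (\<lambda>x. LINT m:{l<..}|lborel. exp (\<i> * branch \<sigma> m * of_real x) * g m * branch' \<sigma> m) (D * Y)"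
  proof (rule curve_superposition_half_line[where I="{l<..}" and \<gamma>="branch \<sigma>" and \<gamma>'="branch' \<sigma>" and c=centre and A=A and B="2 * pi" and s=s])
    show "Im (branch \<sigma> m) > 0" if "m \<in> {l<..}" for m using that l_pos by (simp add: branch_def)
    show "\<bar>Re (branch \<sigma> m) - centre\<bar> \<le> A * Im (branch \<sigma> m)" if "m \<in> {l<..}" for m
      using branch_cone[OF _ \<sigma>, of m] that by (simp add: A_def branch_def)
    show "(\<integral>\<^sup>+m. ennreal (indicator {l<..} m * (cmod (branch' \<sigma> m) / (sqrt (Im (branch \<sigma> m)) * (Im (branch \<sigma> m) + b)))) \<partial>lborel)
      \<le> ennreal (2 * pi / sqrt b)" if "b > 0" for b
      by (rule branch_hilbert[OF that \<sigma>])
  qed (use that A s in auto)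
  show thesis
  proof (rule that[of "D * C"])
    show "D * C \<ge> 0" using C D by simp
    fix j \<psi> t and X :: real
    assume dat: "boundary_datum s j \<psi> X"
    note j = boundary_datumD(1)[OF dat] and \<psi> = boundary_datumD(2)[OF dat]
      and X = boundary_datumD(3)[OF dat] and b = boundary_datumD(4)[OF dat]
    have [measurable]: "\<psi> \<in> borel_measurable borel" using \<psi> by auto
    have [measurable]: "Defs.density \<alpha> \<beta> \<delta> j \<psi> t \<in> borel_measurable borel" by (rule density_measurable) simp
    have "half_line_bound s (\<lambda>x. LINT m:{l<..}|lborel. exp (\<i> * branch \<sigma> m * of_real x) * Defs.density \<alpha> \<beta> \<delta> j \<psi> t (branch \<sigma> m) * branch' \<sigma> m) (D * (C * X))"
      by (rule D(2)[OF _ _ C(2)[OF dat]]) (use C X in simp_all)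
    then show "half_line_bound s (\<lambda>x. curve_integral {l..} (branch \<sigma>) (wave \<alpha> \<beta> \<delta> j \<psi> t x)) (D * C * X)"
      by (subst branch_curve_integral) (simp_all add: mult.assoc)
  qed
qed

definition segment :: "real \<Rightarrow> real \<Rightarrow> complex" where
  "segment a m = Complex a m"

lemma gamma2_eq: "gamma2 \<alpha> \<beta> \<delta> l = segment (c1 \<alpha> \<beta> \<delta> l)" and gamma5_eq: "gamma5 \<alpha> \<beta> \<delta> l = segment (c2 \<alpha> \<beta> \<delta> l)"
  by (auto simp: gamma2_def gamma5_def segment_def)

lemma segment_curve_integral:
  "curve_integral S (segment a) f = (LINT m:S|lborel. f (segment a m) * \<i>)"
proof -
  have "(segment a has_vector_derivative 0 + \<i> * of_real 1) (at m)" for m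
    unfolding segment_def[abs_def] Complex_eq
    by (rule has_vector_derivative_add[OF has_vector_derivative_const
          has_vector_derivative_mult_right[OF has_vector_derivative_of_real[OF DERIV_ident]]])
  then have "vector_derivative (segment a) (at m) = \<i>" for m
    using vector_derivative_at by fastforce
  then show ?thesis unfolding curve_integral_def by simp
qed

text \<open>For bounded \<open>k\<close> the symbol is bounded, so the time factor and the transform of the datum each grow at
most exponentially in \<open>T\<close>; \<open>\<Lambda>\<close> is twice the bound of the symbol.\<close>

lemma density_bound_bounded_frequencies:
  obtains C \<Lambda> where "C \<ge> 0" "\<Lambda> \<ge> 0"
    "\<And>j \<psi> t T X k. j \<le> 1 \<Longrightarrow> 0 \<le> t \<Longrightarrow> t \<le> T \<Longrightarrow> compact_datum T \<psi> X \<Longrightarrow> cmod k \<le> R \<Longrightarrow>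
      cmod (Defs.density \<alpha> \<beta> \<delta> j \<psi> t k) \<le> C * (exp (\<Lambda> * T) * sqrt T * X)"
proof -
  obtain Kp where Kp: "Kp > 0" "\<And>j k. j \<le> 1 \<Longrightarrow> (cmod (phi \<alpha> \<beta> \<delta> j k))\<^sup>2 \<le> Kp * (1 + (cmod k)\<^sup>2) ^ (2 - j)"
    using phi_growth by blast
  define R' where "R' = max R 0"
  define \<Lambda> where "\<Lambda> = \<bar>\<beta>\<bar> * R' ^ 3 + \<bar>\<alpha>\<bar> * R'\<^sup>2 + \<bar>\<delta>\<bar> * R'"
  define C where "C = sqrt (Kp * (1 + R'\<^sup>2)\<^sup>2)"
  have R': "R' \<ge> 0" by (simp add: R'_def)
  have \<Lambda>: "\<Lambda> \<ge> 0" using R' by (simp add: \<Lambda>_def)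
  show thesis
  proof (rule that[of C "2 * \<Lambda>"])
    show "C \<ge> 0" "2 * \<Lambda> \<ge> 0" using Kp(1) \<Lambda> by (simp_all add: C_def)
    fix j \<psi> k and t T X :: real
    assume j: "j \<le> (1::nat)" and t: "0 \<le> t" "t \<le> T" and dat: "compact_datum T \<psi> X" and k: "cmod k \<le> R"
    note \<psi> = compact_datumD[OF dat]
    have kR: "cmod k \<le> R'" using k by (simp add: R'_def)
    have "cmod (omega \<alpha> \<beta> \<delta> k) \<le> \<bar>\<beta>\<bar> * cmod k ^ 3 + \<bar>\<alpha>\<bar> * (cmod k)\<^sup>2 + \<bar>\<delta>\<bar> * cmod k"
      unfolding omega_def
      using norm_triangle_ineq[of "- \<i> * of_real \<beta> * k ^ 3 + \<i> * of_real \<alpha> * k\<^sup>2" "\<i> * of_real \<delta> * k"]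
        norm_triangle_ineq[of "- \<i> * of_real \<beta> * k ^ 3" "\<i> * of_real \<alpha> * k\<^sup>2"]
      by (simp add: norm_mult norm_power)
    also have "\<dots> \<le> \<Lambda>"
      unfolding \<Lambda>_def using kR by (intro add_mono mult_left_mono power_mono) simp_all
    finally have om: "cmod (omega \<alpha> \<beta> \<delta> k) \<le> \<Lambda>" .
    have T: "T \<ge> 0" using t by simp
    have e1: "cmod (exp (- omega \<alpha> \<beta> \<delta> k * of_real t)) \<le> exp (\<Lambda> * T)"
    proof -
      have "cmod (exp (- omega \<alpha> \<beta> \<delta> k * of_real t)) \<le> exp (cmod (- omega \<alpha> \<beta> \<delta> k * of_real t))"
        by (rule norm_exp)
      also have "cmod (- omega \<alpha> \<beta> \<delta> k * of_real t) = cmod (omega \<alpha> \<beta> \<delta> k) * t" using t by (simp add: norm_mult)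
      also have "cmod (omega \<alpha> \<beta> \<delta> k) * t \<le> \<Lambda> * T" using om t \<Lambda> by (intro mult_mono) simp_all
      finally show ?thesis by simp
    qed
    have e2: "cmod (phi \<alpha> \<beta> \<delta> j k) \<le> C"
    proof -
      have "(cmod (phi \<alpha> \<beta> \<delta> j k))\<^sup>2 \<le> Kp * (1 + (cmod k)\<^sup>2) ^ (2 - j)" by (rule Kp(2)[OF j])
      also have "\<dots> \<le> Kp * (1 + (cmod k)\<^sup>2) ^ 2"
        using Kp(1) by (intro mult_left_mono power_increasing) simp_all
      also have "\<dots> \<le> Kp * (1 + R'\<^sup>2) ^ 2"
        using Kp(1) kR by (intro mult_left_mono power_mono add_left_mono) simp_all
      finally show ?thesis unfolding C_def by (rule real_le_rsqrt)
    qed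
    have e3: "cmod (fourier \<psi> (\<i> * omega \<alpha> \<beta> \<delta> k)) \<le> exp (\<Lambda> * T) * sqrt T * X"
    proof -
      have "cmod (fourier \<psi> (\<i> * omega \<alpha> \<beta> \<delta> k)) \<le> exp (cmod (\<i> * omega \<alpha> \<beta> \<delta> k) * T) * sqrt T * X"
        by (rule fourier_compact_support_bound[OF \<psi>(1,2) T \<psi>(3,4)])
      also have "\<dots> \<le> exp (\<Lambda> * T) * sqrt T * X"
        using om T \<psi>(4) by (intro mult_right_mono) (simp_all add: norm_mult mult_right_mono)
      finally show ?thesis .
    qed
    have "cmod (Defs.density \<alpha> \<beta> \<delta> j \<psi> t k) \<le> exp (\<Lambda> * T) * C * (exp (\<Lambda> * T) * sqrt T * X)"
      unfolding Defs.density_def norm_mult using \<open>C \<ge> 0\<close> by (intro mult_mono e1 e2 e3) simp_all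
    also have "\<dots> = C * ((exp (\<Lambda> * T) * exp (\<Lambda> * T)) * sqrt T * X)" by (simp only: mult_ac)
    also have "exp (\<Lambda> * T) * exp (\<Lambda> * T) = exp (2 * \<Lambda> * T)" by (simp add: exp_add[symmetric])
    finally show "cmod (Defs.density \<alpha> \<beta> \<delta> j \<psi> t k) \<le> C * (exp (2 * \<Lambda> * T) * sqrt T * X)" .
  qed
qed

text \<open>A segment of length \<open>l\<close> with a bounded amplitude: the weighted norm is at most the supremum times
\<open>sqrt l\<close> up to a constant. The cone degenerates to a vertical line.\<close>

lemma segment_piece_half_line:
  assumes s: "s \<ge> 0"
  obtains C \<Lambda> where "C \<ge> 0" "\<Lambda> \<ge> 0"
    "\<And>j \<psi> t T X. j \<le> 1 \<Longrightarrow> 0 \<le> t \<Longrightarrow> t \<le> T \<Longrightarrow> compact_datum T \<psi> X \<Longrightarrow>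
      half_line_bound s (\<lambda>x. curve_integral {0<..<l} (segment a) (wave \<alpha> \<beta> \<delta> j \<psi> t x))
        (C * (exp (\<Lambda> * T) * sqrt T * X))"
proof -
  define R where "R = \<bar>a\<bar> + l"
  have R: "cmod (segment a m) \<le> R" if "m \<in> {0<..<l}" for m
    using cmod_le[of "segment a m"] that by (simp add: segment_def R_def)
  obtain C \<Lambda> where C: "C \<ge> 0" "\<Lambda> \<ge> 0"
    "\<And>j \<psi> t T X k. j \<le> 1 \<Longrightarrow> 0 \<le> t \<Longrightarrow> t \<le> T \<Longrightarrow> compact_datum T \<psi> X \<Longrightarrow> cmod k \<le> R \<Longrightarrow>
      cmod (Defs.density \<alpha> \<beta> \<delta> j \<psi> t k) \<le> C * (exp (\<Lambda> * T) * sqrt T * X)"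
    by (rule density_bound_bounded_frequencies[of R]) blast
  have [measurable]: "segment a \<in> borel_measurable borel"
    unfolding segment_def[abs_def] Complex_eq by measurable
  obtain D where D: "D \<ge> 0"
    "\<And>g Y. g \<in> borel_measurable borel \<Longrightarrow> Y \<ge> 0 \<Longrightarrow>
      curve_norm_sq s {0<..<l} (segment a) (\<lambda>_. \<i>) g \<le> ennreal (Y\<^sup>2) \<Longrightarrow>
      half_line_bound s (\<lambda>x. LINT m:{0<..<l}|lborel. exp (\<i> * segment a m * of_real x) * g m * \<i>) (D * Y)"
  proof (rule curve_superposition_half_line[where I="{0<..<l}" and \<gamma>="segment a" and \<gamma>'="\<lambda>_. \<i>" and c=a and A=0 and B=pi and s=s])
    fix b :: real assume b: "b > 0"
    have "(\<integral>\<^sup>+m. ennreal (indicator {0<..<l} m * (cmod \<i> / (sqrt (Im (segment a m)) * (Im (segment a m) + b)))) \<partial>lborel)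
      \<le> (\<integral>\<^sup>+r. ennreal (1 / (sqrt r * (r + b))) * indicator {0<..} r \<partial>lborel)"
      by (intro nn_integral_mono) (auto simp: segment_def indicator_def)
    then show "(\<integral>\<^sup>+m. ennreal (indicator {0<..<l} m * (cmod \<i> / (sqrt (Im (segment a m)) * (Im (segment a m) + b)))) \<partial>lborel)
      \<le> ennreal (pi / sqrt b)" unfolding hilbert_kernel_half[OF b] .
  qed (use that s in \<open>auto simp: segment_def\<close>)
  define Q where "Q = l * (1 + R\<^sup>2) powr s"
  have Q: "Q \<ge> 0" using l_pos by (simp add: Q_def)
  show thesis
  proof (rule that[of "D * (sqrt Q * C)" \<Lambda>])
    show "D * (sqrt Q * C) \<ge> 0" "\<Lambda> \<ge> 0" using C D Q by simp_all
    fix j \<psi> and t T X :: real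
    assume j: "j \<le> (1::nat)" and t: "0 \<le> t" "t \<le> T" and dat: "compact_datum T \<psi> X"
    note \<psi> = compact_datumD[OF dat]
    have [measurable]: "\<psi> \<in> borel_measurable borel" using \<psi>(1) by (simp add: square_integrable_def)
    have [measurable]: "Defs.density \<alpha> \<beta> \<delta> j \<psi> t \<in> borel_measurable borel" by (rule density_measurable) simp
    define Z where "Z = C * (exp (\<Lambda> * T) * sqrt T * X)"
    have Z: "Z \<ge> 0" using C \<psi>(4) t by (simp add: Z_def)
    have "curve_norm_sq s {0<..<l} (segment a) (\<lambda>_. \<i>) (\<lambda>m. Defs.density \<alpha> \<beta> \<delta> j \<psi> t (segment a m))
      \<le> (\<integral>\<^sup>+m. ennreal ((1 + R\<^sup>2) powr s * Z\<^sup>2) * indicator {0<..<l} m \<partial>lborel)"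
    proof (rule nn_integral_mono)
      fix m
      show "ennreal (indicator {0<..<l} m * ((1 + (cmod (segment a m))\<^sup>2) powr s *
        (cmod (Defs.density \<alpha> \<beta> \<delta> j \<psi> t (segment a m)))\<^sup>2 * cmod \<i>)) \<le> ennreal ((1 + R\<^sup>2) powr s * Z\<^sup>2) * indicator {0<..<l} m"
      proof (cases "m \<in> {0<..<l}")
        case True
        have "(1 + (cmod (segment a m))\<^sup>2) powr s \<le> (1 + R\<^sup>2) powr s"
          using R[OF True] s by (intro powr_mono2 add_left_mono power_mono) simp_all
        moreover have "(cmod (Defs.density \<alpha> \<beta> \<delta> j \<psi> t (segment a m)))\<^sup>2 \<le> Z\<^sup>2"
          unfolding Z_def by (intro power_mono C(3) j t dat R True) simp
        ultimately have "(1 + (cmod (segment a m))\<^sup>2) powr s * (cmod (Defs.density \<alpha> \<beta> \<delta> j \<psi> t (segment a m)))\<^sup>2 \<le> (1 + R\<^sup>2) powr s * Z\<^sup>2"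
          by (intro mult_mono) simp_all
        then show ?thesis using True by (simp add: ennreal_leI)
      qed simp
    qed
    also have "\<dots> = ennreal ((1 + R\<^sup>2) powr s * Z\<^sup>2) * ennreal l"
      using l_pos by (subst nn_integral_cmult_indicator) simp_all
    also have "\<dots> = ennreal ((sqrt Q * Z)\<^sup>2)"
      using Q l_pos by (simp add: ennreal_mult'[symmetric] power_mult_distrib) (simp add: Q_def mult_ac)
    finally have b: "curve_norm_sq s {0<..<l} (segment a) (\<lambda>_. \<i>) (\<lambda>m. Defs.density \<alpha> \<beta> \<delta> j \<psi> t (segment a m)) \<le> ennreal ((sqrt Q * Z)\<^sup>2)" .
    have "half_line_bound s (\<lambda>x. LINT m:{0<..<l}|lborel. exp (\<i> * segment a m * of_real x) * Defs.density \<alpha> \<beta> \<delta> j \<psi> t (segment a m) * \<i>) (D * (sqrt Q * Z))"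
      by (rule D(2)[OF _ _ b]) (use Q Z in simp_all)
    then show "half_line_bound s (\<lambda>x. curve_integral {0<..<l} (segment a) (wave \<alpha> \<beta> \<delta> j \<psi> t x))
        (D * (sqrt Q * C) * (exp (\<Lambda> * T) * sqrt T * X))"
      unfolding segment_curve_integral by (simp add: Z_def mult.assoc)
  qed
qed

text \<open>The two levels of sums cost a factor \<open>4\<close> by \<open>half_line_bound_add\<close>, which \<open>8\<close> covers.\<close>

lemma nonreal_half_line:
  assumes s: "s \<ge> 0"
  obtains C \<Lambda> where "C \<ge> 0" "\<Lambda> \<ge> 0"
    "\<And>j \<psi> t T X. 0 \<le> t \<Longrightarrow> t \<le> T \<Longrightarrow> boundary_datum s j \<psi> X \<Longrightarrow> compact_datum T \<psi> X \<Longrightarrow>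
      half_line_bound s (\<lambda>x. nonreal_integral \<alpha> \<beta> \<delta> l (wave \<alpha> \<beta> \<delta> j \<psi> t x))
        (C * ((1 + exp (\<Lambda> * T) * sqrt T) * X))"
proof -
  obtain C3 where C3: "C3 \<ge> 0"
    "\<And>j \<psi> t X. boundary_datum s j \<psi> X \<Longrightarrow>
      half_line_bound s (\<lambda>x. curve_integral {l..} (branch 1) (wave \<alpha> \<beta> \<delta> j \<psi> t x)) (C3 * X)"
    by (rule branch_piece_half_line[OF disjI1[OF refl] s]) blast
  obtain C4 where C4: "C4 \<ge> 0"
    "\<And>j \<psi> t X. boundary_datum s j \<psi> X \<Longrightarrow>
      half_line_bound s (\<lambda>x. curve_integral {l..} (branch (- 1)) (wave \<alpha> \<beta> \<delta> j \<psi> t x)) (C4 * X)"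
    by (rule branch_piece_half_line[OF disjI2[OF refl] s]) blast
  obtain C2 L2 where C2: "C2 \<ge> 0" "L2 \<ge> 0"
    "\<And>j \<psi> t T X. j \<le> 1 \<Longrightarrow> 0 \<le> t \<Longrightarrow> t \<le> T \<Longrightarrow> compact_datum T \<psi> X \<Longrightarrow>
      half_line_bound s (\<lambda>x. curve_integral {0<..<l} (segment (c1 \<alpha> \<beta> \<delta> l)) (wave \<alpha> \<beta> \<delta> j \<psi> t x))
        (C2 * (exp (L2 * T) * sqrt T * X))"
    by (rule segment_piece_half_line[OF s, of "c1 \<alpha> \<beta> \<delta> l"]) blast
  obtain C5 L5 where C5: "C5 \<ge> 0" "L5 \<ge> 0"
    "\<And>j \<psi> t T X. j \<le> 1 \<Longrightarrow> 0 \<le> t \<Longrightarrow> t \<le> T \<Longrightarrow> compact_datum T \<psi> X \<Longrightarrow>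
      half_line_bound s (\<lambda>x. curve_integral {0<..<l} (segment (c2 \<alpha> \<beta> \<delta> l)) (wave \<alpha> \<beta> \<delta> j \<psi> t x))
        (C5 * (exp (L5 * T) * sqrt T * X))"
    by (rule segment_piece_half_line[OF s, of "c2 \<alpha> \<beta> \<delta> l"]) blast
  define C where "C = 8 * (C2 + C3 + C4 + C5)"
  define \<Lambda> where "\<Lambda> = L2 + L5"
  show thesis
  proof (rule that[of C \<Lambda>])
    show "C \<ge> 0" "\<Lambda> \<ge> 0" using C2 C3 C4 C5 by (simp_all add: C_def \<Lambda>_def)
    fix j \<psi> and t T X :: real
    assume t: "0 \<le> t" "t \<le> T" and dat: "boundary_datum s j \<psi> X" and cdat: "compact_datum T \<psi> X"
    note j = boundary_datumD(1)[OF dat] and X = boundary_datumD(3)[OF dat]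
    let ?f = "\<lambda>x k. exp (\<i> * k * of_real x) * Defs.density \<alpha> \<beta> \<delta> j \<psi> t k"
    let ?E = "exp (\<Lambda> * T) * sqrt T * X"
    note h3 = C3(2)[OF dat, of t]
    note h4 = half_line_bound_cmult[OF C4(2)[OF dat, of t], of "- 1"]
    note h2 = C2(3)[OF j t cdat]
    note h5 = half_line_bound_cmult[OF C5(3)[OF j t cdat], of "- 1"]
    have T: "T \<ge> 0" using t by simp
    have E0: "?E \<ge> 0" using T X by simp
    have le: "exp (L * T) * sqrt T * X \<le> ?E" if "L \<le> \<Lambda>" for L
      using that T X by (intro mult_right_mono) (simp_all add: mult_right_mono)
    have le2: "C2 * (exp (L2 * T) * sqrt T * X) \<le> C2 * ?E"
      by (rule mult_left_mono[OF le C2(1)]) (simp add: \<Lambda>_def C5(2))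
    have le5: "C5 * (exp (L5 * T) * sqrt T * X) \<le> C5 * ?E"
      by (rule mult_left_mono[OF le C5(1)]) (simp add: \<Lambda>_def C2(2))
    have nn: "C2 * X \<ge> 0" "C3 * X \<ge> 0" "C4 * X \<ge> 0" "C5 * X \<ge> 0" "C2 * ?E \<ge> 0" "C3 * ?E \<ge> 0" "C4 * ?E \<ge> 0" "C5 * ?E \<ge> 0"
      using C2(1) C3(1) C4(1) C5(1) X E0 by (simp_all del: mult_nonneg_nonneg add: mult_nonneg_nonneg)
    have split: "C * ((1 + exp (\<Lambda> * T) * sqrt T) * X) = 8 * (C2 * X + C3 * X + C4 * X + C5 * X) + 8 * (C2 * ?E + C3 * ?E + C4 * ?E + C5 * ?E)"
      unfolding C_def by (simp only: distrib_right distrib_left mult.assoc mult_1_left)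
    show "half_line_bound s (\<lambda>x. nonreal_integral \<alpha> \<beta> \<delta> l (?f x)) (C * ((1 + exp (\<Lambda> * T) * sqrt T) * X))"
    proof (cases "\<alpha>\<^sup>2 + 3 * \<beta> * \<delta> \<ge> 0")
      case True
      have "half_line_bound s (\<lambda>x. (curve_integral {0<..<l} (segment (c1 \<alpha> \<beta> \<delta> l)) (?f x) + curve_integral {l..} (branch 1) (?f x))
         + ((- 1) * curve_integral {l..} (branch (- 1)) (?f x) + (- 1) * curve_integral {0<..<l} (segment (c2 \<alpha> \<beta> \<delta> l)) (?f x)))
         (2 * (2 * (C2 * (exp (L2 * T) * sqrt T * X) + C3 * X) + 2 * (cmod (- 1) * (C4 * X) + cmod (- 1) * (C5 * (exp (L5 * T) * sqrt T * X)))))"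
        by (rule half_line_bound_add[OF half_line_bound_add[OF h2 h3] half_line_bound_add[OF h4 h5]])
      then show ?thesis
      proof (rule half_line_bound_cong)
        show "2 * (2 * (C2 * (exp (L2 * T) * sqrt T * X) + C3 * X) + 2 * (cmod (- 1) * (C4 * X) + cmod (- 1) * (C5 * (exp (L5 * T) * sqrt T * X))))
          \<le> C * ((1 + exp (\<Lambda> * T) * sqrt T) * X)"
          unfolding split norm_minus_cancel norm_one mult_1_left distrib_left using le2 le5 nn by linarith
      qed (use True in \<open>simp add: nonreal_integral_def gamma2_eq gamma3_eq gamma4_eq gamma5_eq\<close>)
    next
      case False
      have "half_line_bound s (\<lambda>x. curve_integral {l..} (branch 1) (?f x) + (- 1) * curve_integral {l..} (branch (- 1)) (?f x))
         (2 * (C3 * X + cmod (- 1) * (C4 * X)))"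
        by (rule half_line_bound_add[OF h3 h4])
      then show ?thesis
      proof (rule half_line_bound_cong)
        show "2 * (C3 * X + cmod (- 1) * (C4 * X)) \<le> C * ((1 + exp (\<Lambda> * T) * sqrt T) * X)"
          unfolding split norm_minus_cancel norm_one mult_1_left distrib_left using nn by linarith
      qed (use False in \<open>simp add: nonreal_integral_def gamma3_eq gamma4_eq\<close>)
    qed
  qed
qed

end

theorem theorem3p1:
  fixes \<alpha> \<beta> \<delta> s l :: real
  assumes "\<beta> < 0" and "s \<ge> 0" and "admissible_l \<alpha> \<beta> \<delta> l"
  shows "\<exists>C c :: real. \<forall>(T' :: real) (\<psi> :: nat \<Rightarrow> real \<Rightarrow> complex) (v :: real \<Rightarrow> real \<Rightarrow> complex).
     T' > 0 \<longrightarrow>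
     \<psi> 0 \<in> sobolev ((s + 1) / 3) \<longrightarrow> \<psi> 1 \<in> sobolev (s / 3) \<longrightarrow>
     ess_support (\<psi> 0) \<subseteq> {0..T'} \<longrightarrow> ess_support (\<psi> 1) \<subseteq> {0..T'} \<longrightarrow>
     (\<forall>t\<in>{0..T'}. represented \<alpha> \<beta> \<delta> l \<psi> t (\<lambda>x. v x t)) \<longrightarrow>
     (\<forall>t\<in>{0..T'}.
        (\<lambda>x. v x t) \<in> sobolev_half_line s \<and>
        sobolev_half_line_norm s (\<lambda>x. v x t)
          \<le> C * (1 + exp (c * T') * sqrt T') *
             (\<Sum>b=0..1. sobolev_norm ((s + 1 - real b) / 3) (\<psi> b)))"
proof -
  interpret dispersion \<alpha> \<beta> \<delta> l by unfold_locales (fact assms)+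
  have s: "s \<ge> 0" by fact
  have pt: "AE t in lborel. t \<noteq> a" for a :: real by (rule AE_lborel_singleton)
  obtain C1 where C1: "C1 \<ge> 0"
    "\<And>j \<psi> t X w. boundary_datum s j \<psi> X \<Longrightarrow>
      is_L2_inv_fourier (\<lambda>k. indicator {..c1 \<alpha> \<beta> \<delta> l} k *\<^sub>R Defs.density \<alpha> \<beta> \<delta> j \<psi> t (of_real k)) w \<Longrightarrow>
      half_line_bound s w (C1 * X)"
  proof (rule real_piece_half_line[where I="{..<c1 \<alpha> \<beta> \<delta> l}" and S="{..c1 \<alpha> \<beta> \<delta> l}" and s=s])
    show "AE t in lborel. (t \<in> {..c1 \<alpha> \<beta> \<delta> l}) = (t \<in> {..<c1 \<alpha> \<beta> \<delta> l})"
      using pt[of "c1 \<alpha> \<beta> \<delta> l"] by eventually_elim auto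
  qed (use that far_left s in \<open>auto simp: is_interval_1\<close>)
  obtain C6 where C6: "C6 \<ge> 0"
    "\<And>j \<psi> t X w. boundary_datum s j \<psi> X \<Longrightarrow>
      is_L2_inv_fourier (\<lambda>k. indicator {c2 \<alpha> \<beta> \<delta> l..} k *\<^sub>R Defs.density \<alpha> \<beta> \<delta> j \<psi> t (of_real k)) w \<Longrightarrow>
      half_line_bound s w (C6 * X)"
  proof (rule real_piece_half_line[where I="{c2 \<alpha> \<beta> \<delta> l<..}" and S="{c2 \<alpha> \<beta> \<delta> l..}" and s=s])
    show "AE t in lborel. (t \<in> {c2 \<alpha> \<beta> \<delta> l..}) = (t \<in> {c2 \<alpha> \<beta> \<delta> l<..})"
      using pt[of "c2 \<alpha> \<beta> \<delta> l"] by eventually_elim auto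
  qed (use that far_right s in \<open>auto simp: is_interval_1\<close>)
  obtain CN \<Lambda> where CN: "CN \<ge> 0" "\<Lambda> \<ge> 0"
    "\<And>j \<psi> t T X. 0 \<le> t \<Longrightarrow> t \<le> T \<Longrightarrow> boundary_datum s j \<psi> X \<Longrightarrow> compact_datum T \<psi> X \<Longrightarrow>
      half_line_bound s (\<lambda>x. nonreal_integral \<alpha> \<beta> \<delta> l (wave \<alpha> \<beta> \<delta> j \<psi> t x))
        (CN * ((1 + exp (\<Lambda> * T) * sqrt T) * X))"
    by (rule nonreal_half_line[OF s]) blast
  define H where "H = 2 * (2 * (C1 + C6) + CN)"
  show ?thesis
  proof (rule exI[of _ "2 * H"], rule exI[of _ \<Lambda>], intro allI impI ballI)
    fix T' :: real and \<psi> :: "nat \<Rightarrow> real \<Rightarrow> complex" and v :: "real \<Rightarrow> real \<Rightarrow> complex" and t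
    assume T': "T' > 0" and \<psi>0: "\<psi> 0 \<in> sobolev ((s + 1) / 3)" and \<psi>1: "\<psi> 1 \<in> sobolev (s / 3)"
      and supp0: "ess_support (\<psi> 0) \<subseteq> {0..T'}" and supp1: "ess_support (\<psi> 1) \<subseteq> {0..T'}"
      and rep: "\<forall>t\<in>{0..T'}. represented \<alpha> \<beta> \<delta> l \<psi> t (\<lambda>x. v x t)" and t: "t \<in> {0..T'}"
    let ?N = "\<lambda>j. sobolev_norm ((s + 1 - real j) / 3) (\<psi> j)"
    let ?e = "1 + exp (\<Lambda> * T') * sqrt T'"
    let ?nr = "\<lambda>j x. nonreal_integral \<alpha> \<beta> \<delta> l (wave \<alpha> \<beta> \<delta> j (\<psi> j) t x)"
    obtain w1 w6 :: "nat \<Rightarrow> real \<Rightarrow> complex" where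
      w1: "\<And>j. j \<in> {0..1} \<Longrightarrow> is_L2_inv_fourier
             (\<lambda>k. indicator {..c1 \<alpha> \<beta> \<delta> l} k *\<^sub>R Defs.density \<alpha> \<beta> \<delta> j (\<psi> j) t (of_real k)) (w1 j)"
      and w6: "\<And>j. j \<in> {0..1} \<Longrightarrow> is_L2_inv_fourier
             (\<lambda>k. indicator {c2 \<alpha> \<beta> \<delta> l..} k *\<^sub>R Defs.density \<alpha> \<beta> \<delta> j (\<psi> j) t (of_real k)) (w6 j)"
      and u: "AE x in lborel. x > 0 \<longrightarrow>
           v x t = (\<Sum>j=0..1. w1 j x + w6 j x + 1 / (2 * of_real pi) * ?nr j x)"
      using rep t unfolding represented_def by blast
    have e1: "?e \<ge> 1" using T' by simp
    have N0: "?N j \<ge> 0" for j by (rule sobolev_norm_nonneg)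
    have piece: "half_line_bound s (\<lambda>x. w1 j x + w6 j x + 1 / (2 * of_real pi) * ?nr j x) (H * (?e * ?N j))"
      if j: "j \<in> {0..1}" for j
    proof -
      have j1: "j \<le> 1" using j by simp
      have sob: "\<psi> j \<in> sobolev ((s + 1 - real j) / 3)"
        using \<psi>0 \<psi>1 j1 by (cases "j = 0") (simp_all add: le_Suc_eq)
      have "ess_support (\<psi> j) \<subseteq> {0..T'}"
        using supp0 supp1 j1 by (cases "j = 0") (simp_all add: le_Suc_eq)
      then have supp: "AE x in lborel. x \<notin> {0..T'} \<longrightarrow> \<psi> j x = 0" by (rule ess_support_AE)
      have r: "(s + 1 - real j) / 3 \<ge> 0" using s j1 by simp
      note cs = sobolev_compact_support[OF sob r supp]
      have dat: "boundary_datum s j (\<psi> j) (?N j)"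
        unfolding boundary_datum_def using j1 cs(1,3) N0[of j] by simp
      have cdat: "compact_datum T' (\<psi> j) (?N j)"
        unfolding compact_datum_def using cs(2,4) supp N0[of j] by simp
      have h1: "half_line_bound s (w1 j) (C1 * ?N j)"
        by (rule C1(2)[OF dat w1[OF j]])
      have h6: "half_line_bound s (w6 j) (C6 * ?N j)"
        by (rule C6(2)[OF dat w6[OF j]])
      have hN: "half_line_bound s (?nr j) (CN * (?e * ?N j))"
        by (rule CN(3)[OF _ _ dat cdat]) (use t in simp_all)
      have "half_line_bound s (\<lambda>x. w1 j x + w6 j x + 1 / (2 * of_real pi) * ?nr j x)
         (2 * (2 * (C1 * ?N j + C6 * ?N j) + cmod (1 / (2 * of_real pi)) * (CN * (?e * ?N j))))"
        by (rule half_line_bound_add[OF half_line_bound_add[OF h1 h6] half_line_bound_cmult[OF hN]])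
      then show ?thesis
      proof (rule half_line_bound_cong)
        have NE: "?N j \<le> ?e * ?N j" using mult_right_mono[OF e1 N0[of j]] by simp
        have "cmod (1 / (2 * of_real pi)) \<le> 1" using pi_gt3 by (simp add: norm_divide norm_mult)
        then have "cmod (1 / (2 * of_real pi)) * (CN * (?e * ?N j)) \<le> 1 * (CN * (?e * ?N j))"
          using CN(1) e1 N0[of j] by (intro mult_right_mono mult_nonneg_nonneg) simp_all
        moreover have "C1 * ?N j \<le> C1 * (?e * ?N j)" "C6 * ?N j \<le> C6 * (?e * ?N j)"
          using C1(1) C6(1) NE by (intro mult_left_mono; simp)+
        ultimately show "2 * (2 * (C1 * ?N j + C6 * ?N j) + cmod (1 / (2 * of_real pi)) * (CN * (?e * ?N j))) \<le> H * (?e * ?N j)"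
          unfolding H_def mult.assoc distrib_right distrib_left by linarith
      qed simp
    qed
    have "half_line_bound s (\<lambda>x. (w1 0 x + w6 0 x + 1 / (2 * of_real pi) * ?nr 0 x) + (w1 1 x + w6 1 x + 1 / (2 * of_real pi) * ?nr 1 x))
        (2 * (H * (?e * ?N 0) + H * (?e * ?N 1)))"
      by (rule half_line_bound_add[OF piece piece]) simp_all
    then have "half_line_bound s (\<lambda>x. v x t) (2 * H * ?e * (\<Sum>b=0..1. ?N b))"
    proof (rule half_line_bound_cong)
      show "AE x in lborel. x > 0 \<longrightarrow> (w1 0 x + w6 0 x + 1 / (2 * of_real pi) * ?nr 0 x) + (w1 1 x + w6 1 x + 1 / (2 * of_real pi) * ?nr 1 x) = v x t"
        using u by eventually_elim simp
      have "2 * (H * (?e * ?N 0) + H * (?e * ?N 1)) = 2 * H * ?e * (?N 0 + ?N 1)"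
      proof -
        have "2 * (h * (e * a) + h * (e * b)) = 2 * h * e * (a + b)" for h e a b :: real
          by (simp add: algebra_simps)
        then show ?thesis .
      qed
      also have "?N 0 + ?N 1 = (\<Sum>b=0..1. ?N b)" by simp
      finally show "2 * (H * (?e * ?N 0) + H * (?e * ?N 1)) \<le> 2 * H * ?e * (\<Sum>b=0..1. ?N b)" by simp
    qed
    from half_line_bound_sobolev_half_line[OF this]
    show "(\<lambda>x. v x t) \<in> sobolev_half_line s \<and>
        sobolev_half_line_norm s (\<lambda>x. v x t) \<le> 2 * H * ?e * (\<Sum>b=0..1. ?N b)" by simp
  qed
qed

end
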